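(* Let $k\ge1$ and $f\in C([0,1]^k)$. Then, as $n\to\infty$, $$A_k^n=\frac{1}{n^{k/2}}\sum_{i_1\ne\dots\ne i_k} f\left(\frac{i_1}{n},\dots,\frac{i_k}{n}\right)\varepsilon_{i_1}\cdots\varepsilon_{i_k}$$ converges in distribution to $f(\underbrace{\xi,\dots,\xi}_{k})$, the infinite-dimensional Hermite polynomial related to $f$. Here the sum is over all $k$-tuples $(i_1,\dots,i_k)$ of pairwise distinct indices with $1\le i_j\le n$.
   Context: $(\varepsilon_k)_{k\ge1}$ are independent random variables with $P(\varepsilon_k=1)=P(\varepsilon_k=-1)=\frac12$. Gaussian white noise $\xi$ on $L_2([0,1])$: a family of jointly Gaussian centered random variables $(g,\xi)$, $g\in L_2([0,1])$, with $\mathbb{E}(g,\xi)(h,\xi)=\int_0^1 g(s)h(s)\,ds$. Infinite-dimensional Hermite polynomial: let $\{\psi_m,m\ge1\}$ be an orthonormal basis of $L_2([0,1])$ consisting of functions $\psi_m\in C([0,1])$, and expand $$f(x_1,\dots,x_k)=\sum_{m_1,\dots,m_k=1}^\infty c_{m_1,\dots,m_k}\psi_{m_1}(x_1)\cdots\psi_{m_k}(x_k)$$ (convergence in $L_2([0,1]^k)$). Then $$f(\underbrace{\xi,\dots,\xi}_k)=\sum_{m_1,\dots,m_k=1}^\infty c_{m_1,\dots,m_k}(\psi_{m_1},\xi)*\dots*(\psi_{m_k},\xi)$$ (convergence in $L_2$ of the probability space), where $(\psi_{m_1},\xi)*\dots*(\psi_{m_k},\xi)$ is obtained from the product $(\psi_{m_1},\xi)\cdots(\psi_{m_k},\xi)$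 by collecting equal factors and replacing each power $(\psi_m,\xi)^r$ (with $r$ the number of times $m$ occurs among $m_1,\dots,m_k$) by $H_r((\psi_m,\xi))$, where $H_r$ is the $r$-th Hermite polynomial (monic, orthogonal with respect to the standard Gaussian measure: $H_0=1$, $H_1(x)=x$, $H_{r+1}(x)=xH_r(x)-rH_{r-1}(x)$). *)

theory Defs
  imports "HOL-Probability.Probability"
begin

definition square_integrable :: "'a measure \<Rightarrow> ('a \<Rightarrow> real) \<Rightarrow> bool" where
  "square_integrable M g \<longleftrightarrow> g \<in> borel_measurable M \<and> integrable M (\<lambda>x. (g x)\<^sup>2)"

text \<open>
  Convergence of a (multiply indexed) series in the \<open>L\<^sub>2\<close> sense, along the finite subsets of the
  index set as for \<^const>\<open>has_sum\<close>. Square integrability of all functions is required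
  explicitly because the Bochner integral of a non-integrable function is 0.
\<close>

definition L2_has_sum ::
  "'a measure \<Rightarrow> ('i \<Rightarrow> 'a \<Rightarrow> real) \<Rightarrow> ('a \<Rightarrow> real) \<Rightarrow> 'i set \<Rightarrow> bool" where
  "L2_has_sum M F g A \<longleftrightarrow>
     (\<forall>i\<in>A. square_integrable M (F i)) \<and> square_integrable M g \<and>
     ((\<lambda>S. \<integral>x. ((\<Sum>i\<in>S. F i x) - g x)\<^sup>2 \<partial>M) \<longlongrightarrow> 0) (finite_subsets_at_top A)"

abbreviation unit_interval :: "real measure" where
  "unit_interval \<equiv> restrict_space lborel {0..1}"

text \<open>
  A point \<open>(x\<^sub>1, \<dots>, x\<^sub>k)\<close> of \<open>[0,1]\<^sup>k\<close> is an extensional function on \<open>{1..k}\<close>. On this set the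
  product topology of the type \<^typ>\<open>nat \<Rightarrow> real\<close> induces the Euclidean topology of the cube.
\<close>

abbreviation cube :: "nat \<Rightarrow> (nat \<Rightarrow> real) set" where
  "cube k \<equiv> {1..k} \<rightarrow>\<^sub>E {0..1}"

abbreviation cube_measure :: "nat \<Rightarrow> (nat \<Rightarrow> real) measure" where
  "cube_measure k \<equiv> Pi\<^sub>M {1..k} (\<lambda>_. unit_interval)"

definition rademacher_sequence :: "'a measure \<Rightarrow> (nat \<Rightarrow> 'a \<Rightarrow> real) \<Rightarrow> bool" where
  "rademacher_sequence M \<epsilon> \<longleftrightarrow>
     prob_space M \<and> prob_space.indep_vars M (\<lambda>_. borel) \<epsilon> {1..} \<and>
     (\<forall>i\<ge>1. measure M {\<omega> \<in> space M. \<epsilon> i \<omega> = 1} = 1 / 2 \<and>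
             measure M {\<omega> \<in> space M. \<epsilon> i \<omega> = -1} = 1 / 2)"

text \<open>Centered Gaussian variables may be degenerate, so that joint Gaussianity can be expressed
  by all finite linear combinations being Gaussian.\<close>

definition centered_gaussian :: "'a measure \<Rightarrow> ('a \<Rightarrow> real) \<Rightarrow> bool" where
  "centered_gaussian N X \<longleftrightarrow>
     (\<exists>\<sigma>>0. distributed N lborel X (normal_density 0 \<sigma>)) \<or>
     (X \<in> borel_measurable N \<and> (AE \<omega> in N. X \<omega> = 0))"

text \<open>The noise is indexed by functions rather than by classes modulo null sets; the covariance
  forces \<open>\<xi> g = \<xi> h\<close> almost surely whenever \<open>g = h\<close> almost everywhere on \<open>[0,1]\<close>.\<close>

definition white_noise :: "'b measure \<Rightarrow> ((real \<Rightarrow> real) \<Rightarrow> 'b \<Rightarrow> real) \<Rightarrow> bool" where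
  "white_noise N \<xi> \<longleftrightarrow>
     prob_space N \<and>
     (\<forall>G a. finite G \<and> (\<forall>g\<in>G. square_integrable unit_interval g) \<longrightarrow>
        centered_gaussian N (\<lambda>\<omega>. \<Sum>g\<in>G. a g * \<xi> g \<omega>)) \<and>
     (\<forall>g h. square_integrable unit_interval g \<and> square_integrable unit_interval h \<longrightarrow>
        (\<integral>\<omega>. \<xi> g \<omega> * \<xi> h \<omega> \<partial>N) = (\<integral>s. g s * h s \<partial>unit_interval))"

definition orthonormal_basis :: "(nat \<Rightarrow> real \<Rightarrow> real) \<Rightarrow> bool" where
  "orthonormal_basis \<psi> \<longleftrightarrow>
     (\<forall>m\<ge>1. square_integrable unit_interval (\<psi> m)) \<and>
     (\<forall>l\<ge>1. \<forall>m\<ge>1. (\<integral>s. \<psi> l s * \<psi> m s \<partial>unit_interval) = (if l = m then 1 else 0)) \<and>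
     (\<forall>g. square_integrable unit_interval g \<longrightarrow>
        (\<exists>a. L2_has_sum unit_interval (\<lambda>m s. a m * \<psi> m s) g {1..}))"

fun hermite :: "nat \<Rightarrow> real \<Rightarrow> real" where
  "hermite 0 x = 1"
| "hermite (Suc 0) x = x"
| "hermite (Suc (Suc r)) x = x * hermite (Suc r) x - real (Suc r) * hermite r x"

text \<open>\<open>(\<psi>\<^bsub>m 1\<^esub>, \<xi>) * \<dots> * (\<psi>\<^bsub>m k\<^esub>, \<xi>)\<close>: one factor per distinct index, with its multiplicity.\<close>

definition hermite_product ::
  "((real \<Rightarrow> real) \<Rightarrow> 'b \<Rightarrow> real) \<Rightarrow> (nat \<Rightarrow> real \<Rightarrow> real) \<Rightarrow> nat \<Rightarrow> (nat \<Rightarrow> nat) \<Rightarrow> 'b \<Rightarrow> real"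
  where
  "hermite_product \<xi> \<psi> k m \<omega> =
     (\<Prod>l\<in>m ` {1..k}. hermite (card {j \<in> {1..k}. m j = l}) (\<xi> (\<psi> l) \<omega>))"

text \<open>\<open>Y\<close> is a version of \<open>f(\<xi>, \<dots>, \<xi>)\<close>, which as an \<open>L\<^sub>2\<close> limit is determined almost surely.\<close>

definition is_hermite_polynomial ::
  "'b measure \<Rightarrow> ((real \<Rightarrow> real) \<Rightarrow> 'b \<Rightarrow> real) \<Rightarrow> (nat \<Rightarrow> real \<Rightarrow> real) \<Rightarrow> nat \<Rightarrow>
   ((nat \<Rightarrow> real) \<Rightarrow> real) \<Rightarrow> ('b \<Rightarrow> real) \<Rightarrow> bool" where
  "is_hermite_polynomial N \<xi> \<psi> k f Y \<longleftrightarrow>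
     (\<exists>c. L2_has_sum (cube_measure k) (\<lambda>m x. c m * (\<Prod>j\<in>{1..k}. \<psi> (m j) (x j))) f
            ({1..k} \<rightarrow>\<^sub>E {1..}) \<and>
          L2_has_sum N (\<lambda>m \<omega>. c m * hermite_product \<xi> \<psi> k m \<omega>) Y ({1..k} \<rightarrow>\<^sub>E {1..}))"

definition rademacher_chaos ::
  "(nat \<Rightarrow> 'a \<Rightarrow> real) \<Rightarrow> nat \<Rightarrow> ((nat \<Rightarrow> real) \<Rightarrow> real) \<Rightarrow> nat \<Rightarrow> 'a \<Rightarrow> real" where
  "rademacher_chaos \<epsilon> k f n \<omega> =
     1 / real n powr (real k / 2) *
     (\<Sum>i | i \<in> {1..k} \<rightarrow>\<^sub>E {1..n} \<and> inj_on i {1..k}.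
        f (\<lambda>j\<in>{1..k}. real (i j) / real n) * (\<Prod>j\<in>{1..k}. \<epsilon> (i j) \<omega>))"

end

theory Submission imports Defs
begin

text \<open>
  For a finite linear combination of products of basis functions the off-diagonal sum satisfies,
  because \<open>\<epsilon>\<^sub>i\<^sup>2 = 1\<close>, the recursion of the Hermite polynomials up to errors of order
  \<open>1/n\<close>. It is therefore asymptotically a Hermite product evaluated at the linear forms
  \<open>n\<^bsup>-1/2\<^esup> \<Sum>\<^sub>i \<psi>\<^sub>l(i/n) \<epsilon>\<^sub>i\<close>, and these are jointly asymptotically standard
  Gaussian. The bound \<open>E (A\<^sub>k\<^sup>n)\<^sup>2 \<le> k\<^sup>k n\<^bsup>-k\<^esup> \<Sum> f(i/n)\<^sup>2\<close>, whose right-hand side tends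
  to \<open>k\<^sup>k \<parallel>f\<parallel>\<^sup>2\<close>, extends the convergence to all continuous \<open>f\<close>; by Fatou's lemma it passes to
  the limits, which gives the convergence of the Hermite series.
\<close>

text \<open>\<open>f\<close> need not be symmetric, so different tuples with the same image interact
  in the second moment; at most \<open>k^k\<close> tuples share an image, which is the origin of the
  constant. In the recursion, two colliding indices leave a Riemann sum of a product of two basis
  functions, tending to the Kronecker delta that stands behind the term \<open>- r H_(r-1)\<close>.
  A third collision costs a factor \<open>1/n\<close> but creates a product of three basis
  functions, so the errors have to be controlled for arbitrary continuous factors; tightness from
  the second moment bound does this. The main obstacle is to pass from linear forms to polynomials
  of them, since joint characteristic functions do not give the transform of a polynomial directly.
  The polynomial is cut off, its exponential is expanded in a Taylor series on the compact support,
  and monomials times cutoffs become products of bounded continuous functions of one coordinate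
  each. For these, Levy's one-dimensional theorem is applied coordinate by coordinate, the other
  factors acting as a bounded weight. Tightness then removes the cutoff.\<close>

subsection \<open>Riemann sums on the cube\<close>

abbreviation (input) cube_on :: "nat set \<Rightarrow> (nat \<Rightarrow> real) set" where
  "cube_on J \<equiv> J \<rightarrow>\<^sub>E {0..1}"

abbreviation (input) cubeM :: "nat set \<Rightarrow> (nat \<Rightarrow> real) measure" where
  "cubeM J \<equiv> Pi\<^sub>M J (\<lambda>_. unit_interval)"

lemma prob_space_unit_interval: "prob_space unit_interval"
  by (auto intro!: prob_spaceI simp: space_restrict_space emeasure_restrict_space)

interpretation unit: prob_space unit_interval
  by (rule prob_space_unit_interval)

interpretation cube: product_sigma_finite "\<lambda>_::nat. unit_interval"
  by unfold_locales

lemma space_cube: "space (cubeM J) = (cube_on J)"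
  by (simp add: space_PiM space_restrict_space)

text \<open>Rounding up to the grid of mesh \<open>1/n\<close>. For \<open>n \<ge> 1\<close> and
  \<open>x\<close> in \<open>[0,1]\<close> the \<open>max 1\<close> matters only at
  \<open>x = 0\<close>, which joins the first cell so that the values stay in
  \<open>{1..n}\<close>.\<close>

definition cell :: "nat \<Rightarrow> real \<Rightarrow> nat" where
  "cell n x = max 1 (nat \<lceil>real n * x\<rceil>)"

lemma cell_mem:
  assumes "n \<ge> 1" "x \<in> {0..1}"
  shows "cell n x \<in> {1..n}"
proof -
  have "real n * x \<le> real n" using assms by (simp add: mult_left_le)
  then have "nat \<lceil>real n * x\<rceil> \<le> n" by linarith
  then show ?thesis using assms by (auto simp: cell_def)
qed

lemma cell_close:
  assumes "n \<ge> 1" "x \<in> {0..1}"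
  shows "\<bar>real (cell n x) / real n - x\<bar> \<le> 1 / real n"
proof -
  have "\<bar>real (cell n x) - real n * x\<bar> \<le> 1"
  proof (cases "x = 0")
    case False
    then have "0 < real n * x" using assms by auto
    then have "nat \<lceil>real n * x\<rceil> \<ge> 1" by linarith
    then have "real (cell n x) = of_int \<lceil>real n * x\<rceil>"
      using \<open>0 < real n * x\<close> by (auto simp: cell_def max_def)
    then show ?thesis by linarith
  qed (simp add: cell_def)
  moreover have "real (cell n x) / real n - x = (real (cell n x) - real n * x) / real n"
    using assms by (simp add: field_simps)
  ultimately show ?thesis
    using assms by (simp add: divide_right_mono)
qed

lemma cell_grid_mem:
  assumes "n \<ge> 1" "i \<in> {1..n}"
  shows "real i / real n \<in> {0..1}"
  using assms by (auto simp: divide_le_eq)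

lemma measurable_cell [measurable]: "cell n \<in> borel \<rightarrow>\<^sub>M count_space UNIV"
  unfolding cell_def by measurable

lemma cell_eq_iff:
  assumes "v \<in> {1..n}"
  shows "{x \<in> {0..1}. cell n x = v} =
    (if v = 1 then {0..1 / real n} else {(real v - 1) / real n<..real v / real n})"
proof -
  have n: "real n > 0" using assms by auto
  have v: "real v \<le> real n" "1 \<le> real v" using assms by auto
  have *: "cell n x = v \<longleftrightarrow> (if v = 1 then real n * x \<le> 1 else real v - 1 < real n * x \<and> real n * x \<le> real v)"
    if "x \<ge> 0" for x
    using assms that unfolding cell_def max_def by (auto split: if_splits) linarith+
  have "(x \<in> {0..1} \<and> cell n x = v) \<longleftrightarrow>
    x \<in> (if v = 1 then {0..1 / real n} else {(real v - 1) / real n<..real v / real n})" for x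
  proof (cases "v = 1")
    case True
    have "real n * x \<le> 1 \<longleftrightarrow> x \<le> 1 / real n" using n by (simp add: field_simps)
    moreover have "1 / real n \<le> 1" using v True by simp
    ultimately show ?thesis using * True by auto
  next
    case False
    have "real n * x \<le> real v \<longleftrightarrow> x \<le> real v / real n"
      "real v - 1 < real n * x \<longleftrightarrow> (real v - 1) / real n < x" using n by (auto simp: field_simps)
    moreover have "real v / real n \<le> 1" "(real v - 1) / real n \<ge> 0" using v by simp_all
    ultimately show ?thesis using *[of x] False by auto
  qed
  then show ?thesis by blast
qed

lemma integral_cell:
  assumes "v \<in> {1..n}"
  shows "(\<integral>x. indicator {v} (cell n x) \<partial>unit_interval) = 1 / real n"
proof -
  have "(\<integral>x. indicator {v} (cell n x) \<partial>unit_interval) =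
     (\<integral>x. indicator {x \<in> {0..1}. cell n x = v} x \<partial>unit_interval)"
    by (rule Bochner_Integration.integral_cong) (auto simp: indicator_def space_restrict_space)
  also have "\<dots> = measure unit_interval ({x \<in> {0..1}. cell n x = v} \<inter> {0..1})"
    by (simp add: space_restrict_space)
  also have "\<dots> = measure lborel {x \<in> {0..1}. cell n x = v}"
    by (subst measure_restrict_space) (auto intro!: arg_cong[where f="measure lborel"])
  also have "\<dots> = 1 / real n"
    using assms unfolding cell_eq_iff[OF assms] by (auto simp: field_simps)
  finally show ?thesis .
qed

text \<open>Exactly one tuple, the tuple of cells of \<open>x\<close>, has no vanishing factor. The
  product form serves twice: Fubini applies to it, and it exhibits step functions as combinations of
  tensors.\<close>

lemma step_eq_sum:
  fixes F :: "(nat \<Rightarrow> nat) \<Rightarrow> real"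
  assumes J: "finite J" and n: "n \<ge> 1" and x: "x \<in> space (cubeM J)"
  shows "F (\<lambda>j\<in>J. cell n (x j)) =
     (\<Sum>i\<in>J \<rightarrow>\<^sub>E {1..n}. F i * (\<Prod>j\<in>J. indicator {i j} (cell n (x j))))"
proof -
  let ?y = "\<lambda>j\<in>J. cell n (x j)"
  have y: "?y \<in> J \<rightarrow>\<^sub>E {1..n}"
    using x cell_mem[OF n] by (auto simp: space_cube PiE_iff)
  have fin: "finite (J \<rightarrow>\<^sub>E {1..n})" using J by (simp add: finite_PiE)
  have "(\<Prod>j\<in>J. indicator {i j} (cell n (x j)) :: real) = (if i = ?y then 1 else 0)"
    if i: "i \<in> J \<rightarrow>\<^sub>E {1..n}" for i
  proof (cases "i = ?y")
    case False
    then obtain j where "j \<in> J" "i j \<noteq> cell n (x j)"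
      using PiE_ext[OF i y] by auto
    then show ?thesis using False J by (auto simp: prod_zero_iff indicator_def)
  qed auto
  then have "(\<Sum>i\<in>J \<rightarrow>\<^sub>E {1..n}. F i * (\<Prod>j\<in>J. indicator {i j} (cell n (x j)))) =
    (\<Sum>i\<in>J \<rightarrow>\<^sub>E {1..n}. if i = ?y then F i else 0)"
    by (intro sum.cong) auto
  also have "\<dots> = F ?y" using y fin by (simp add: sum.delta)
  finally show ?thesis ..
qed

lemma measurable_indicator_cell [measurable]:
  "(\<lambda>x. indicator {v} (cell n x) :: real) \<in> borel_measurable borel"
  by (rule measurable_compose[OF measurable_cell]) simp

text \<open>By Fubini every box of cells has measure \<open>1 / n ^ card J\<close>, so integrals of
  step functions are exactly Riemann sums. Convergence of Riemann sums thereby becomes a matter of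
  dominated convergence.\<close>

lemma
  fixes F :: "(nat \<Rightarrow> nat) \<Rightarrow> real"
  assumes J: "finite J" and n: "n \<ge> 1"
  shows integrable_step: "integrable (cubeM J) (\<lambda>x. F (\<lambda>j\<in>J. cell n (x j)))"
    and integral_step: "(\<integral>x. F (\<lambda>j\<in>J. cell n (x j)) \<partial>cubeM J) =
      (\<Sum>i\<in>J \<rightarrow>\<^sub>E {1..n}. F i) / real n ^ card J"
proof -
  let ?P = "cubeM J"
  have int1: "integrable unit_interval (\<lambda>x. indicator {v} (cell n x) :: real)" for v
  proof (rule unit.integrable_const_bound[where B=1])
    show "(\<lambda>x. indicator {v} (cell n x) :: real) \<in> borel_measurable unit_interval"
      by (intro measurable_restrict_space1) simp
  qed auto
  have int: "integrable ?P (\<lambda>x. \<Prod>j\<in>J. indicator {i j} (cell n (x j)) :: real)" for i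
    by (rule cube.product_integrable_prod[OF J int1])
  have val: "(\<integral>x. (\<Prod>j\<in>J. indicator {i j} (cell n (x j))) \<partial>?P) = (1 / real n ^ card J :: real)"
    if "i \<in> J \<rightarrow>\<^sub>E {1..n}" for i
    using that by (subst cube.product_integral_prod[OF J int1])
      (auto simp: integral_cell PiE_iff power_one_over)
  note eq = step_eq_sum[OF J n]
  have i2: "integrable ?P (\<lambda>x. \<Sum>i\<in>J \<rightarrow>\<^sub>E {1..n}. F i * (\<Prod>j\<in>J. indicator {i j} (cell n (x j))))"
    by (intro Bochner_Integration.integrable_sum integrable_mult_right int)
  show "integrable ?P (\<lambda>x. F (\<lambda>j\<in>J. cell n (x j)))"
    using i2 by (subst Bochner_Integration.integrable_cong[OF refl eq]) auto
  have "(\<integral>x. F (\<lambda>j\<in>J. cell n (x j)) \<partial>?P) =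
     (\<integral>x. (\<Sum>i\<in>J \<rightarrow>\<^sub>E {1..n}. F i * (\<Prod>j\<in>J. indicator {i j} (cell n (x j)))) \<partial>?P)"
    by (rule Bochner_Integration.integral_cong[OF refl eq])
  also have "\<dots> = (\<Sum>i\<in>J \<rightarrow>\<^sub>E {1..n}. F i * (1 / real n ^ card J))"
    by (subst Bochner_Integration.integral_sum)
      (auto intro!: integrable_mult_right int sum.cong simp: val)
  finally show "(\<integral>x. F (\<lambda>j\<in>J. cell n (x j)) \<partial>?P) = (\<Sum>i\<in>J \<rightarrow>\<^sub>E {1..n}. F i) / real n ^ card J"
    by (simp add: sum_divide_distrib)
qed

lemma bounded_on_cube:
  fixes f :: "(nat \<Rightarrow> real) \<Rightarrow> real"
  assumes "continuous_on (cube_on J) f"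
  obtains B where "B \<ge> 0" "\<And>x. x \<in> cube_on J \<Longrightarrow> \<bar>f x\<bar> \<le> B"
proof -
  \<comment> \<open>As a set of total functions the cube is a product over \<open>UNIV\<close> with
    one-point factors \<open>{undefined}\<close> outside \<open>J\<close>; Tychonoff's theorem then
    gives compactness.\<close>
  have "J \<rightarrow>\<^sub>E {0..1::real} = PiE UNIV (\<lambda>j. if j \<in> J then {0..1} else {undefined})"
    by (auto simp: PiE_iff extensional_def split: if_splits)
  then have "compactin (product_topology (\<lambda>_. euclidean) UNIV) (J \<rightarrow>\<^sub>E {0..1::real})"
    by (auto simp: compactin_PiE)
  then have "compact (J \<rightarrow>\<^sub>E {0..1::real})"
    by (simp add: euclidean_product_topology)
  then have "bounded (f ` (cube_on J))"
    using assms compact_continuous_image compact_imp_bounded by blast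
  then obtain B where "\<And>x. x \<in> cube_on J \<Longrightarrow> \<bar>f x\<bar> \<le> B"
    by (auto simp: bounded_iff)
  then show ?thesis using that[of "max B 0"] by (meson max.cobounded2 max.coboundedI1)
qed

definition grid :: "nat set \<Rightarrow> nat \<Rightarrow> (nat \<Rightarrow> nat) \<Rightarrow> nat \<Rightarrow> real" where
  "grid J n i = (\<lambda>j\<in>J. real (i j) / real n)"

lemma grid_mem: "i \<in> J \<rightarrow>\<^sub>E {1..n} \<Longrightarrow> grid J n i \<in> cube_on J"
  by (auto simp: grid_def PiE_iff divide_le_eq)

abbreviation (input) snap :: "nat set \<Rightarrow> nat \<Rightarrow> (nat \<Rightarrow> real) \<Rightarrow> nat \<Rightarrow> real" where
  "snap J n x \<equiv> grid J n (\<lambda>j\<in>J. cell n (x j))"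

text \<open>Coordinatewise convergence from \<open>cell_close\<close> is convergence in the product
  topology; outside \<open>J\<close> both sides are constantly \<open>undefined\<close>. The shift
  to \<open>Suc n\<close> keeps the grid nonempty.\<close>

lemma step_tendsto:
  fixes f :: "(nat \<Rightarrow> real) \<Rightarrow> real"
  assumes f: "continuous_on (cube_on J) f" and x: "x \<in> cube_on J"
  shows "(\<lambda>n. f (snap J (Suc n) x)) \<longlonglongrightarrow> f x"
proof -
  have "(\<lambda>n. snap J (Suc n) x j) \<longlonglongrightarrow> x j" for j
  proof (cases "j \<in> J")
    case True
    have "(\<lambda>n. real (cell (Suc n) (x j)) / real (Suc n) - x j) \<longlonglongrightarrow> 0"
    proof (rule Lim_null_comparison)
      show "\<forall>\<^sub>F n in sequentially. norm (real (cell (Suc n) (x j)) / real (Suc n) - x j) \<le> 1 / real (Suc n)"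
        using cell_close[of "Suc _" "x j"] True x by (intro always_eventually) (auto simp: PiE_iff)
      show "(\<lambda>n. 1 / real (Suc n)) \<longlonglongrightarrow> 0"
        using LIMSEQ_inverse_real_of_nat by (simp add: inverse_eq_divide)
    qed
    then show ?thesis using True by (simp add: grid_def LIM_zero_iff)
  next
    case False
    then show ?thesis using x by (simp add: grid_def PiE_iff extensional_def)
  qed
  then have "limitin (product_topology (\<lambda>_. euclidean) UNIV)
      (\<lambda>n. snap J (Suc n) x) x sequentially"
    by (subst limitin_componentwise) auto
  then have lim: "(\<lambda>n. snap J (Suc n) x) \<longlonglongrightarrow> x"
    by (simp add: euclidean_product_topology)
  have "snap J (Suc n) x \<in> cube_on J" for n
    using x cell_mem[of "Suc n"] by (intro grid_mem) (auto simp: PiE_iff)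
  then show ?thesis
    using continuous_on_tendsto_compose[OF f lim x] by auto
qed

text \<open>All four claims come from the step functions: measurability because \<open>f\<close> is
  their pointwise limit, the two limits by dominated convergence with the constant bound supplied by
  compactness.\<close>

lemma
  fixes f :: "(nat \<Rightarrow> real) \<Rightarrow> real"
  assumes J: "finite J" and f: "continuous_on (cube_on J) f"
  shows measurable_on_cube: "f \<in> borel_measurable (cubeM J)"
    and integrable_on_cube: "integrable (cubeM J) f"
    and step_tendsto_L2: "(\<lambda>n. \<integral>x. (f (snap J (Suc n) x) - f x)\<^sup>2
        \<partial>cubeM J) \<longlonglongrightarrow> 0"
    and riemann_cube: "(\<lambda>n. (\<Sum>i\<in>J \<rightarrow>\<^sub>E {1..n}. f (grid J n i)) / real n ^ card J)
        \<longlonglongrightarrow> (\<integral>x. f x \<partial>cubeM J)"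
proof -
  let ?P = "cubeM J"
  interpret P: prob_space ?P by (intro prob_space_PiM prob_space_unit_interval)
  let ?s = "\<lambda>n x. f (snap J (Suc n) x)"
  obtain B where B: "B \<ge> 0" "\<And>x. x \<in> cube_on J \<Longrightarrow> \<bar>f x\<bar> \<le> B"
    using bounded_on_cube[OF f] by blast
  have s_int: "integrable ?P (?s n)" for n
    using integrable_step[OF J, of "Suc n" "\<lambda>i. f (grid J (Suc n) i)"] by simp
  then have s_meas [measurable]: "?s n \<in> borel_measurable ?P" for n by auto
  have mem: "snap J (Suc n) x \<in> cube_on J" if "x \<in> space ?P" for x n
    using that cell_mem[of "Suc n"] by (intro grid_mem) (auto simp: PiE_iff space_cube)
  have sB: "\<bar>?s n x\<bar> \<le> B" if "x \<in> space ?P" for x n using B(2) mem[OF that] by blast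
  have fB: "\<bar>f x\<bar> \<le> B" if "x \<in> space ?P" for x using B(2) that by (simp add: space_cube)
  have lim: "(\<lambda>n. ?s n x) \<longlonglongrightarrow> f x" if "x \<in> space ?P" for x
    using step_tendsto[OF f] that by (simp add: space_cube)
  show meas [measurable]: "f \<in> borel_measurable ?P"
    by (rule borel_measurable_LIMSEQ_real[OF lim s_meas])
  show "integrable ?P f"
    by (rule P.integrable_const_bound[where B=B]) (auto simp: fB)
  have "(\<lambda>n. \<integral>x. (?s n x - f x)\<^sup>2 \<partial>?P) \<longlonglongrightarrow> (\<integral>x. 0 \<partial>?P)"
  proof (rule integral_dominated_convergence[where w="\<lambda>_. (2 * B)\<^sup>2"])
    show "AE x in ?P. (\<lambda>n. (?s n x - f x)\<^sup>2) \<longlonglongrightarrow> 0"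
    proof (rule AE_I2)
      fix x assume "x \<in> space ?P"
      from tendsto_power[OF tendsto_diff[OF lim[OF this] tendsto_const], of "f x" 2]
      show "(\<lambda>n. (?s n x - f x)\<^sup>2) \<longlonglongrightarrow> 0" by simp
    qed
    show "AE x in ?P. norm ((?s n x - f x)\<^sup>2) \<le> (2 * B)\<^sup>2" for n
    proof (rule AE_I2)
      fix x assume x: "x \<in> space ?P"
      have "\<bar>?s n x - f x\<bar> \<le> 2 * B" using sB[OF x, of n] fB[OF x] by linarith
      then show "norm ((?s n x - f x)\<^sup>2) \<le> (2 * B)\<^sup>2"
        using power_mono[of "\<bar>?s n x - f x\<bar>" "2 * B" 2] by simp
    qed
  qed (auto simp del: power_mult_distrib)
  then show "(\<lambda>n. \<integral>x. (?s n x - f x)\<^sup>2 \<partial>?P) \<longlonglongrightarrow> 0" by simp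
  have "(\<lambda>n. \<integral>x. ?s n x \<partial>?P) \<longlonglongrightarrow> (\<integral>x. f x \<partial>?P)"
    by (rule integral_dominated_convergence[where w="\<lambda>_. B"]) (auto simp: sB lim)
  then have "(\<lambda>n. (\<Sum>i\<in>J \<rightarrow>\<^sub>E {1..Suc n}. f (grid J (Suc n) i)) / real (Suc n) ^ card J) \<longlonglongrightarrow> (\<integral>x. f x \<partial>?P)"
    using integral_step[OF J, of "Suc _" "\<lambda>i. f (grid J (Suc _) i)"] by simp
  then show "(\<lambda>n. (\<Sum>i\<in>J \<rightarrow>\<^sub>E {1..n}. f (grid J n i)) / real n ^ card J) \<longlonglongrightarrow> (\<integral>x. f x \<partial>?P)"
    by (rule LIMSEQ_imp_Suc)
qed

text \<open>The interval is treated as the cube over the index set \<open>{1}\<close>.\<close>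

lemma riemann_unit_interval:
  fixes h :: "real \<Rightarrow> real"
  assumes h: "continuous_on {0..1} h"
  shows "(\<lambda>n. (\<Sum>v\<in>{1..n}. h (real v / real n)) / real n) \<longlonglongrightarrow> (\<integral>x. h x \<partial>unit_interval)"
proof -
  have c: "continuous_on ({1::nat} \<rightarrow>\<^sub>E {0..1}) (\<lambda>x. h (x 1))"
    by (rule continuous_on_compose2[OF h])
      (auto intro: continuous_on_product_then_coordinatewise[OF continuous_on_id])
  have hm: "h \<in> borel_measurable unit_interval"
    using borel_measurable_continuous_on_restrict[OF h]
    by (simp add: measurable_cong_sets[OF sets_restrict_space_cong[OF sets_lborel] refl])
  have "(\<Sum>i\<in>{1::nat} \<rightarrow>\<^sub>E {1..n}. h (grid {1} n i 1)) = (\<Sum>v\<in>{1..n}. h (real v / real n))" for n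
    by (rule sum.reindex_bij_witness[where j="\<lambda>i. i 1" and i="\<lambda>v. (\<lambda>j\<in>{1::nat}. v)"])
      (auto simp: grid_def PiE_iff extensional_def)
  with riemann_cube[OF _ c] cube.product_integral_singleton[OF hm, of 1] show ?thesis by simp
qed

subsection \<open>The tensor basis\<close>

lemma square_integrable_mult:
  assumes "square_integrable M f" "square_integrable M g"
  shows "integrable M (\<lambda>x. f x * g x)"
proof (rule Bochner_Integration.integrable_bound)
  show "integrable M (\<lambda>x. (f x)\<^sup>2 + (g x)\<^sup>2)"
    using assms by (auto simp: square_integrable_def)
  show "AE x in M. norm (f x * g x) \<le> norm ((f x)\<^sup>2 + (g x)\<^sup>2)"
  proof (rule AE_I2)
    fix x
    have "0 \<le> (\<bar>f x\<bar> - \<bar>g x\<bar>)\<^sup>2" by simp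
    then have "2 * (\<bar>f x\<bar> * \<bar>g x\<bar>) \<le> (f x)\<^sup>2 + (g x)\<^sup>2" by (simp add: power2_diff)
    moreover have "0 \<le> \<bar>f x\<bar> * \<bar>g x\<bar>" by simp
    ultimately have "\<bar>f x\<bar> * \<bar>g x\<bar> \<le> (f x)\<^sup>2 + (g x)\<^sup>2" by linarith
    then show "norm (f x * g x) \<le> norm ((f x)\<^sup>2 + (g x)\<^sup>2)"
      by (simp add: abs_mult)
  qed
qed (use assms in \<open>auto simp: square_integrable_def\<close>)

lemma square_integrable_add:
  assumes "square_integrable M f" "square_integrable M g"
  shows "square_integrable M (\<lambda>x. f x + g x)"
  using assms square_integrable_mult[OF assms]
  by (auto simp: square_integrable_def power2_sum mult.assoc)

lemma square_integrable_cmult: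
  assumes "square_integrable M f"
  shows "square_integrable M (\<lambda>x. c * f x)"
  using assms by (auto simp: square_integrable_def power_mult_distrib)

lemma square_integrable_diff:
  assumes "square_integrable M f" "square_integrable M g"
  shows "square_integrable M (\<lambda>x. f x - g x)"
  using square_integrable_add[OF assms(1) square_integrable_cmult[OF assms(2), of "-1"]] by simp

lemma square_integrable_sum:
  assumes "\<And>i. i \<in> S \<Longrightarrow> square_integrable M (f i)"
  shows "square_integrable M (\<lambda>x. \<Sum>i\<in>S. f i x)"
  using assms
  by (induction S rule: infinite_finite_induct)
    (auto simp: square_integrable_add, auto simp: square_integrable_def)

text \<open>From \<open>(a + b)^2 \<le> 2 a^2 + 2 b^2\<close>; it replaces the triangle inequality
  and keeps all estimates free of square roots.\<close>

lemma integral_square_triangle: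
  assumes "square_integrable M f" "square_integrable M g" "square_integrable M h"
  shows "(\<integral>x. (f x - h x)\<^sup>2 \<partial>M) \<le> 2 * (\<integral>x. (f x - g x)\<^sup>2 \<partial>M) + 2 * (\<integral>x. (g x - h x)\<^sup>2 \<partial>M)"
proof -
  have "(\<integral>x. (f x - h x)\<^sup>2 \<partial>M) \<le> (\<integral>x. 2 * (f x - g x)\<^sup>2 + 2 * (g x - h x)\<^sup>2 \<partial>M)"
  proof (rule integral_mono)
    show "(f x - h x)\<^sup>2 \<le> 2 * (f x - g x)\<^sup>2 + 2 * (g x - h x)\<^sup>2" for x
    proof -
      have "0 \<le> ((f x - g x) - (g x - h x))\<^sup>2" by simp
      then show ?thesis by (simp add: power2_eq_square algebra_simps)
    qed
  qed (use assms square_integrable_diff[of M] in \<open>auto simp: square_integrable_def\<close>)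
  also have "\<dots> = 2 * (\<integral>x. (f x - g x)\<^sup>2 \<partial>M) + 2 * (\<integral>x. (g x - h x)\<^sup>2 \<partial>M)"
    using square_integrable_diff[OF assms(1,2)] square_integrable_diff[OF assms(2,3)]
    by (subst Bochner_Integration.integral_add) (auto simp: square_integrable_def)
  finally show ?thesis .
qed

definition tensor :: "nat set \<Rightarrow> (nat \<Rightarrow> real \<Rightarrow> real) \<Rightarrow> (nat \<Rightarrow> real) \<Rightarrow> real" where
  "tensor J g x = (\<Prod>j\<in>J. g j (x j))"

lemma
  assumes J: "finite J" and g: "\<And>j. j \<in> J \<Longrightarrow> square_integrable unit_interval (g j)"
  shows square_integrable_tensor: "square_integrable (cubeM J) (tensor J g)"
    and integral_tensor_square: "(\<integral>x. (tensor J g x)\<^sup>2 \<partial>cubeM J) =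
      (\<Prod>j\<in>J. \<integral>s. (g j s)\<^sup>2 \<partial>unit_interval)"
proof -
  have m: "g j \<in> borel_measurable unit_interval" "integrable unit_interval (\<lambda>s. (g j s)\<^sup>2)"
    if "j \<in> J" for j using g[OF that] by (auto simp: square_integrable_def)
  have "tensor J g \<in> borel_measurable (cubeM J)"
    unfolding tensor_def [abs_def]
    by (intro borel_measurable_prod measurable_compose[OF measurable_component_singleton] m)
  moreover have "integrable (cubeM J) (\<lambda>x. (tensor J g x)\<^sup>2)"
    unfolding tensor_def prod_power_distrib
    using J m(2) by (rule cube.product_integrable_prod)
  ultimately show "square_integrable (cubeM J) (tensor J g)"
    by (simp add: square_integrable_def)
  show "(\<integral>x. (tensor J g x)\<^sup>2 \<partial>cubeM J) =
      (\<Prod>j\<in>J. \<integral>s. (g j s)\<^sup>2 \<partial>unit_interval)"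
    unfolding tensor_def prod_power_distrib
    using J m(2) by (rule cube.product_integral_prod)
qed

lemma integral_tensor_mult:
  assumes J: "finite J" and "\<And>j. j \<in> J \<Longrightarrow> square_integrable unit_interval (g j)"
    and "\<And>j. j \<in> J \<Longrightarrow> square_integrable unit_interval (h j)"
  shows "(\<integral>x. tensor J g x * tensor J h x \<partial>cubeM J) =
      (\<Prod>j\<in>J. \<integral>s. g j s * h j s \<partial>unit_interval)"
  unfolding tensor_def prod.distrib[symmetric]
  using assms by (intro cube.product_integral_prod square_integrable_mult)

section \<open>The closed span of products of basis functions\<close>

locale onb =
  fixes \<psi> :: "nat \<Rightarrow> real \<Rightarrow> real"
  assumes onb: "orthonormal_basis \<psi>"
begin

abbreviation \<Psi> :: "nat set \<Rightarrow> (nat \<Rightarrow> nat) \<Rightarrow> (nat \<Rightarrow> real) \<Rightarrow> real" where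
  "\<Psi> J m \<equiv> tensor J (\<lambda>j. \<psi> (m j))"

abbreviation (input) comb ::
  "nat set \<Rightarrow> (nat \<Rightarrow> nat) set \<Rightarrow> ((nat \<Rightarrow> nat) \<Rightarrow> real) \<Rightarrow> (nat \<Rightarrow> real) \<Rightarrow> real" where
  "comb J S b \<equiv> \<lambda>x. \<Sum>m\<in>S. b m * \<Psi> J m x"

text \<open>Membership in the L2 closure of the span of the \<open>\<Psi> J m\<close>. The
  coefficients may change with \<open>e\<close>, so this is density only and not yet a series
  expansion.\<close>

definition approx :: "nat set \<Rightarrow> ((nat \<Rightarrow> real) \<Rightarrow> real) \<Rightarrow> bool" where
  "approx J F \<longleftrightarrow> square_integrable (cubeM J) F \<and>
     (\<forall>e>0. \<exists>S b. finite S \<and> S \<subseteq> J \<rightarrow>\<^sub>E {1..} \<and>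
        (\<integral>x. (F x - comb J S b x)\<^sup>2 \<partial>cubeM J) < e)"

lemma square_integrable_basis: "m \<ge> 1 \<Longrightarrow> square_integrable unit_interval (\<psi> m)"
  using onb by (simp add: orthonormal_basis_def)

lemma square_integrable_Psi:
  "finite J \<Longrightarrow> m \<in> J \<rightarrow>\<^sub>E {1..} \<Longrightarrow> square_integrable (cubeM J) (\<Psi> J m)"
  by (intro square_integrable_tensor square_integrable_basis) (auto simp: PiE_iff)

lemma square_integrable_sum_Psi:
  "finite J \<Longrightarrow> S \<subseteq> J \<rightarrow>\<^sub>E {1..} \<Longrightarrow>
    square_integrable (cubeM J) (comb J S b)"
  by (intro square_integrable_sum square_integrable_cmult square_integrable_Psi) auto

lemma approx_limit:
  assumes J: "finite J" and F: "square_integrable (cubeM J) F"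
    and lim: "\<And>e. e > 0 \<Longrightarrow> \<exists>G. approx J G \<and> (\<integral>x. (F x - G x)\<^sup>2 \<partial>cubeM J) < e"
  shows "approx J F"
  unfolding approx_def
proof (intro conjI F allI impI)
  fix e :: real assume "e > 0"
  \<comment> \<open>Quarters, because \<open>integral_square_triangle\<close> doubles each of the
    two errors.\<close>
  then obtain G where G: "approx J G" "(\<integral>x. (F x - G x)\<^sup>2 \<partial>cubeM J) < e / 4"
    using lim[of "e / 4"] by auto
  obtain S b where S: "finite S" "S \<subseteq> J \<rightarrow>\<^sub>E {1..}"
      "(\<integral>x. (G x - comb J S b x)\<^sup>2 \<partial>cubeM J) < e / 4"
    using G(1) \<open>e > 0\<close> unfolding approx_def by (meson divide_pos_pos zero_less_numeral)
  have "(\<integral>x. (F x - comb J S b x)\<^sup>2 \<partial>cubeM J) < e"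
    using integral_square_triangle[OF F _ square_integrable_sum_Psi[OF J S(2), of b], of G] G S(3)
    by (auto simp: approx_def)
  with S show "\<exists>S b. finite S \<and> S \<subseteq> J \<rightarrow>\<^sub>E {1..} \<and>
      (\<integral>x. (F x - comb J S b x)\<^sup>2 \<partial>cubeM J) < e" by blast
qed

lemma approx_zero: "approx J (\<lambda>_. 0)"
  unfolding approx_def by (auto simp: square_integrable_def intro!: exI[of _ "{}"])

lemma approx_cmult_add:
  assumes J: "finite J" and F: "approx J F" and G: "approx J G"
  shows "approx J (\<lambda>x. c * F x + G x)"
  unfolding approx_def
proof (intro conjI allI impI)
  let ?P = "cubeM J"
  have sF: "square_integrable ?P F" and sG: "square_integrable ?P G"
    using F G by (auto simp: approx_def)
  show "square_integrable ?P (\<lambda>x. c * F x + G x)"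
    by (intro square_integrable_add square_integrable_cmult sF sG)
  fix e :: real assume e: "e > 0"
  \<comment> \<open>After scaling by \<open>c\<close> the squared error of \<open>F\<close> is at
    most \<open>e / 4\<close>, and doubling leaves room for the error of \<open>G\<close>; the
    \<open>+ 1\<close> covers \<open>c = 0\<close>.\<close>
  have "e / (4 * (c\<^sup>2 + 1)) > 0" using e by (simp add: add_nonneg_pos)
  then obtain S b where S: "finite S" "S \<subseteq> J \<rightarrow>\<^sub>E {1..}"
      "(\<integral>x. (F x - comb J S b x)\<^sup>2 \<partial>?P) < e / (4 * (c\<^sup>2 + 1))"
    using F unfolding approx_def by blast
  obtain T d where T: "finite T" "T \<subseteq> J \<rightarrow>\<^sub>E {1..}"
      "(\<integral>x. (G x - comb J T d x)\<^sup>2 \<partial>?P) < e / 4"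
    using G e unfolding approx_def by (meson divide_pos_pos zero_less_numeral)
  define a where "a m = (if m \<in> S then c * b m else 0) + (if m \<in> T then d m else 0)" for m
  let ?F = "comb J S b" and ?G = "comb J T d"
  have sF': "square_integrable ?P ?F" and sG': "square_integrable ?P ?G"
    using square_integrable_sum_Psi[OF J S(2), of b] square_integrable_sum_Psi[OF J T(2), of d] by auto
  have a: "(\<Sum>m\<in>S \<union> T. a m * \<Psi> J m x) = c * ?F x + ?G x" for x
  proof -
    have "(\<Sum>m\<in>S \<union> T. a m * \<Psi> J m x) = (\<Sum>m\<in>S \<union> T. (if m \<in> S then c * b m * \<Psi> J m x else 0)) +
       (\<Sum>m\<in>S \<union> T. (if m \<in> T then d m * \<Psi> J m x else 0))"
      unfolding sum.distrib[symmetric] by (intro sum.cong) (auto simp: a_def algebra_simps)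
    also have "\<dots> = (\<Sum>m\<in>S. c * b m * \<Psi> J m x) + ?G x"
      using S(1) T(1) by (simp add: sum.If_cases Int_absorb1 Int_absorb2 Un_Int_eq)
    finally show ?thesis by (simp add: sum_distrib_left mult.assoc)
  qed
  have "(\<integral>x. ((c * F x + G x) - (c * ?F x + ?G x))\<^sup>2 \<partial>?P) \<le>
     2 * (\<integral>x. ((c * F x + G x) - (c * ?F x + G x))\<^sup>2 \<partial>?P) +
     2 * (\<integral>x. ((c * ?F x + G x) - (c * ?F x + ?G x))\<^sup>2 \<partial>?P)"
    by (intro integral_square_triangle square_integrable_add square_integrable_cmult sF sG sF' sG')
  also have "\<dots> = 2 * (c\<^sup>2 * (\<integral>x. (F x - ?F x)\<^sup>2 \<partial>?P)) + 2 * (\<integral>x. (G x - ?G x)\<^sup>2 \<partial>?P)"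
  proof -
    have "((c * F x + G x) - (c * ?F x + G x))\<^sup>2 = c\<^sup>2 * (F x - ?F x)\<^sup>2" for x
      by (simp add: power2_eq_square algebra_simps)
    then show ?thesis by simp
  qed
  also have "\<dots> < e"
  proof -
    have "c\<^sup>2 * (\<integral>x. (F x - ?F x)\<^sup>2 \<partial>?P) \<le> c\<^sup>2 * (e / (4 * (c\<^sup>2 + 1)))"
      using S(3) by (intro mult_left_mono) auto
    also have "\<dots> \<le> e / 4"
    proof -
      have "c\<^sup>2 + 1 > 0" by (simp add: add_nonneg_pos)
      then show ?thesis using e by (simp add: field_simps)
    qed
    finally show ?thesis using T(3) by simp
  qed
  finally show "\<exists>S b. finite S \<and> S \<subseteq> J \<rightarrow>\<^sub>E {1..} \<and>
      (\<integral>x. (c * F x + G x - comb J S b x)\<^sup>2 \<partial>?P) < e"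
    using S T by (intro exI[of _ "S \<union> T"] exI[of _ a]) (auto simp: a)
qed

lemma approx_sum:
  assumes "finite J" "\<And>i. i \<in> I \<Longrightarrow> approx J (F i)"
  shows "approx J (\<lambda>x. \<Sum>i\<in>I. c i * F i x)"
  using assms
  by (induction I rule: infinite_finite_induct) (auto simp: approx_zero approx_cmult_add)

text \<open>Basis factors are replaced by general factors one coordinate at a time, \<open>A\<close>
  being the set already replaced. Expanding the new factor \<open>g j0\<close> in the basis gives
  tensors with \<open>\<psi> l\<close> at \<open>j0\<close>, which the induction hypothesis covers
  with \<open>m(j0 := l)\<close> in place of \<open>m\<close>.\<close>

lemma approx_tensor_aux:
  assumes J: "finite J" and g: "\<And>j. j \<in> J \<Longrightarrow> square_integrable unit_interval (g j)"
    and A: "A \<subseteq> J" and m: "m \<in> J \<rightarrow>\<^sub>E {1..}"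
  shows "approx J (tensor J (\<lambda>j. if j \<in> A then g j else \<psi> (m j)))"
  using finite_subset[OF A J] A m
proof (induction A arbitrary: m rule: finite_induct)
  case empty
  then show ?case
    unfolding approx_def using J
    by (auto intro!: square_integrable_Psi exI[of _ "{m}"] exI[of _ "\<lambda>_. 1"])
next
  case (insert j0 A)
  let ?P = "cubeM J"
  define h where "h m j = (if j \<in> A then g j else \<psi> (m j))" for m :: "nat \<Rightarrow> nat" and j
  let ?h0 = "\<lambda>j. if j \<in> insert j0 A then g j else \<psi> (m j)"
  have j0: "j0 \<in> J" using insert by auto
  have mge: "m j \<ge> 1" if "j \<in> J" for j using insert.prems(2) that by (auto simp: PiE_iff)
  have sq: "square_integrable unit_interval (?h0 j)" if "j \<in> J" for j
    using that g square_integrable_basis mge by simp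
  \<comment> \<open>The squared norm of the factors other than \<open>j0\<close>. It multiplies the
    squared error made at \<open>j0\<close>, hence the accuracy \<open>e / (c + 1)\<close>
    below.\<close>
  define c where "c = (\<Prod>j\<in>J - {j0}. \<integral>s. (?h0 j s)\<^sup>2 \<partial>unit_interval)"
  have c: "c \<ge> 0" unfolding c_def by (intro prod_nonneg) auto
  show ?case
  proof (rule approx_limit[OF J square_integrable_tensor[OF J sq]])
    fix e :: real assume e: "e > 0"
    obtain a where a: "L2_has_sum unit_interval (\<lambda>l s. a l * \<psi> l s) (g j0) {1..}"
      using onb g[OF j0] unfolding orthonormal_basis_def by blast
    then have "\<forall>\<^sub>F S in finite_subsets_at_top {1..}.
        (\<integral>x. ((\<Sum>i\<in>S. a i * \<psi> i x) - g j0 x)\<^sup>2 \<partial>unit_interval) < e / (c + 1)"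
      unfolding L2_has_sum_def using e c by (intro order_tendstoD(2)) auto
    then obtain L where L: "finite L" "L \<subseteq> {1..}"
        "(\<integral>x. ((\<Sum>i\<in>L. a i * \<psi> i x) - g j0 x)\<^sup>2 \<partial>unit_interval) < e / (c + 1)"
      unfolding eventually_finite_subsets_at_top by blast
    let ?G = "\<lambda>x. \<Sum>l\<in>L. a l * tensor J (h (m(j0 := l))) x"
    have G: "approx J ?G"
    proof (rule approx_sum[OF J])
      fix l assume "l \<in> L"
      then have "m(j0 := l) \<in> J \<rightarrow>\<^sub>E {1..}"
        using insert.prems(2) L(2) j0 by (auto simp: PiE_iff extensional_def)
      from insert.IH[OF _ this] show "approx J (tensor J (h (m(j0 := l))))"
        using insert.prems(1) unfolding h_def[abs_def] by simp
    qed
    let ?d = "\<lambda>s. g j0 s - (\<Sum>l\<in>L. a l * \<psi> l s)"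
    \<comment> \<open>Only the factor at \<open>j0\<close> is changed, so the error is again a
      tensor and its squared norm factorises.\<close>
    have "tensor J ?h0 x - ?G x = tensor J (?h0(j0 := ?d)) x" for x
    proof -
      have split: "tensor J u x = u j0 (x j0) * (\<Prod>j\<in>J - {j0}. u j (x j))" for u
        unfolding tensor_def using J j0 by (simp add: prod.remove)
      have 1: "(\<Prod>j\<in>J - {j0}. h (m(j0 := l)) j (x j)) = (\<Prod>j\<in>J - {j0}. ?h0 j (x j))" for l
        by (intro prod.cong) (auto simp: h_def)
      have 2: "h (m(j0 := l)) j0 = \<psi> l" for l using insert.hyps by (simp add: h_def)
      have 3: "(\<Prod>j\<in>J - {j0}. (?h0(j0 := ?d)) j (x j)) = (\<Prod>j\<in>J - {j0}. ?h0 j (x j))"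
        by (intro prod.cong) auto
      have "?G x = (\<Sum>l\<in>L. a l * \<psi> l (x j0)) * (\<Prod>j\<in>J - {j0}. ?h0 j (x j))"
        unfolding split 1 2 by (simp add: sum_distrib_right mult.assoc)
      moreover have "tensor J ?h0 x = g j0 (x j0) * (\<Prod>j\<in>J - {j0}. ?h0 j (x j))"
        unfolding split by simp
      moreover have "tensor J (?h0(j0 := ?d)) x = ?d (x j0) * (\<Prod>j\<in>J - {j0}. ?h0 j (x j))"
        unfolding split 3 by simp
      ultimately show ?thesis by (simp add: algebra_simps)
    qed
    moreover have "(\<integral>x. (tensor J (?h0(j0 := ?d)) x)\<^sup>2 \<partial>?P) = (\<integral>s. (?d s)\<^sup>2 \<partial>unit_interval) * c"
    proof -
      have d: "square_integrable unit_interval ?d"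
        using L(2) by (intro square_integrable_diff g j0 square_integrable_sum
            square_integrable_cmult square_integrable_basis) auto
      have "(\<integral>x. (tensor J (?h0(j0 := ?d)) x)\<^sup>2 \<partial>?P) =
          (\<Prod>j\<in>J. \<integral>s. ((?h0(j0 := ?d)) j s)\<^sup>2 \<partial>unit_interval)"
        using d sq by (intro integral_tensor_square J) (simp only: fun_upd_apply split: if_split, blast)
      also have "\<dots> = (\<integral>s. (?d s)\<^sup>2 \<partial>unit_interval) *
          (\<Prod>j\<in>J - {j0}. \<integral>s. ((?h0(j0 := ?d)) j s)\<^sup>2 \<partial>unit_interval)"
        using J j0 by (simp add: prod.remove)
      also have "(\<Prod>j\<in>J - {j0}. \<integral>s. ((?h0(j0 := ?d)) j s)\<^sup>2 \<partial>unit_interval) = c"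
        unfolding c_def by (intro prod.cong) auto
      finally show ?thesis .
    qed
    moreover have "(\<integral>s. (?d s)\<^sup>2 \<partial>unit_interval) * c < e"
    proof -
      have "(\<integral>s. (?d s)\<^sup>2 \<partial>unit_interval) < e / (c + 1)"
        using L(3) by (simp add: power2_commute)
      then have "(\<integral>s. (?d s)\<^sup>2 \<partial>unit_interval) * c \<le> e / (c + 1) * c"
        using c by (intro mult_right_mono) auto
      also have "\<dots> < e" using c e by (simp add: field_simps)
      finally show ?thesis .
    qed
    ultimately show "\<exists>G. approx J G \<and> (\<integral>x. (tensor J ?h0 x - G x)\<^sup>2 \<partial>?P) < e"
      using G by (intro exI[of _ ?G]) auto
  qed auto
qed

lemma approx_tensor:
  assumes J: "finite J" and g: "\<And>j. j \<in> J \<Longrightarrow> square_integrable unit_interval (g j)"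
  shows "approx J (tensor J g)"
proof -
  have "tensor J (\<lambda>j. if j \<in> J then g j else \<psi> ((\<lambda>j\<in>J. 1) j)) = tensor J g"
    by (auto simp: tensor_def fun_eq_iff intro!: prod.cong)
  moreover have "approx J (tensor J (\<lambda>j. if j \<in> J then g j else \<psi> ((\<lambda>j\<in>J. 1) j)))"
    by (rule approx_tensor_aux[OF J g]) auto
  ultimately show ?thesis by simp
qed

text \<open>The step functions of \<open>f\<close> tend to \<open>f\<close> in L2, and each is a
  finite combination of tensors of cell indicators.\<close>

lemma approx_continuous:
  assumes J: "finite J" and f: "continuous_on (cube_on J) f"
  shows "approx J f"
proof (rule approx_limit[OF J])
  let ?P = "cubeM J"
  have "continuous_on (cube_on J) (\<lambda>x. (f x)\<^sup>2)" using f by (intro continuous_intros)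
  then show "square_integrable ?P f"
    using f J by (simp add: square_integrable_def measurable_on_cube integrable_on_cube)
  fix e :: real assume "e > 0"
  then have "\<forall>\<^sub>F n in sequentially.
      (\<integral>x. (f (snap J (Suc n) x) - f x)\<^sup>2 \<partial>?P) < e"
    using order_tendstoD(2)[OF step_tendsto_L2[OF J f]] by auto
  then obtain n where n: "(\<integral>x. (f (snap J (Suc n) x) - f x)\<^sup>2 \<partial>?P) < e"
    by (auto simp: eventually_sequentially)
  let ?G = "\<lambda>x. \<Sum>i\<in>J \<rightarrow>\<^sub>E {1..Suc n}.
     f (grid J (Suc n) i) * tensor J (\<lambda>j s. indicator {i j} (cell (Suc n) s)) x"
  have sq: "square_integrable unit_interval (\<lambda>s. indicator {i} (cell (Suc n) s))" for i
  proof -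
    have [measurable]: "(\<lambda>s. indicator {i} (cell (Suc n) s) :: real) \<in> borel_measurable unit_interval"
      by (intro measurable_restrict_space1) simp
    show ?thesis unfolding square_integrable_def
      by (auto intro!: unit.integrable_const_bound[where B=1] simp: indicator_le_1 power_le_one)
  qed
  have "approx J ?G"
    using J sq by (intro approx_sum approx_tensor)
  moreover have "(\<integral>x. (f x - ?G x)\<^sup>2 \<partial>?P) =
      (\<integral>x. (f (snap J (Suc n) x) - f x)\<^sup>2 \<partial>?P)"
    using step_eq_sum[OF J, of "Suc n" _ "\<lambda>i. f (grid J (Suc n) i)"]
    by (intro Bochner_Integration.integral_cong) (auto simp: tensor_def power2_commute)
  ultimately show "\<exists>G. approx J G \<and> (\<integral>x. (f x - G x)\<^sup>2 \<partial>?P) < e"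
    using n by (intro exI[of _ ?G]) auto
qed

lemma integral_Psi_mult:
  assumes J: "finite J" and m: "m \<in> J \<rightarrow>\<^sub>E {1..}" "m' \<in> J \<rightarrow>\<^sub>E {1..}"
  shows "(\<integral>x. \<Psi> J m x * \<Psi> J m' x \<partial>cubeM J) = (if m = m' then 1 else 0)"
proof -
  have ge: "m j \<ge> 1" "m' j \<ge> 1" if "j \<in> J" for j using m that by (auto simp: PiE_iff)
  have "(\<integral>x. \<Psi> J m x * \<Psi> J m' x \<partial>cubeM J) =
     (\<Prod>j\<in>J. if m j = m' j then 1 else 0)"
    using ge onb
    by (subst integral_tensor_mult[OF J]) (auto simp: square_integrable_basis orthonormal_basis_def intro!: prod.cong)
  also have "\<dots> = (if m = m' then 1 else 0)"
  proof (cases "m = m'")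
    case False
    then obtain j where "j \<in> J" "m j \<noteq> m' j" using m by (meson PiE_ext)
    then show ?thesis using False J by (auto simp: prod_zero_iff)
  qed auto
  finally show ?thesis .
qed

text \<open>Pythagoras: with Fourier coefficients \<open>a\<close> the remainder \<open>u\<close> is
  orthogonal to the span over \<open>S\<close>, and any other choice \<open>b\<close> adds an
  element \<open>v\<close> of that span to it.\<close>

lemma approx_best:
  assumes J: "finite J" and f: "square_integrable (cubeM J) f"
    and S: "finite S" "S \<subseteq> J \<rightarrow>\<^sub>E {1..}"
    and a: "\<And>m. a m = (\<integral>x. f x * \<Psi> J m x \<partial>cubeM J)"
  shows "(\<integral>x. (f x - comb J S a x)\<^sup>2 \<partial>cubeM J) \<le>
    (\<integral>x. (f x - comb J S b x)\<^sup>2 \<partial>cubeM J)"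
proof -
  let ?P = "cubeM J"
  define u where "u x = f x - comb J S a x" for x
  define v where "v x = (\<Sum>m\<in>S. (a m - b m) * \<Psi> J m x)" for x
  have sP: "square_integrable ?P (\<Psi> J m)" if "m \<in> S" for m
    using that S J square_integrable_Psi by blast
  have su: "square_integrable ?P u" unfolding u_def
    by (intro square_integrable_diff f square_integrable_sum_Psi J S)
  have sv: "square_integrable ?P v" unfolding v_def by (intro square_integrable_sum_Psi J S)
  have uP: "(\<integral>x. u x * \<Psi> J m x \<partial>?P) = 0" if m: "m \<in> S" for m
  proof -
    have "(\<integral>x. u x * \<Psi> J m x \<partial>?P) = (\<integral>x. f x * \<Psi> J m x - (\<Sum>m'\<in>S. a m' * (\<Psi> J m' x * \<Psi> J m x)) \<partial>?P)"
      unfolding u_def by (simp add: algebra_simps sum_distrib_left)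
    also have "\<dots> = (\<integral>x. f x * \<Psi> J m x \<partial>?P) - (\<Sum>m'\<in>S. a m' * (\<integral>x. \<Psi> J m' x * \<Psi> J m x \<partial>?P))"
      using m by (subst Bochner_Integration.integral_diff)
        (simp_all add: square_integrable_mult f sP Bochner_Integration.integral_sum)
    also have "(\<Sum>m'\<in>S. a m' * (\<integral>x. \<Psi> J m' x * \<Psi> J m x \<partial>?P)) = (\<Sum>m'\<in>S. a m' * (if m' = m then 1 else 0))"
      using m S(2) by (intro sum.cong arg_cong2[where f="(*)"] integral_Psi_mult J) auto
    also have "\<dots> = a m" using m S(1) by (simp add: if_distrib sum.delta cong: if_cong)
    finally show ?thesis using a by simp
  qed
  have uv: "(\<integral>x. u x * v x \<partial>?P) = 0"
  proof -
    have "(\<integral>x. u x * v x \<partial>?P) = (\<integral>x. (\<Sum>m\<in>S. (a m - b m) * (u x * \<Psi> J m x)) \<partial>?P)"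
      unfolding v_def by (simp add: sum_distrib_left algebra_simps)
    also have "\<dots> = (\<Sum>m\<in>S. (a m - b m) * (\<integral>x. u x * \<Psi> J m x \<partial>?P))"
      by (subst Bochner_Integration.integral_sum)
        (auto intro!: square_integrable_mult su sP integrable_mult_right)
    also have "\<dots> = 0" by (simp add: uP)
    finally show ?thesis .
  qed
  have "(\<integral>x. (u x)\<^sup>2 \<partial>?P) \<le> (\<integral>x. (u x)\<^sup>2 \<partial>?P) + 2 * (\<integral>x. u x * v x \<partial>?P) + (\<integral>x. (v x)\<^sup>2 \<partial>?P)"
    by (simp add: uv)
  also have "\<dots> = (\<integral>x. (u x)\<^sup>2 + 2 * (u x * v x) + (v x)\<^sup>2 \<partial>?P)"
    using su sv square_integrable_mult[OF su sv] by (simp add: square_integrable_def)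
  also have "\<dots> = (\<integral>x. (f x - comb J S b x)\<^sup>2 \<partial>?P)"
  proof (rule Bochner_Integration.integral_cong[OF refl])
    fix x
    have "f x - comb J S b x = u x + v x"
      by (simp add: u_def v_def left_diff_distrib sum_subtractf)
    then show "(u x)\<^sup>2 + 2 * (u x * v x) + (v x)\<^sup>2 = (f x - comb J S b x)\<^sup>2"
      by (simp add: power2_sum)
  qed
  finally show ?thesis by (simp add: u_def)
qed

text \<open>Density gives one good combination over some \<open>T\<close>. Over every larger finite
  \<open>S\<close> the Fourier coefficients do at least as well as that combination extended by
  zero, which is convergence along the net of finite subsets.\<close>

theorem tensor_basis:
  assumes J: "finite J" and f: "continuous_on (cube_on J) f"
  shows "\<exists>c. L2_has_sum (cubeM J) (\<lambda>m x. c m * \<Psi> J m x) f (J \<rightarrow>\<^sub>E {1..})"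
proof -
  let ?P = "cubeM J"
  have app: "approx J f" by (rule approx_continuous[OF J f])
  then have f': "square_integrable ?P f" by (simp add: approx_def)
  define a where "a m = (\<integral>x. f x * \<Psi> J m x \<partial>?P)" for m
  have "((\<lambda>S. \<integral>x. (comb J S a x - f x)\<^sup>2 \<partial>?P) \<longlongrightarrow> 0) (finite_subsets_at_top (J \<rightarrow>\<^sub>E {1..}))"
  proof (rule tendstoI)
    fix e :: real assume "e > 0"
    then obtain T b where T: "finite T" "T \<subseteq> J \<rightarrow>\<^sub>E {1..}"
        "(\<integral>x. (f x - comb J T b x)\<^sup>2 \<partial>?P) < e"
      using app unfolding approx_def by blast
    show "\<forall>\<^sub>F S in finite_subsets_at_top (J \<rightarrow>\<^sub>E {1..}).
       dist (\<integral>x. (comb J S a x - f x)\<^sup>2 \<partial>?P) 0 < e"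
      unfolding eventually_finite_subsets_at_top
    proof (intro exI[of _ T] conjI allI impI)
      fix S assume S: "finite S \<and> T \<subseteq> S \<and> S \<subseteq> J \<rightarrow>\<^sub>E {1..}"
      have "(\<integral>x. (comb J S a x - f x)\<^sup>2 \<partial>?P) = (\<integral>x. (f x - comb J S a x)\<^sup>2 \<partial>?P)"
        by (simp add: power2_commute)
      also have "\<dots> \<le> (\<integral>x. (f x - (\<Sum>m\<in>S. (if m \<in> T then b m else 0) * \<Psi> J m x))\<^sup>2 \<partial>?P)"
        using S by (intro approx_best J f' a_def) auto
      also have "(\<lambda>x. \<Sum>m\<in>S. (if m \<in> T then b m else 0) * \<Psi> J m x) = (comb J T b)"
        using S by (intro ext sum.mono_neutral_cong_right) auto
      also note T(3)
      finally show "dist (\<integral>x. (comb J S a x - f x)\<^sup>2 \<partial>?P) 0 < e" by simp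
    qed (use T in auto)
  qed
  then show ?thesis
    unfolding L2_has_sum_def using f' J
    by (intro exI[of _ a]) (auto intro!: square_integrable_cmult square_integrable_Psi)
qed

end

subsection \<open>Rademacher chaos\<close>

definition inj_tuples :: "nat set \<Rightarrow> nat set \<Rightarrow> (nat \<Rightarrow> nat) set" where
  "inj_tuples J V = {i \<in> J \<rightarrow>\<^sub>E V. inj_on i J}"

lemma finite_inj_tuples: "finite J \<Longrightarrow> finite V \<Longrightarrow> finite (inj_tuples J V)"
  by (simp add: inj_tuples_def finite_PiE)

text \<open>The off-diagonal sum of a product kernel. The factors are arbitrary functions of the
  index, so signs and normalisation can be absorbed into them and merged factors are again of the
  same kind.\<close>

definition offdiag :: "nat set \<Rightarrow> nat set \<Rightarrow> (nat \<Rightarrow> nat \<Rightarrow> real) \<Rightarrow> real" where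
  "offdiag V J H = (\<Sum>i\<in>inj_tuples J V. \<Prod>j\<in>J. H j (i j))"

lemma offdiag_cong:
  "(\<And>j v. j \<in> J \<Longrightarrow> v \<in> V \<Longrightarrow> H j v = H' j v) \<Longrightarrow> offdiag V J H = offdiag V J H'"
  unfolding offdiag_def by (intro sum.cong prod.cong) (auto simp: inj_tuples_def PiE_iff)

text \<open>An injective tuple on \<open>insert j0 J\<close> is one on \<open>J\<close> together
  with a value outside its image. Summing that value over all of \<open>V\<close> and subtracting
  the collisions, which by injectivity are one for each \<open>p\<close>, gives the formula; a
  collision with \<open>p\<close> merges the factors \<open>H j0\<close> and
  \<open>H p\<close>.\<close>

lemma offdiag_insert:
  assumes J: "finite J" and V: "finite V" and j0: "j0 \<notin> J"
  shows "offdiag V (insert j0 J) H =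
    (\<Sum>v\<in>V. H j0 v) * offdiag V J H - (\<Sum>p\<in>J. offdiag V J (H(p := \<lambda>v. H j0 v * H p v)))"
proof -
  let ?T = "inj_tuples J V"
  have fin: "finite ?T" using J V by (rule finite_inj_tuples)
  have "offdiag V (insert j0 J) H = (\<Sum>(i, v)\<in>(SIGMA i:?T. V - i ` J). H j0 v * (\<Prod>j\<in>J. H j (i j)))"
    unfolding offdiag_def
  proof (rule sum.reindex_bij_witness[where j="\<lambda>i. (restrict i J, i j0)" and i="\<lambda>(i, v). i(j0 := v)"], goal_cases)
    case (1 i)
    then show ?case by (auto simp: inj_tuples_def PiE_iff extensional_def fun_eq_iff)
  next
    case (2 i)
    then show ?case using j0
      by (auto simp: inj_tuples_def PiE_iff inj_on_def)
  next
    case (3 b)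
    then show ?case using j0 by (auto simp: inj_tuples_def PiE_iff extensional_def fun_eq_iff)
  next
    case (4 b)
    then show ?case using j0
      by (auto simp: inj_tuples_def PiE_iff extensional_def intro!: inj_on_fun_updI split: if_splits)
  next
    case (5 i)
    have "(\<Prod>j\<in>J. H j (restrict i J j)) = (\<Prod>j\<in>J. H j (i j))" by (intro prod.cong) auto
    then show ?case using j0 J by simp
  qed
  also have "\<dots> = (\<Sum>i\<in>?T. \<Sum>v\<in>V - i ` J. H j0 v * (\<Prod>j\<in>J. H j (i j)))"
    using fin V by (subst sum.Sigma) auto
  also have "\<dots> = (\<Sum>i\<in>?T. (\<Sum>v\<in>V. H j0 v) * (\<Prod>j\<in>J. H j (i j)) - (\<Sum>p\<in>J. H j0 (i p) * (\<Prod>j\<in>J. H j (i j))))"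
  proof (rule sum.cong[OF refl])
    fix i assume i: "i \<in> ?T"
    then have "i ` J \<subseteq> V" "inj_on i J" by (auto simp: inj_tuples_def PiE_iff)
    then have "(\<Sum>v\<in>V - i ` J. H j0 v * (\<Prod>j\<in>J. H j (i j))) =
       (\<Sum>v\<in>V. H j0 v * (\<Prod>j\<in>J. H j (i j))) - (\<Sum>p\<in>J. H j0 (i p) * (\<Prod>j\<in>J. H j (i j)))"
      using V by (simp add: sum_diff sum.reindex)
    then show "(\<Sum>v\<in>V - i ` J. H j0 v * (\<Prod>j\<in>J. H j (i j))) =
       (\<Sum>v\<in>V. H j0 v) * (\<Prod>j\<in>J. H j (i j)) - (\<Sum>p\<in>J. H j0 (i p) * (\<Prod>j\<in>J. H j (i j)))"
      by (simp add: sum_distrib_right)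
  qed
  also have "\<dots> = (\<Sum>v\<in>V. H j0 v) * offdiag V J H - (\<Sum>p\<in>J. \<Sum>i\<in>?T. H j0 (i p) * (\<Prod>j\<in>J. H j (i j)))"
    unfolding offdiag_def sum_subtractf sum_distrib_left[symmetric]
    by (subst sum.swap) simp
  also have "(\<Sum>p\<in>J. \<Sum>i\<in>?T. H j0 (i p) * (\<Prod>j\<in>J. H j (i j))) =
     (\<Sum>p\<in>J. offdiag V J (H(p := \<lambda>v. H j0 v * H p v)))"
    unfolding offdiag_def
  proof (intro sum.cong refl)
    fix p i assume p: "p \<in> J"
    have "(\<Prod>j\<in>J - {p}. (H(p := \<lambda>v. H j0 v * H p v)) j (i j)) = (\<Prod>j\<in>J - {p}. H j (i j))"
      by (intro prod.cong) auto
    then show "H j0 (i p) * (\<Prod>j\<in>J. H j (i j)) = (\<Prod>j\<in>J. (H(p := \<lambda>v. H j0 v * H p v)) j (i j))"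
      using p J by (simp add: prod.remove[where x=p])
  qed
  finally show ?thesis .
qed

lemma offdiag_scale:
  assumes "finite J" "q \<in> J"
  shows "offdiag V J (H(q := \<lambda>v. c * g v)) = c * offdiag V J (H(q := g))"
proof -
  have "(\<Prod>j\<in>J. (H(q := \<lambda>v. c * g v)) j (i j)) = c * (\<Prod>j\<in>J. (H(q := g)) j (i j))" for i
  proof -
    have "(\<Prod>j\<in>J - {q}. (H(q := u)) j (i j)) = (\<Prod>j\<in>J - {q}. H j (i j))" for u
      by (intro prod.cong) auto
    then show ?thesis using assms by (simp add: prod.remove[where x=q])
  qed
  then show ?thesis by (simp add: offdiag_def sum_distrib_left)
qed

section \<open>Moments of products of signs\<close>

locale rademacher =
  fixes M :: "'a measure" and \<epsilon> :: "nat \<Rightarrow> 'a \<Rightarrow> real"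
  assumes rademacher: "rademacher_sequence M \<epsilon>"

sublocale rademacher \<subseteq> prob_space M
  using rademacher by (simp add: rademacher_sequence_def)

context rademacher
begin

lemma indep_signs: "indep_vars (\<lambda>_. borel) \<epsilon> {1..}"
  using rademacher by (simp add: rademacher_sequence_def)

lemma measurable_sign: "i \<ge> 1 \<Longrightarrow> \<epsilon> i \<in> borel_measurable M"
  using indep_signs by (auto simp: indep_vars_def)

lemma AE_sign: "i \<ge> 1 \<Longrightarrow> AE z in M. \<epsilon> i z = 1 \<or> \<epsilon> i z = -1"
proof -
  assume i: "i \<ge> 1"
  note [measurable] = measurable_sign[OF i]
  have "prob ({z \<in> space M. \<epsilon> i z = 1} \<union> {z \<in> space M. \<epsilon> i z = -1}) = 1 / 2 + 1 / 2"
    using rademacher i by (subst finite_measure_Union) (auto simp: rademacher_sequence_def)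
  also have "{z \<in> space M. \<epsilon> i z = 1} \<union> {z \<in> space M. \<epsilon> i z = -1} =
      {z \<in> space M. \<epsilon> i z = 1 \<or> \<epsilon> i z = -1}" by auto
  finally show ?thesis by (subst prob_Collect_eq_1[symmetric]) auto
qed

lemma AE_signs: "AE z in M. \<forall>i\<ge>1. \<epsilon> i z = 1 \<or> \<epsilon> i z = -1"
  unfolding AE_all_countable using AE_sign by auto

text \<open>The values of \<open>h\<close> lie in a Banach space because both real powers and
  complex exponentials of a sign are averaged.\<close>

lemma
  fixes h :: "real \<Rightarrow> 'b :: {banach, second_countable_topology}"
  assumes i: "i \<ge> 1" and h [measurable]: "h \<in> borel_measurable borel"
  shows expectation_sign: "expectation (\<lambda>z. h (\<epsilon> i z)) = (1 / 2) *\<^sub>R (h 1 + h (-1))"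
    and integrable_sign: "integrable M (\<lambda>z. h (\<epsilon> i z))"
proof -
  note [measurable] = measurable_sign[OF i]
  let ?g = "\<lambda>z. indicator {z \<in> space M. \<epsilon> i z = 1} z *\<^sub>R h 1 + indicator {z \<in> space M. \<epsilon> i z = -1} z *\<^sub>R h (-1)"
  have ae: "AE z in M. h (\<epsilon> i z) = ?g z"
    using AE_sign[OF i] AE_space by eventually_elim (auto simp: indicator_def)
  have ind: "integrable M (indicat_real {z \<in> space M. \<epsilon> i z = c})" for c
    by (rule integrable_real_indicator) (auto simp: less_top[symmetric])
  have int: "integrable M ?g"
    by (intro Bochner_Integration.integrable_add integrable_scaleR_left ind)
  show "integrable M (\<lambda>z. h (\<epsilon> i z))"
    using int by (subst integrable_cong_AE[OF _ _ ae]) auto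
  have "expectation (\<lambda>z. h (\<epsilon> i z)) = expectation ?g"
    by (rule integral_cong_AE[OF _ _ ae]) auto
  also have "\<dots> = prob {z \<in> space M. \<epsilon> i z = 1} *\<^sub>R h 1 + prob {z \<in> space M. \<epsilon> i z = -1} *\<^sub>R h (-1)"
  proof -
    have "expectation (\<lambda>z. indicator {z \<in> space M. \<epsilon> i z = c} z *\<^sub>R x) =
        prob {z \<in> space M. \<epsilon> i z = c} *\<^sub>R x" for c and x :: 'b
      by (subst integral_scaleR_left[OF ind]) (auto intro!: arg_cong[where f=prob])
    then show ?thesis
      by (subst Bochner_Integration.integral_add) (auto intro!: integrable_scaleR_left ind)
  qed
  also have "\<dots> = (1 / 2) *\<^sub>R (h 1 + h (-1))"
  proof -
    have "prob {z \<in> space M. \<epsilon> i z = 1} = 1 / 2" "prob {z \<in> space M. \<epsilon> i z = -1} = 1 / 2"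
      using rademacher i by (auto simp only: rademacher_sequence_def)
    then show ?thesis by (simp only: scaleR_add_right)
  qed
  finally show "expectation (\<lambda>z. h (\<epsilon> i z)) = (1 / 2) *\<^sub>R (h 1 + h (-1))" .
qed

text \<open>The product of the two monomials has exponents \<open>e v\<close> in
  \<open>{0, 1, 2}\<close>. A point in exactly one of the sets has exponent \<open>1\<close>, and by
  independence its mean zero annihilates the expectation.\<close>

lemma
  assumes A: "finite A" "A \<subseteq> {1..}" and B: "finite B" "B \<subseteq> {1..}"
  shows integrable_sign_products: "integrable M (\<lambda>z. (\<Prod>v\<in>A. \<epsilon> v z) * (\<Prod>v\<in>B. \<epsilon> v z))"
    and expectation_sign_products: "A \<noteq> B \<Longrightarrow> expectation (\<lambda>z. (\<Prod>v\<in>A. \<epsilon> v z) * (\<Prod>v\<in>B. \<epsilon> v z)) = 0"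
proof -
  define e where "e v = (if v \<in> A then 1 else 0) + (if v \<in> B then 1 else 0 :: nat)" for v
  have eq: "(\<Prod>v\<in>A. \<epsilon> v z) * (\<Prod>v\<in>B. \<epsilon> v z) = (\<Prod>v\<in>A \<union> B. \<epsilon> v z ^ e v)" for z
  proof -
    have "(\<Prod>v\<in>A. \<epsilon> v z) = (\<Prod>v\<in>A \<union> B. \<epsilon> v z ^ (if v \<in> A then 1 else 0))"
      using A B by (intro prod.mono_neutral_cong_left) auto
    moreover have "(\<Prod>v\<in>B. \<epsilon> v z) = (\<Prod>v\<in>A \<union> B. \<epsilon> v z ^ (if v \<in> B then 1 else 0))"
      using A B by (intro prod.mono_neutral_cong_left) auto
    ultimately show ?thesis by (simp add: e_def power_add prod.distrib)
  qed
  have ind: "indep_vars (\<lambda>_. borel) (\<lambda>v z. \<epsilon> v z ^ e v) (A \<union> B)"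
    using A B by (intro indep_vars_compose2[OF indep_vars_subset[OF indep_signs]]) auto
  have int: "integrable M (\<lambda>z. \<epsilon> v z ^ e v)" if "v \<in> A \<union> B" for v
    using that A B by (intro integrable_sign[where h="\<lambda>x. x ^ e v"]) auto
  show "integrable M (\<lambda>z. (\<Prod>v\<in>A. \<epsilon> v z) * (\<Prod>v\<in>B. \<epsilon> v z))"
    unfolding eq using A B ind int by (intro indep_vars_integrable) auto
  assume "A \<noteq> B"
  then obtain v where "v \<in> A - B \<or> v \<in> B - A" by blast
  then have v: "v \<in> A \<union> B" "e v = 1" by (auto simp: e_def)
  have "expectation (\<lambda>z. (\<Prod>v\<in>A. \<epsilon> v z) * (\<Prod>v\<in>B. \<epsilon> v z)) = (\<Prod>v\<in>A \<union> B. expectation (\<lambda>z. \<epsilon> v z ^ e v))"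
    unfolding eq using A B ind int by (intro indep_vars_lebesgue_integral) auto
  also have "\<dots> = 0"
  proof -
    have "v \<ge> 1" using v A B by auto
    then have "expectation (\<lambda>z. \<epsilon> v z ^ e v) = 0"
      using expectation_sign[of v "\<lambda>x. x"] v(2) by simp
    then show ?thesis using A B v(1) by (intro prod_zero bexI[of _ v]) auto
  qed
  finally show "expectation (\<lambda>z. (\<Prod>v\<in>A. \<epsilon> v z) * (\<Prod>v\<in>B. \<epsilon> v z)) = 0" .
qed

lemma expectation_sign_products_le:
  assumes A: "finite A" "A \<subseteq> {1..}" and B: "finite B" "B \<subseteq> {1..}"
  shows "\<bar>expectation (\<lambda>z. (\<Prod>v\<in>A. \<epsilon> v z) * (\<Prod>v\<in>B. \<epsilon> v z))\<bar> \<le> (if A = B then 1 else 0)"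
proof (cases "A = B")
  case True
  have "AE z in M. (\<Prod>v\<in>A. \<epsilon> v z) * (\<Prod>v\<in>A. \<epsilon> v z) = 1"
    using AE_signs
  proof eventually_elim
    case (elim z)
    then have "(\<Prod>v\<in>A. \<epsilon> v z * \<epsilon> v z) = (\<Prod>v\<in>A. 1)" using A by (intro prod.cong) auto
    then show ?case by (simp add: prod.distrib)
  qed
  moreover have "(\<lambda>z. (\<Prod>v\<in>A. \<epsilon> v z) * (\<Prod>v\<in>A. \<epsilon> v z)) \<in> borel_measurable M"
    using integrable_sign_products[OF A A] by auto
  ultimately have "expectation (\<lambda>z. (\<Prod>v\<in>A. \<epsilon> v z) * (\<Prod>v\<in>A. \<epsilon> v z)) = expectation (\<lambda>_. 1)"
    by (intro integral_cong_AE) auto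
  then show ?thesis using True by (simp add: prob_space)
qed (use expectation_sign_products[OF assms] in simp)

text \<open>Only pairs of tuples with equal image correlate. For these
  \<open>a b \<le> (a^2 + b^2) / 2\<close> and symmetry reduce the double sum to the squares, each
  counted as often as there are tuples with the same image.\<close>

lemma
  assumes J: "finite J"
  shows integrable_chaos_square:
      "integrable M (\<lambda>z. (\<Sum>i\<in>inj_tuples J {1..n}. a i * (\<Prod>j\<in>J. \<epsilon> (i j) z))\<^sup>2)"
    and chaos_second_moment:
      "expectation (\<lambda>z. (\<Sum>i\<in>inj_tuples J {1..n}. a i * (\<Prod>j\<in>J. \<epsilon> (i j) z))\<^sup>2) \<le>
       real (card J ^ card J) * (\<Sum>i\<in>inj_tuples J {1..n}. (a i)\<^sup>2)"
proof -
  let ?T = "inj_tuples J {1..n}"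
  let ?C = "real (card J ^ card J)"
  let ?p = "\<lambda>i z. \<Prod>v\<in>i ` J. \<epsilon> v z"
  have fin: "finite ?T" using J by (simp add: finite_inj_tuples)
  have im: "finite (i ` J)" "i ` J \<subseteq> {1..}" if "i \<in> ?T" for i
    using that J by (auto simp: inj_tuples_def PiE_iff)
  have p: "(\<Prod>j\<in>J. \<epsilon> (i j) z) = ?p i z" if "i \<in> ?T" for i z
    using that by (simp add: prod.reindex inj_tuples_def)
  have int: "integrable M (\<lambda>z. a i * a i' * (?p i z * ?p i' z))" if "i \<in> ?T" "i' \<in> ?T" for i i'
    using that im by (intro integrable_mult_right integrable_sign_products) auto
  have sq: "(\<Sum>i\<in>?T. a i * (\<Prod>j\<in>J. \<epsilon> (i j) z))\<^sup>2 = (\<Sum>i\<in>?T. \<Sum>i'\<in>?T. a i * a i' * (?p i z * ?p i' z))" for z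
    unfolding power2_eq_square sum_product by (intro sum.cong refl) (simp add: p mult_ac)
  show "integrable M (\<lambda>z. (\<Sum>i\<in>?T. a i * (\<Prod>j\<in>J. \<epsilon> (i j) z))\<^sup>2)"
    unfolding sq by (intro Bochner_Integration.integrable_sum int)
  have "expectation (\<lambda>z. (\<Sum>i\<in>?T. a i * (\<Prod>j\<in>J. \<epsilon> (i j) z))\<^sup>2) =
     (\<Sum>i\<in>?T. \<Sum>i'\<in>?T. a i * a i' * expectation (\<lambda>z. ?p i z * ?p i' z))"
  proof -
    have "expectation (\<lambda>z. \<Sum>i\<in>?T. \<Sum>i'\<in>?T. a i * a i' * (?p i z * ?p i' z)) =
        (\<Sum>i\<in>?T. expectation (\<lambda>z. \<Sum>i'\<in>?T. a i * a i' * (?p i z * ?p i' z)))"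
      by (intro Bochner_Integration.integral_sum Bochner_Integration.integrable_sum int)
    also have "\<dots> = (\<Sum>i\<in>?T. \<Sum>i'\<in>?T. expectation (\<lambda>z. a i * a i' * (?p i z * ?p i' z)))"
      by (intro sum.cong refl Bochner_Integration.integral_sum int)
    finally show ?thesis unfolding sq by (simp only: Bochner_Integration.integral_mult_right_zero)
  qed
  also have "\<dots> \<le> (\<Sum>i\<in>?T. \<Sum>i'\<in>?T. if i ` J = i' ` J then ((a i)\<^sup>2 + (a i')\<^sup>2) / 2 else 0)"
  proof (intro sum_mono)
    fix i i' assume i: "i \<in> ?T" "i' \<in> ?T"
    let ?e = "expectation (\<lambda>z. ?p i z * ?p i' z)"
    have e: "\<bar>?e\<bar> \<le> (if i ` J = i' ` J then 1 else 0)"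
      using im i by (intro expectation_sign_products_le) auto
    have "a i * a i' * ?e \<le> \<bar>a i * a i'\<bar> * \<bar>?e\<bar>" by (simp add: abs_mult[symmetric])
    also have "\<dots> \<le> \<bar>a i * a i'\<bar> * (if i ` J = i' ` J then 1 else 0)"
      using e by (intro mult_left_mono) auto
    also have "\<dots> \<le> (if i ` J = i' ` J then ((a i)\<^sup>2 + (a i')\<^sup>2) / 2 else 0)"
    proof -
      have "0 \<le> (\<bar>a i\<bar> - \<bar>a i'\<bar>)\<^sup>2" by simp
      then show ?thesis by (simp add: power2_diff abs_mult)
    qed
    finally show "a i * a i' * ?e \<le> (if i ` J = i' ` J then ((a i)\<^sup>2 + (a i')\<^sup>2) / 2 else 0)" .
  qed
  also have "\<dots> = (\<Sum>i\<in>?T. \<Sum>i'\<in>?T. if i ` J = i' ` J then (a i)\<^sup>2 / 2 else 0) +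
     (\<Sum>i\<in>?T. \<Sum>i'\<in>?T. if i ` J = i' ` J then (a i')\<^sup>2 / 2 else 0)"
    unfolding sum.distrib[symmetric] by (intro sum.cong) (auto simp: field_simps)
  also have "(\<Sum>i\<in>?T. \<Sum>i'\<in>?T. if i ` J = i' ` J then (a i')\<^sup>2 / 2 else 0) =
     (\<Sum>i\<in>?T. \<Sum>i'\<in>?T. if i ` J = i' ` J then (a i)\<^sup>2 / 2 else 0)"
    by (subst sum.swap) (intro sum.cong, auto)
  also have "(\<Sum>i\<in>?T. \<Sum>i'\<in>?T. if i ` J = i' ` J then (a i)\<^sup>2 / 2 else 0) +
     (\<Sum>i\<in>?T. \<Sum>i'\<in>?T. if i ` J = i' ` J then (a i)\<^sup>2 / 2 else 0) =
     (\<Sum>i\<in>?T. (a i)\<^sup>2 * real (card {i' \<in> ?T. i ` J = i' ` J}))"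
  proof -
    have eq: "(\<Sum>i'\<in>?T. if i ` J = i' ` J then (a i)\<^sup>2 / 2 else 0) =
        real (card {i' \<in> ?T. i ` J = i' ` J}) * ((a i)\<^sup>2 / 2)" for i
      using fin by (simp flip: sum.inter_filter)
    then show ?thesis
      unfolding eq sum.distrib[symmetric] by (intro sum.cong refl) simp
  qed
  also have "\<dots> \<le> (\<Sum>i\<in>?T. (a i)\<^sup>2 * ?C)"
  proof (intro sum_mono mult_left_mono)
    fix i assume i: "i \<in> ?T"
    \<comment> \<open>All maps from \<open>J\<close> into the image of \<open>i\<close> are counted
      instead of only the bijections: \<open>k^k\<close> in place of \<open>k!\<close>.\<close>
    have "card {i' \<in> ?T. i ` J = i' ` J} \<le> card (J \<rightarrow>\<^sub>E i ` J)"
      using J by (intro card_mono finite_PiE) (auto simp: inj_tuples_def PiE_iff extensional_def)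
    also have "\<dots> = card J ^ card J"
      using i J by (simp add: card_PiE inj_tuples_def card_image)
    finally show "real (card {i' \<in> ?T. i ` J = i' ` J}) \<le> ?C" by (rule of_nat_mono)
  qed auto
  finally show "expectation (\<lambda>z. (\<Sum>i\<in>?T. a i * (\<Prod>j\<in>J. \<epsilon> (i j) z))\<^sup>2) \<le> ?C * (\<Sum>i\<in>?T. (a i)\<^sup>2)"
    by (simp add: sum_distrib_left mult.commute)
qed

text \<open>The index set is an arbitrary finite \<open>J\<close> rather than \<open>{1..k}\<close>,
  because the recursion deletes elements at arbitrary places; the normalisation contributes one
  factor \<open>1 / sqrt n\<close> per index.\<close>

definition chaos :: "nat \<Rightarrow> nat set \<Rightarrow> ((nat \<Rightarrow> real) \<Rightarrow> real) \<Rightarrow> 'a \<Rightarrow> real" where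
  "chaos n J F z =
     (1 / sqrt (real n)) ^ card J * (\<Sum>i\<in>inj_tuples J {1..n}. F (grid J n i) * (\<Prod>j\<in>J. \<epsilon> (i j) z))"

definition linear_form :: "nat \<Rightarrow> (real \<Rightarrow> real) \<Rightarrow> 'a \<Rightarrow> real" where
  "linear_form n h z = (\<Sum>v\<in>{1..n}. h (real v / real n) * (\<epsilon> v z / sqrt (real n)))"

lemma measurable_chaos [measurable]:
  assumes "finite J" shows "chaos n J F \<in> borel_measurable M"
  unfolding chaos_def
  by (intro borel_measurable_times borel_measurable_const borel_measurable_sum
      borel_measurable_prod measurable_sign) (auto simp: inj_tuples_def PiE_iff)

lemma measurable_linear_form [measurable]: "linear_form n h \<in> borel_measurable M"
  unfolding linear_form_def
  by (intro borel_measurable_times borel_measurable_divide borel_measurable_const borel_measurable_sum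
      measurable_sign) auto

lemma rademacher_chaos_eq:
  assumes "k \<ge> 1" shows "rademacher_chaos \<epsilon> k f n = chaos n {1..k} f"
proof -
  have "1 / real n powr (real k / 2) = (1 / sqrt (real n)) ^ k"
  proof (cases "n = 0")
    case False
    have "real n powr (real k / 2) = (real n powr (1 / 2)) powr real k" by (simp add: powr_powr)
    also have "\<dots> = sqrt (real n) ^ k" using False by (simp add: powr_half_sqrt powr_realpow)
    finally show ?thesis by (simp add: power_one_over)
  \<comment> \<open>At \<open>n = 0\<close> division by zero makes the left side \<open>0\<close>,
    and the right side is \<open>0 ^ k\<close>, which vanishes by \<open>k \<ge> 1\<close>.\<close>
  qed (use assms in simp)
  then show ?thesis
    by (simp add: fun_eq_iff rademacher_chaos_def chaos_def inj_tuples_def grid_def)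
qed

lemma chaos_cmult_add: "chaos n J (\<lambda>x. c * F x + G x) z = c * chaos n J F z + chaos n J G z"
  by (simp add: chaos_def sum.distrib sum_distrib_left algebra_simps)

lemma chaos_diff: "chaos n J (\<lambda>x. F x - G x) z = chaos n J F z - chaos n J G z"
  by (simp add: chaos_def sum_subtractf algebra_simps)

lemma chaos_sum: "chaos n J (\<lambda>x. \<Sum>m\<in>S. c m * F m x) z = (\<Sum>m\<in>S. c m * chaos n J (F m) z)"
proof (induction S rule: infinite_finite_induct)
  case (insert m S)
  then show ?case by (simp add: chaos_cmult_add)
qed (simp_all add: chaos_def)

text \<open>The squared normalisation is \<open>1 / n ^ card J\<close>. Enlarging the sum of squares
  from injective to all tuples makes the bound a Riemann sum of \<open>F\<close> squared.\<close>

lemma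
  assumes J: "finite J"
  shows square_integrable_chaos: "square_integrable M (chaos n J F)"
    and chaos_L2_bound: "expectation (\<lambda>z. (chaos n J F z)\<^sup>2) \<le>
      real (card J ^ card J) * ((\<Sum>i\<in>J \<rightarrow>\<^sub>E {1..n}. (F (grid J n i))\<^sup>2) / real n ^ card J)"
proof -
  let ?s = "\<lambda>z. \<Sum>i\<in>inj_tuples J {1..n}. F (grid J n i) * (\<Prod>j\<in>J. \<epsilon> (i j) z)"
  have sq: "(chaos n J F z)\<^sup>2 = (1 / real n) ^ card J * (?s z)\<^sup>2" for z
  proof -
    have "((1 / sqrt (real n)) ^ card J)\<^sup>2 = ((1 / sqrt (real n))\<^sup>2) ^ card J"
      by (simp add: power_mult[symmetric] mult.commute)
    also have "\<dots> = (1 / real n) ^ card J" by (simp add: power_divide)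
    finally show ?thesis by (simp add: chaos_def power_mult_distrib)
  qed
  show "square_integrable M (chaos n J F)"
    unfolding square_integrable_def sq using integrable_chaos_square[OF J] measurable_chaos[OF J] by auto
  have "expectation (\<lambda>z. (chaos n J F z)\<^sup>2) = (1 / real n) ^ card J * expectation (\<lambda>z. (?s z)\<^sup>2)"
    unfolding sq by simp
  also have "\<dots> \<le> (1 / real n) ^ card J * (real (card J ^ card J) * (\<Sum>i\<in>inj_tuples J {1..n}. (F (grid J n i))\<^sup>2))"
    by (intro mult_left_mono chaos_second_moment J) auto
  also have "\<dots> \<le> (1 / real n) ^ card J * (real (card J ^ card J) * (\<Sum>i\<in>J \<rightarrow>\<^sub>E {1..n}. (F (grid J n i))\<^sup>2))"
    using J by (intro mult_left_mono sum_mono2 finite_PiE) (auto simp: inj_tuples_def)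
  finally show "expectation (\<lambda>z. (chaos n J F z)\<^sup>2) \<le>
      real (card J ^ card J) * ((\<Sum>i\<in>J \<rightarrow>\<^sub>E {1..n}. (F (grid J n i))\<^sup>2) / real n ^ card J)"
    by (simp add: power_one_over)
qed

lemma chaos_L2_bound_tendsto:
  assumes J: "finite J" and F: "continuous_on (cube_on J) F"
  shows "(\<lambda>n. real (card J ^ card J) * ((\<Sum>i\<in>J \<rightarrow>\<^sub>E {1..n}. (F (grid J n i))\<^sup>2) / real n ^ card J))
    \<longlonglongrightarrow> real (card J ^ card J) * (\<integral>x. (F x)\<^sup>2 \<partial>cubeM J)"
  using F by (intro tendsto_mult_left riemann_cube J continuous_intros)

lemma chaos_tensor_eq:
  assumes "finite J"
  shows "chaos n J (tensor J h) z =
    offdiag {1..n} J (\<lambda>j v. h j (real v / real n) * (\<epsilon> v z / sqrt (real n)))"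
proof -
  have "(1 / sqrt (real n)) ^ card J * (tensor J h (grid J n i) * (\<Prod>j\<in>J. \<epsilon> (i j) z)) =
      (\<Prod>j\<in>J. h j (real (i j) / real n) * (\<epsilon> (i j) z / sqrt (real n)))" for i
  proof -
    have "tensor J h (grid J n i) = (\<Prod>j\<in>J. h j (real (i j) / real n))"
      unfolding tensor_def grid_def by (intro prod.cong) auto
    then show ?thesis
      by (simp add: prod.distrib prod_dividef power_one_over)
  qed
  then show ?thesis by (simp add: chaos_def offdiag_def sum_distrib_left)
qed

text \<open>Two applications of \<open>offdiag_insert\<close>. The first removes \<open>j0\<close>;
  its collision with \<open>p\<close> produces a squared sign, hence a deterministic factor of size
  \<open>1/n\<close> at \<open>p\<close>. The second sums out \<open>p\<close>: the free sum is a
  Riemann sum, and a further collision with \<open>q\<close> puts the product of three functions at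
  \<open>q\<close> and keeps the \<open>1/n\<close>.\<close>

lemma chaos_recursion:
  assumes J: "finite J" and j0: "j0 \<notin> J"
    and z: "\<And>v. v \<ge> 1 \<Longrightarrow> \<epsilon> v z = 1 \<or> \<epsilon> v z = -1"
  shows "chaos n (insert j0 J) (tensor (insert j0 J) h) z =
    linear_form n (h j0) z * chaos n J (tensor J h) z -
    (\<Sum>p\<in>J. (\<Sum>v\<in>{1..n}. h j0 (real v / real n) * h p (real v / real n)) / real n *
        chaos n (J - {p}) (tensor (J - {p}) h) z -
      1 / real n * (\<Sum>q\<in>J - {p}. chaos n (J - {p})
        (tensor (J - {p}) (h(q := \<lambda>s. h j0 s * h p s * h q s))) z))"
proof (cases "n = 0")
  case True
  \<comment> \<open>Without grid points there is no tuple on a nonempty index set; on the right the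
    last term vanishes because \<open>1 / 0 = 0\<close>.\<close>
  have "inj_tuples (insert j0 J) {} = {}" by (auto simp: inj_tuples_def PiE_iff)
  then show ?thesis by (simp add: True chaos_def linear_form_def)
next
  case n: False
  let ?x = "\<lambda>v. \<epsilon> v z / sqrt (real n)"
  let ?H = "\<lambda>h j v. h j (real v / real n) * ?x v"
  have x: "?x v * ?x v = 1 / real n" if "v \<ge> 1" for v
    using z[OF that] n by (auto simp: field_simps)
  have "offdiag {1..n} J ((?H h)(p := \<lambda>v. ?H h j0 v * ?H h p v)) =
      (\<Sum>v\<in>{1..n}. h j0 (real v / real n) * h p (real v / real n)) / real n *
        chaos n (J - {p}) (tensor (J - {p}) h) z -
      1 / real n * (\<Sum>q\<in>J - {p}. chaos n (J - {p})
        (tensor (J - {p}) (h(q := \<lambda>s. h j0 s * h p s * h q s))) z)" if p: "p \<in> J" for p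
  proof -
    \<comment> \<open>The kernel after the collision of \<open>j0\<close> with \<open>p\<close>; at
      \<open>p\<close> it no longer depends on the signs.\<close>
    define H' where "H' = (?H h)(p := \<lambda>v. ?H h j0 v * ?H h p v)"
    have H'p: "H' p v = h j0 (real v / real n) * h p (real v / real n) / real n" if "v \<in> {1..n}" for v
    proof -
      have "H' p v = h j0 (real v / real n) * h p (real v / real n) * (?x v * ?x v)"
        by (simp add: H'_def)
      then show ?thesis using x[of v] that by simp
    qed
    have "offdiag {1..n} J H' = offdiag {1..n} (insert p (J - {p})) H'"
      using p by (simp add: insert_absorb)
    also have "\<dots> = (\<Sum>v\<in>{1..n}. H' p v) * offdiag {1..n} (J - {p}) H' -
        (\<Sum>q\<in>J - {p}. offdiag {1..n} (J - {p}) (H'(q := \<lambda>v. H' p v * H' q v)))"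
      using J by (intro offdiag_insert) auto
    also have "(\<Sum>v\<in>{1..n}. H' p v) = (\<Sum>v\<in>{1..n}. h j0 (real v / real n) * h p (real v / real n)) / real n"
      by (simp add: H'p sum_divide_distrib)
    also have "offdiag {1..n} (J - {p}) H' = chaos n (J - {p}) (tensor (J - {p}) h) z"
      using J by (subst chaos_tensor_eq) (simp, rule offdiag_cong, simp add: H'_def)
    also have "(\<Sum>q\<in>J - {p}. offdiag {1..n} (J - {p}) (H'(q := \<lambda>v. H' p v * H' q v))) =
       (\<Sum>q\<in>J - {p}. 1 / real n * chaos n (J - {p})
        (tensor (J - {p}) (h(q := \<lambda>s. h j0 s * h p s * h q s))) z)"
    proof (rule sum.cong[OF refl])
      fix q assume q: "q \<in> J - {p}"
      let ?h = "h(q := \<lambda>s. h j0 s * h p s * h q s)"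
      have "offdiag {1..n} (J - {p}) (H'(q := \<lambda>v. H' p v * H' q v)) =
        offdiag {1..n} (J - {p}) ((?H ?h)(q := \<lambda>v. 1 / real n * ?H ?h q v))"
        using q by (intro offdiag_cong) (auto simp: H'p, auto simp: H'_def mult_ac)
      also have "\<dots> = 1 / real n * offdiag {1..n} (J - {p}) ((?H ?h)(q := \<lambda>v. ?H ?h q v))"
        using q J by (intro offdiag_scale) auto
      also have "(?H ?h)(q := \<lambda>v. ?H ?h q v) = ?H ?h" by (rule fun_upd_triv)
      also have "offdiag {1..n} (J - {p}) (?H ?h) = chaos n (J - {p}) (tensor (J - {p}) ?h) z"
        using J by (subst chaos_tensor_eq) auto
      finally show "offdiag {1..n} (J - {p}) (H'(q := \<lambda>v. H' p v * H' q v)) =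
        1 / real n * chaos n (J - {p}) (tensor (J - {p}) ?h) z" .
    qed
    finally show ?thesis unfolding H'_def by (simp only: sum_distrib_left)
  qed
  moreover have "chaos n (insert j0 J) (tensor (insert j0 J) h) z =
     (\<Sum>v\<in>{1..n}. ?H h j0 v) * offdiag {1..n} J (?H h) -
     (\<Sum>p\<in>J. offdiag {1..n} J ((?H h)(p := \<lambda>v. ?H h j0 v * ?H h p v)))"
    using J j0 by (subst chaos_tensor_eq) (simp, rule offdiag_insert, simp_all)
  ultimately show ?thesis
    using J by (simp add: linear_form_def chaos_tensor_eq)
qed

end

subsection \<open>Hermite asymptotics of the chaos\<close>

lemma norm_iexp_diff: "norm (iexp x - iexp y) \<le> \<bar>x - y\<bar>"
proof -
  have "iexp x - iexp y = iexp y * (iexp (x - y) - 1)"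
    by (simp add: right_diff_distrib flip: exp_add)
  then have "norm (iexp x - iexp y) = norm (iexp (x - y) - 1)" by (simp add: norm_mult)
  also have "\<dots> \<le> \<bar>x - y\<bar>" using iexp_approx1[of "x - y" 0] by simp
  finally show ?thesis .
qed

section \<open>Convergence to zero and boundedness in probability\<close>

context prob_space
begin

lemma norm_expectation_diff:
  fixes F G :: "'a \<Rightarrow> 'b :: {banach, second_countable_topology}"
  assumes "integrable M F" "integrable M G"
  shows "norm (expectation F - expectation G) \<le> expectation (\<lambda>z. norm (F z - G z))"
  using integral_norm_bound[of M "\<lambda>z. F z - G z"] assms by simp

definition negligible_seq :: "(nat \<Rightarrow> 'a \<Rightarrow> real) \<Rightarrow> bool" where
  "negligible_seq X \<longleftrightarrow> (\<forall>n. X n \<in> borel_measurable M) \<and>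
     (\<forall>e>0. (\<lambda>n. prob {z \<in> space M. \<bar>X n z\<bar> \<ge> e}) \<longlonglongrightarrow> 0)"

text \<open>The bound is demanded only for large \<open>n\<close>, which a convergent moment bound
  provides. A single random variable enters as a constant sequence.\<close>

definition tight_seq :: "(nat \<Rightarrow> 'a \<Rightarrow> real) \<Rightarrow> bool" where
  "tight_seq X \<longleftrightarrow> (\<forall>n. X n \<in> borel_measurable M) \<and>
     (\<forall>e>0. \<exists>K>0. \<forall>\<^sub>F n in sequentially. prob {z \<in> space M. \<bar>X n z\<bar> \<ge> K} \<le> e)"

lemma negligible_seq_add:
  assumes "negligible_seq X" "negligible_seq Y"
  shows "negligible_seq (\<lambda>n z. X n z + Y n z)"
  unfolding negligible_seq_def
proof (intro conjI allI impI)
  have [measurable]: "X n \<in> borel_measurable M" "Y n \<in> borel_measurable M" for n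
    using assms by (auto simp: negligible_seq_def)
  show "(\<lambda>z. X n z + Y n z) \<in> borel_measurable M" for n by measurable
  fix e :: real assume e: "e > 0"
  have le: "prob {z \<in> space M. \<bar>X n z + Y n z\<bar> \<ge> e} \<le>
      prob {z \<in> space M. \<bar>X n z\<bar> \<ge> e / 2} + prob {z \<in> space M. \<bar>Y n z\<bar> \<ge> e / 2}" for n
  proof -
    have "prob {z \<in> space M. \<bar>X n z + Y n z\<bar> \<ge> e} \<le>
       prob ({z \<in> space M. \<bar>X n z\<bar> \<ge> e / 2} \<union> {z \<in> space M. \<bar>Y n z\<bar> \<ge> e / 2})"
      by (rule finite_measure_mono) auto
    also have "\<dots> \<le> prob {z \<in> space M. \<bar>X n z\<bar> \<ge> e / 2} + prob {z \<in> space M. \<bar>Y n z\<bar> \<ge> e / 2}"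
      by (rule measure_Un_le) auto
    finally show ?thesis .
  qed
  have lim: "(\<lambda>n. prob {z \<in> space M. \<bar>X n z\<bar> \<ge> e / 2} + prob {z \<in> space M. \<bar>Y n z\<bar> \<ge> e / 2}) \<longlonglongrightarrow> 0 + 0"
    using assms half_gt_zero[OF e] unfolding negligible_seq_def by (intro tendsto_add) blast+
  show "(\<lambda>n. prob {z \<in> space M. \<bar>X n z + Y n z\<bar> \<ge> e}) \<longlonglongrightarrow> 0"
    by (rule tendsto_sandwich[of "\<lambda>_. 0"]) (use le lim in auto)
qed

lemma negligible_seq_zero: "negligible_seq (\<lambda>_ _. 0)"
  by (simp add: negligible_seq_def)

lemma negligible_seq_sum:
  assumes "\<And>i. i \<in> I \<Longrightarrow> negligible_seq (X i)"
  shows "negligible_seq (\<lambda>n z. \<Sum>i\<in>I. X i n z)"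
  using assms
  by (induction I rule: infinite_finite_induct) (auto simp: negligible_seq_zero intro!: negligible_seq_add)

lemma negligible_seq_cong_AE:
  assumes X: "negligible_seq X" and Y: "\<And>n. Y n \<in> borel_measurable M"
    and eq: "\<And>n. AE z in M. X n z = Y n z"
  shows "negligible_seq Y"
proof -
  have [measurable]: "X n \<in> borel_measurable M" "Y n \<in> borel_measurable M" for n
    using X Y by (auto simp: negligible_seq_def)
  have "prob {z \<in> space M. \<bar>X n z\<bar> \<ge> e} = prob {z \<in> space M. \<bar>Y n z\<bar> \<ge> e}" for n e
    using eq[of n] by (intro finite_measure_eq_AE) auto
  then show ?thesis using X Y by (simp add: negligible_seq_def)
qed

text \<open>If \<open>|X Y| \<ge> e\<close>, then \<open>|X| \<ge> K\<close> or
  \<open>|Y| \<ge> e / K\<close>; tightness picks \<open>K\<close> first, and \<open>n\<close> is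
  taken large afterwards.\<close>

lemma negligible_seq_mult_tight:
  assumes "tight_seq X" "negligible_seq Y"
  shows "negligible_seq (\<lambda>n z. X n z * Y n z)"
  unfolding negligible_seq_def
proof (intro conjI allI impI)
  have [measurable]: "X n \<in> borel_measurable M" "Y n \<in> borel_measurable M" for n
    using assms by (auto simp: negligible_seq_def tight_seq_def)
  show "(\<lambda>z. X n z * Y n z) \<in> borel_measurable M" for n by measurable
  fix e :: real assume e: "e > 0"
  show "(\<lambda>n. prob {z \<in> space M. \<bar>X n z * Y n z\<bar> \<ge> e}) \<longlonglongrightarrow> 0"
  proof (rule tendstoI)
    fix d :: real assume d: "d > 0"
    then obtain K where K: "K > 0" "\<forall>\<^sub>F n in sequentially. prob {z \<in> space M. \<bar>X n z\<bar> \<ge> K} \<le> d / 2"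
      using assms(1) unfolding tight_seq_def by (meson half_gt_zero)
    have "(\<lambda>n. prob {z \<in> space M. \<bar>Y n z\<bar> \<ge> e / K}) \<longlonglongrightarrow> 0"
      using assms(2) e K(1) by (auto simp: negligible_seq_def)
    from order_tendstoD(2)[OF this, of "d / 2"] d
    have "\<forall>\<^sub>F n in sequentially. prob {z \<in> space M. \<bar>Y n z\<bar> \<ge> e / K} < d / 2" by simp
    with K(2) show "\<forall>\<^sub>F n in sequentially. dist (prob {z \<in> space M. \<bar>X n z * Y n z\<bar> \<ge> e}) 0 < d"
    proof eventually_elim
      case (elim n)
      have "\<bar>X n z\<bar> \<ge> K \<or> \<bar>Y n z\<bar> \<ge> e / K" if "\<bar>X n z * Y n z\<bar> \<ge> e" for z
      proof (rule ccontr)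
        assume "\<not> (\<bar>X n z\<bar> \<ge> K \<or> \<bar>Y n z\<bar> \<ge> e / K)"
        then have "\<bar>X n z\<bar> * \<bar>Y n z\<bar> < K * (e / K)"
          by (intro mult_strict_mono') auto
        then show False using that K(1) by (simp add: abs_mult)
      qed
      then have "prob {z \<in> space M. \<bar>X n z * Y n z\<bar> \<ge> e} \<le>
         prob ({z \<in> space M. \<bar>X n z\<bar> \<ge> K} \<union> {z \<in> space M. \<bar>Y n z\<bar> \<ge> e / K})"
        by (intro finite_measure_mono) auto
      also have "\<dots> \<le> prob {z \<in> space M. \<bar>X n z\<bar> \<ge> K} + prob {z \<in> space M. \<bar>Y n z\<bar> \<ge> e / K}"
        by (rule measure_Un_le) auto
      finally show ?case using elim by simp
    qed
  qed
qed

lemma negligible_seq_const: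
  assumes "c \<longlonglongrightarrow> (0 :: real)" shows "negligible_seq (\<lambda>n _. c n)"
  unfolding negligible_seq_def
proof (intro conjI allI impI)
  fix e :: real assume "e > 0"
  then have "\<forall>\<^sub>F n in sequentially. \<bar>c n\<bar> < e" using tendstoD[OF assms] by (simp add: dist_real_def)
  then have "\<forall>\<^sub>F n in sequentially. prob {z \<in> space M. \<bar>c n\<bar> \<ge> e} = 0"
    by eventually_elim (simp add: not_le)
  then show "(\<lambda>n. prob {z \<in> space M. \<bar>c n\<bar> \<ge> e}) \<longlonglongrightarrow> 0" by (rule tendsto_eventually)
qed simp

lemma negligible_seq_mult_null:
  assumes "c \<longlonglongrightarrow> 0" "tight_seq X" shows "negligible_seq (\<lambda>n z. c n * X n z)"
  using negligible_seq_mult_tight[OF assms(2) negligible_seq_const[OF assms(1)]]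
  by (simp add: mult.commute)

lemma tight_seq_const: "tight_seq (\<lambda>n _. c)"
  unfolding tight_seq_def by (auto intro!: exI[of _ "\<bar>c\<bar> + 1"])

lemma negligible_seq_cmult: "negligible_seq X \<Longrightarrow> negligible_seq (\<lambda>n z. c * X n z)"
  using negligible_seq_mult_tight[OF tight_seq_const] .

lemma second_moment_tail:
  assumes X: "square_integrable M X" and K: "K > 0"
  shows "prob {z \<in> space M. \<bar>X z\<bar> \<ge> K} \<le> expectation (\<lambda>z. (X z)\<^sup>2) / K\<^sup>2"
proof -
  have [measurable]: "X \<in> borel_measurable M" using X by (simp add: square_integrable_def)
  have "K \<le> \<bar>X z\<bar> \<longleftrightarrow> K\<^sup>2 \<le> (X z)\<^sup>2" for z
    using K abs_le_square_iff[of K "X z"] by simp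
  then show ?thesis
    using integral_Markov_inequality_measure[of M "\<lambda>z. (X z)\<^sup>2" "{}" "K\<^sup>2"] X K
    by (simp add: square_integrable_def)
qed

lemma tight_seq_second_moment:
  assumes X: "\<And>n. square_integrable M (X n)"
    and b: "\<And>n. expectation (\<lambda>z. (X n z)\<^sup>2) \<le> b n" and lim: "b \<longlonglongrightarrow> B"
  shows "tight_seq X"
  unfolding tight_seq_def
proof (intro conjI allI impI)
  show "X n \<in> borel_measurable M" for n using X by (auto simp: square_integrable_def)
  fix e :: real assume e: "e > 0"
  \<comment> \<open>Eventually \<open>b n < |B| + 1\<close>, and this \<open>K\<close> turns the
    Chebyshev bound \<open>(|B| + 1) / K^2\<close> into \<open>e\<close>.\<close>
  define K where "K = sqrt ((\<bar>B\<bar> + 1) / e)"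
  have K: "K > 0" "K\<^sup>2 = (\<bar>B\<bar> + 1) / e" using e by (auto simp: K_def)
  have "\<forall>\<^sub>F n in sequentially. b n < \<bar>B\<bar> + 1" using lim by (rule order_tendstoD) auto
  then have "\<forall>\<^sub>F n in sequentially. prob {z \<in> space M. \<bar>X n z\<bar> \<ge> K} \<le> e"
  proof eventually_elim
    case (elim n)
    have "prob {z \<in> space M. \<bar>X n z\<bar> \<ge> K} \<le> expectation (\<lambda>z. (X n z)\<^sup>2) / K\<^sup>2"
      by (rule second_moment_tail[OF X K(1)])
    also have "\<dots> \<le> (\<bar>B\<bar> + 1) / K\<^sup>2" using b[of n] elim by (intro divide_right_mono) auto
    also have "\<dots> = e" using e by (simp add: K(2))
    finally show ?case .
  qed
  with K(1) show "\<exists>K>0. \<forall>\<^sub>F n in sequentially. prob {z \<in> space M. \<bar>X n z\<bar> \<ge> K} \<le> e" by blast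
qed

text \<open>Where \<open>|X n - Y n| < e\<close> the exponentials differ by at most
  \<open>|t| e\<close>, elsewhere by at most \<open>2\<close>.\<close>

lemma negligible_seq_iexp:
  assumes neg: "negligible_seq (\<lambda>n z. X n z - Y n z)"
    and X: "\<And>n. X n \<in> borel_measurable M" and Y: "\<And>n. Y n \<in> borel_measurable M"
  shows "(\<lambda>n. expectation (\<lambda>z. iexp (t * X n z)) - expectation (\<lambda>z. iexp (t * Y n z))) \<longlonglongrightarrow> 0"
proof (rule tendstoI)
  note [measurable] = X Y
  fix d :: real assume d: "d > 0"
  \<comment> \<open>The Lipschitz part stays below \<open>d / 2\<close>, and twice the exceptional
    probability, taken below \<open>d / 4\<close>, fills the other half.\<close>
  define e where "e = d / (2 * (\<bar>t\<bar> + 1))"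
  have e: "e > 0" "\<bar>t\<bar> * e < d / 2" using d by (auto simp: e_def field_simps add_nonneg_pos)
  have "(\<lambda>n. prob {z \<in> space M. \<bar>X n z - Y n z\<bar> \<ge> e}) \<longlonglongrightarrow> 0"
    using neg e by (simp add: negligible_seq_def)
  from order_tendstoD(2)[OF this, of "d / 4"] d
  have "\<forall>\<^sub>F n in sequentially. prob {z \<in> space M. \<bar>X n z - Y n z\<bar> \<ge> e} < d / 4" by simp
  then show "\<forall>\<^sub>F n in sequentially.
    dist (expectation (\<lambda>z. iexp (t * X n z)) - expectation (\<lambda>z. iexp (t * Y n z))) 0 < d"
  proof eventually_elim
    case (elim n)
    let ?A = "{z \<in> space M. \<bar>X n z - Y n z\<bar> \<ge> e}"
    have int: "integrable M (\<lambda>z. iexp (t * X n z))" "integrable M (\<lambda>z. iexp (t * Y n z))"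
      by (intro integrable_iexp; simp)+
    have iA: "integrable M (\<lambda>z. \<bar>t\<bar> * e + 2 * indicator ?A z)"
      by (intro Bochner_Integration.integrable_add integrable_mult_right integrable_const
          integrable_real_indicator) (auto simp: less_top[symmetric])
    have "norm (expectation (\<lambda>z. iexp (t * X n z)) - expectation (\<lambda>z. iexp (t * Y n z))) \<le>
        expectation (\<lambda>z. norm (iexp (t * X n z) - iexp (t * Y n z)))"
      by (rule norm_expectation_diff[OF int])
    also have "\<dots> \<le> expectation (\<lambda>z. \<bar>t\<bar> * e + 2 * indicator ?A z)"
    proof (rule integral_mono)
      show "integrable M (\<lambda>z. norm (iexp (t * X n z) - iexp (t * Y n z)))" using int by auto
      fix z assume z: "z \<in> space M"
      have 1: "norm (iexp (t * X n z) - iexp (t * Y n z)) \<le> \<bar>t * X n z - t * Y n z\<bar>"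
        by (rule norm_iexp_diff)
      have 2: "norm (iexp (t * X n z) - iexp (t * Y n z)) \<le> 2"
        using norm_triangle_ineq4[of "iexp (t * X n z)" "iexp (t * Y n z)"] by simp
      show "norm (iexp (t * X n z) - iexp (t * Y n z)) \<le> \<bar>t\<bar> * e + 2 * indicator ?A z"
      proof (cases "z \<in> ?A")
        case True
        then show ?thesis using 2 e by (simp add: add_increasing)
      next
        case False
        then have "\<bar>t\<bar> * \<bar>X n z - Y n z\<bar> \<le> \<bar>t\<bar> * e" using z by (intro mult_left_mono) auto
        moreover have "\<bar>t * X n z - t * Y n z\<bar> = \<bar>t\<bar> * \<bar>X n z - Y n z\<bar>"
          by (simp add: abs_mult[symmetric] right_diff_distrib)
        ultimately show ?thesis using 1 False by simp
      qed
    qed (rule iA)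
    also have "\<dots> = \<bar>t\<bar> * e + 2 * prob ?A"
    proof -
      have "integrable M (indicat_real ?A)"
        by (rule integrable_real_indicator) (auto simp: less_top[symmetric])
      then show ?thesis by (simp add: prob_space)
    qed
    also have "\<dots> < d" using elim e by simp
    finally show ?case by (simp add: dist_norm)
  qed
qed

end

text \<open>The polynomial behind \<open>hermite_product\<close>, over any index set and at real
  arguments \<open>w\<close>, so that the same polynomial can be evaluated at the Rademacher linear
  forms and at the noise.\<close>

definition hermite_form :: "nat set \<Rightarrow> (nat \<Rightarrow> nat) \<Rightarrow> (nat \<Rightarrow> real) \<Rightarrow> real" where
  "hermite_form J m w = (\<Prod>l\<in>m ` J. hermite (card {j \<in> J. m j = l}) (w l))"

lemma hermite_product_eq:
  "hermite_product \<xi> \<psi> k m z = hermite_form {1..k} m (\<lambda>l. \<xi> (\<psi> l) z)"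
  by (simp add: hermite_product_def hermite_form_def)

lemma hermite_form_superset:
  assumes "finite L" "m ` J \<subseteq> L"
  shows "hermite_form J m w = (\<Prod>l\<in>L. hermite (card {j \<in> J. m j = l}) (w l))"
  unfolding hermite_form_def
proof (rule prod.mono_neutral_left[OF assms], rule ballI)
  fix l assume "l \<in> L - m ` J"
  then have "{j \<in> J. m j = l} = {}" by auto
  then show "hermite (card {j \<in> J. m j = l}) (w l) = 1" by (simp only: card.empty hermite.simps)
qed

text \<open>At \<open>r = 0\<close> the truncated index \<open>r - 1\<close> is \<open>0\<close>,
  harmless because its coefficient is \<open>0\<close>.\<close>

lemma hermite_Suc: "hermite (Suc r) x = x * hermite r x - real r * hermite (r - 1) x"
  by (cases r) auto

text \<open>The exact counterpart of \<open>chaos_recursion\<close>. Only the factor of the index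
  \<open>m j0\<close> changes; if it occurs \<open>r\<close> times in \<open>J\<close>, each of
  these \<open>r\<close> positions contributes one copy of the product with \<open>H_(r-1)\<close>,
  which accounts for the coefficient \<open>r\<close> of the Hermite recursion.\<close>

lemma hermite_form_insert:
  assumes J: "finite J" and j0: "j0 \<notin> J"
  shows "hermite_form (insert j0 J) m w =
    w (m j0) * hermite_form J m w -
    (\<Sum>p\<in>J. if m p = m j0 then hermite_form (J - {p}) m w else 0)"
proof -
  let ?L = "insert (m j0) (m ` J)"
  let ?l = "m j0"
  define r where "r = card {j \<in> J. m j = ?l}"
  define c where "c = (\<Prod>l\<in>?L - {?l}. hermite (card {j \<in> J. m j = l}) (w l))"
  have fin: "finite ?L" using J by simp
  have split: "hermite_form I m w = hermite (card {j \<in> I. m j = ?l}) (w ?l) *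
      (\<Prod>l\<in>?L - {?l}. hermite (card {j \<in> I. m j = l}) (w l))" if "m ` I \<subseteq> ?L" for I
    using fin that by (subst hermite_form_superset[OF fin that], subst prod.remove[of _ ?l]) auto
  have 1: "hermite_form (insert j0 J) m w = hermite (Suc r) (w ?l) * c"
  proof -
    have "{j \<in> insert j0 J. m j = ?l} = insert j0 {j \<in> J. m j = ?l}" by auto
    moreover have "{j \<in> insert j0 J. m j = l} = {j \<in> J. m j = l}" if "l \<noteq> ?l" for l using that by auto
    ultimately show ?thesis
      using J j0 by (subst split) (auto simp: r_def c_def intro!: prod.cong)
  qed
  have 2: "hermite_form J m w = hermite r (w ?l) * c"
    by (subst split) (auto simp: r_def c_def)
  have 3: "hermite_form (J - {p}) m w = hermite (r - 1) (w ?l) * c" if p: "p \<in> J" "m p = ?l" for p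
  proof -
    have "{j \<in> J - {p}. m j = ?l} = {j \<in> J. m j = ?l} - {p}" by auto
    moreover have "{j \<in> J - {p}. m j = l} = {j \<in> J. m j = l}" if "l \<noteq> ?l" for l using that p by auto
    ultimately show ?thesis
      using J p by (subst split) (auto simp: r_def c_def intro!: prod.cong)
  qed
  have "(\<Sum>p\<in>J. if m p = m j0 then hermite_form (J - {p}) m w else 0) =
      (\<Sum>p\<in>J. if m p = ?l then hermite (r - 1) (w ?l) * c else 0)"
    by (intro sum.cong) (auto simp: 3)
  also have "\<dots> = real r * (hermite (r - 1) (w ?l) * c)"
    using J by (simp add: r_def flip: sum.inter_filter)
  finally show ?thesis by (simp add: 1 2 hermite_Suc algebra_simps)
qed

lemma measurable_hermite [measurable]: "hermite r \<in> borel_measurable borel"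
proof -
  have "continuous_on UNIV (hermite r)"
  proof (induction r rule: less_induct)
    case (less r)
    show ?case
    proof (cases r)
      case (Suc q)
      have "hermite r = (\<lambda>x. x * hermite q x - real q * hermite (q - 1) x)"
        by (simp add: Suc hermite_Suc fun_eq_iff del: hermite.simps(3))
      then show ?thesis using less Suc by (auto intro!: continuous_intros)
    qed (simp add: hermite.simps(1)[abs_def])
  qed
  then show ?thesis by (rule borel_measurable_continuous_onI)
qed

lemma measurable_hermite_form:
  assumes "\<And>l. l \<in> m ` J \<Longrightarrow> (\<lambda>z. w z l) \<in> borel_measurable M"
  shows "(\<lambda>z. hermite_form J m (w z)) \<in> borel_measurable M"
  unfolding hermite_form_def
  by (intro borel_measurable_prod measurable_compose[OF assms measurable_hermite])

lemma continuous_on_tensor: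
  assumes "\<And>j. j \<in> J \<Longrightarrow> continuous_on {0..1} (h j)"
  shows "continuous_on (cube_on J) (tensor J h)"
  unfolding tensor_def[abs_def]
  by (intro continuous_on_prod continuous_on_compose2[OF assms]
      continuous_on_product_then_coordinatewise[OF continuous_on_id]) (auto simp: PiE_iff)

section \<open>Comparison of the chaos with Hermite products of linear forms\<close>

context rademacher
begin

lemma tight_chaos:
  assumes "finite J" "continuous_on (cube_on J) F"
  shows "tight_seq (\<lambda>n. chaos n J F)"
  using square_integrable_chaos[OF assms(1)] chaos_L2_bound[OF assms(1)] chaos_L2_bound_tendsto[OF assms]
  by (rule tight_seq_second_moment)

text \<open>A linear form is a chaos of order one, so it inherits tightness from
  \<open>tight_chaos\<close>.\<close>

lemma linear_form_eq_chaos: "linear_form n h z = chaos n {0} (tensor {0} (\<lambda>_. h)) z"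
proof -
  have "offdiag V {0} H = (\<Sum>v\<in>V. H 0 v)" if "finite V" for V H
    using offdiag_insert[of "{}" V 0 H] that
    by (simp add: offdiag_def inj_tuples_def)
  then show ?thesis by (simp add: chaos_tensor_eq linear_form_def)
qed

lemma tight_linear_form:
  assumes "continuous_on {0..1} h" shows "tight_seq (\<lambda>n. linear_form n h)"
  unfolding linear_form_eq_chaos[abs_def] using assms
  by (intro tight_chaos continuous_on_tensor) auto

end

locale rademacher_onb = rademacher M \<epsilon> + onb \<psi> for M :: "'a measure" and \<epsilon> \<psi> +
  assumes continuous_basis: "m \<ge> 1 \<Longrightarrow> continuous_on {0..1} (\<psi> m)"
begin

text \<open>Chaos and Hermite product satisfy the same recursion up to vanishing errors. It reaches
  back one and two indices and deletes arbitrary positions, hence strong induction on the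
  cardinality with \<open>J\<close> general.\<close>

theorem chaos_minus_hermite:
  assumes "finite J" "\<And>j. j \<in> J \<Longrightarrow> m j \<ge> 1"
  shows "negligible_seq (\<lambda>n z. chaos n J (\<Psi> J m) z - hermite_form J m (\<lambda>l. linear_form n (\<psi> l) z))"
  using assms
proof (induction "card J" arbitrary: J rule: less_induct)
  case less
  show ?case
  proof (cases "J = {}")
    case True
    then show ?thesis
      by (simp add: chaos_def inj_tuples_def hermite_form_def tensor_def negligible_seq_zero)
  next
    case False
    then obtain j0 I where I: "J = insert j0 I" "j0 \<notin> I"
      by (metis equals0I mk_disjoint_insert)
    then have finI: "finite I" and cI: "card I < card J" using less.prems by auto
    have cP: "card (I - {p}) < card J" for p
      using cI card_Diff1_le[of I p] by linarith
    have ge: "m j0 \<ge> 1" "\<And>j. j \<in> I \<Longrightarrow> m j \<ge> 1" using less.prems(2) I by auto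
    let ?w = "\<lambda>n z l. linear_form n (\<psi> l) z"
    let ?h = "\<lambda>j. \<psi> (m j)"
    let ?D = "\<lambda>K n. chaos n K (\<Psi> K m)"
    let ?E = "\<lambda>K n z. ?D K n z - hermite_form K m (?w n z)"
    let ?d = "\<lambda>p. if m p = m j0 then 1 else 0 :: real"
    let ?R = "\<lambda>p n. (\<Sum>v\<in>{1..n}. \<psi> (m j0) (real v / real n) * \<psi> (m p) (real v / real n)) / real n"
    let ?X = "\<lambda>p q n. chaos n (I - {p}) (tensor (I - {p}) (?h(q := \<lambda>s. \<psi> (m j0) s * \<psi> (m p) s * \<psi> (m q) s)))"
    have tightD: "tight_seq (\<lambda>n. ?D (I - {p}) n)" for p
      using finI ge by (intro tight_chaos continuous_on_tensor continuous_basis) auto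
    have tightX: "tight_seq (\<lambda>n. ?X p q n)" if "p \<in> I" "q \<in> I - {p}" for p q
      using finI ge that
      by (intro tight_chaos continuous_on_tensor) (auto intro!: continuous_intros continuous_basis)
    \<comment> \<open>The Riemann sum tends to the inner product of two basis functions, which is
      the Kronecker delta selecting the positions in \<open>hermite_form_insert\<close>.\<close>
    have R: "(\<lambda>n. ?R p n - ?d p) \<longlonglongrightarrow> 0" if "p \<in> I" for p
    proof -
      have "(\<integral>s. \<psi> (m j0) s * \<psi> (m p) s \<partial>unit_interval) = ?d p"
        using onb ge that by (auto simp: orthonormal_basis_def)
      moreover have "?R p \<longlonglongrightarrow> (\<integral>s. \<psi> (m j0) s * \<psi> (m p) s \<partial>unit_interval)"
        using ge that by (intro riemann_unit_interval continuous_intros continuous_basis) auto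
      ultimately show ?thesis by (simp add: LIM_zero)
    qed
    have inv: "(\<lambda>n. 1 / real n) \<longlonglongrightarrow> 0" by (rule lim_1_over_n)
    \<comment> \<open>The difference of the two recursions: tight times negligible; a null sequence
      times a tight one; the induction hypothesis with two indices fewer; and the triple collisions,
      which are \<open>1/n\<close> times a tight chaos.\<close>
    let ?err = "\<lambda>n z. ?w n z (m j0) * ?E I n z +
       ((\<Sum>p\<in>I. - 1 * ((?R p n - ?d p) * ?D (I - {p}) n z + ?d p * ?E (I - {p}) n z)) +
        (\<Sum>p\<in>I. \<Sum>q\<in>I - {p}. 1 / real n * ?X p q n z))"
    have neg: "negligible_seq ?err"
    proof (intro negligible_seq_add negligible_seq_sum negligible_seq_cmult)
      show "negligible_seq (\<lambda>n z. ?w n z (m j0) * ?E I n z)"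
        using less.hyps[OF cI finI] ge
        by (intro negligible_seq_mult_tight tight_linear_form continuous_basis) auto
      fix p assume p: "p \<in> I"
      show "negligible_seq (\<lambda>n z. (?R p n - ?d p) * ?D (I - {p}) n z)"
        by (rule negligible_seq_mult_null[OF R[OF p] tightD])
      show "negligible_seq (\<lambda>n. ?E (I - {p}) n)"
        using finI ge by (intro less.hyps cP) auto
      show "negligible_seq (\<lambda>n z. 1 / real n * ?X p q n z)" if "q \<in> I - {p}" for q
        by (rule negligible_seq_mult_null[OF inv tightX[OF p that]])
    qed
    \<comment> \<open>Only almost surely, since the recursion of the chaos needs every sign to be
      \<open>1\<close> or \<open>-1\<close>.\<close>
    have "AE z in M. ?err n z = ?E J n z" for n
      using AE_signs
    proof eventually_elim
      case (elim z)
      have D: "?D J n z = ?w n z (m j0) * ?D I n z -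
          (\<Sum>p\<in>I. ?R p n * ?D (I - {p}) n z - 1 / real n * (\<Sum>q\<in>I - {p}. ?X p q n z))"
        using chaos_recursion[OF finI I(2), of z n ?h] elim unfolding I(1) by blast
      have H: "hermite_form J m (?w n z) = ?w n z (m j0) * hermite_form I m (?w n z) -
          (\<Sum>p\<in>I. ?d p * hermite_form (I - {p}) m (?w n z))"
        unfolding I(1) hermite_form_insert[OF finI I(2)]
        by (intro arg_cong2[where f="(-)"] refl sum.cong) auto
      show ?case unfolding D H
        by (simp add: sum_subtractf sum.distrib algebra_simps sum_negf sum_distrib_left)
    qed
    note AE_eq = this
    show ?thesis
    proof (rule negligible_seq_cong_AE[OF neg _ AE_eq])
      show "?E J n \<in> borel_measurable M" for n
        using less.prems(1)
        by (intro borel_measurable_diff measurable_chaos measurable_hermite_form measurable_linear_form)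
    qed
  qed
qed

end

subsection \<open>Joint convergence from characteristic functions\<close>

text \<open>The usual interchange of limits. It serves three times: for cutting a Taylor series, for
  the cutoff of large values and for truncating the Hermite series.\<close>

lemma tendsto_uniform_approx:
  fixes x :: "nat \<Rightarrow> 'a :: real_normed_vector"
  assumes "\<And>e. e > 0 \<Longrightarrow> \<exists>y y'. y \<longlonglongrightarrow> y' \<and> (\<forall>\<^sub>F n in sequentially. norm (x n - y n) \<le> e) \<and> norm (x' - y') \<le> e"
  shows "x \<longlonglongrightarrow> x'"
proof (rule tendstoI)
  fix e :: real assume "e > 0"
  then obtain y y' where y: "y \<longlonglongrightarrow> y'" "\<forall>\<^sub>F n in sequentially. norm (x n - y n) \<le> e / 4"
      "norm (x' - y') \<le> e / 4"
    using assms[of "e / 4"] by auto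
  have "\<forall>\<^sub>F n in sequentially. dist (y n) y' < e / 4"
    using tendstoD[OF y(1), of "e / 4"] \<open>e > 0\<close> by simp
  with y(2) show "\<forall>\<^sub>F n in sequentially. dist (x n) x' < e"
  proof eventually_elim
    case (elim n)
    have "norm (x n - x') \<le> norm (x n - y n) + norm (y n - y') + norm (x' - y')"
      using norm_triangle_ineq4[of "(x n - y n) + (y n - y')" "x' - y'"]
        norm_triangle_ineq[of "x n - y n" "y n - y'"] by simp
    then show ?case using elim y(3) \<open>e > 0\<close> by (simp add: dist_norm)
  qed
qed

section \<open>Laws reweighted by a bounded factor\<close>

context prob_space
begin

text \<open>The normaliser of the density \<open>U + (B + 1)\<close>, which for
  \<open>|U| \<le> B\<close> is at least \<open>1\<close>.\<close>

definition weight :: "real \<Rightarrow> ('a \<Rightarrow> real) \<Rightarrow> real" where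
  "weight B U = expectation U + (B + 1)"

definition weighted_law :: "real \<Rightarrow> ('a \<Rightarrow> real) \<Rightarrow> ('a \<Rightarrow> real) \<Rightarrow> real measure" where
  "weighted_law B U X = distr (density M (\<lambda>z. (U z + (B + 1)) / weight B U)) borel X"

context
  fixes X U :: "'a \<Rightarrow> real" and B :: real
  assumes X [measurable]: "X \<in> borel_measurable M" and U [measurable]: "U \<in> borel_measurable M"
    and bound: "\<And>z. \<bar>U z\<bar> \<le> B"
begin

lemma weight_pos: "weight B U > 0"
proof -
  have "integrable M U" using bound by (intro integrable_const_bound[where B=B]) auto
  then have "expectation (\<lambda>z. - B) \<le> expectation U"
    using bound by (intro integral_mono) (auto simp: abs_le_iff minus_le_iff)
  then show ?thesis by (simp add: prob_space weight_def)
qed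

text \<open>The shift by \<open>B + 1\<close> adds a multiple of the unweighted expectation, so
  weighted and unweighted convergence have to be known together.\<close>

lemma
  fixes f :: "real \<Rightarrow> 'b :: {banach, second_countable_topology}"
  shows real_distribution_weighted_law: "real_distribution (weighted_law B U X)"
    and integral_weighted_law: "f \<in> borel_measurable borel \<Longrightarrow> (\<And>x. norm (f x) \<le> D) \<Longrightarrow>
      (\<integral>x. f x \<partial>weighted_law B U X) =
      (expectation (\<lambda>z. U z *\<^sub>R f (X z)) + (B + 1) *\<^sub>R expectation (\<lambda>z. f (X z))) /\<^sub>R weight B U"
proof -
  let ?V = "\<lambda>z. (U z + (B + 1)) / weight B U"
  have V0: "0 \<le> ?V z" for z
    using bound[of z] weight_pos by (intro divide_nonneg_pos) auto
  have iU: "integrable M U" using bound by (intro integrable_const_bound[where B=B]) auto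
  have "emeasure (density M ?V) (space (density M ?V)) = (\<integral>\<^sup>+z. ennreal (?V z) \<partial>M)"
    by (simp add: emeasure_density cong: nn_integral_cong_AE)
  also have "\<dots> = ennreal (expectation ?V)"
    using iU V0 by (intro nn_integral_eq_integral) auto
  also have "expectation ?V = 1"
    using iU weight_pos by (simp add: prob_space weight_def)
  finally interpret D: prob_space "density M ?V" by (intro prob_spaceI) simp
  show "real_distribution (weighted_law B U X)"
    unfolding weighted_law_def real_distribution_def real_distribution_axioms_def
    by (auto intro!: D.prob_space_distr)
  assume f [measurable]: "f \<in> borel_measurable borel" and D: "\<And>x. norm (f x) \<le> D"
  have if1: "integrable M (\<lambda>z. f (X z))"
    using D by (intro integrable_const_bound[where B=D]) auto
  have "0 \<le> B" using bound[of undefined] by linarith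
  then have if2: "integrable M (\<lambda>z. U z *\<^sub>R f (X z))"
    using D bound by (intro integrable_const_bound[where B="B * D"]) (auto intro!: mult_mono)
  have "(\<integral>x. f x \<partial>weighted_law B U X) = expectation (\<lambda>z. ?V z *\<^sub>R f (X z))"
    unfolding weighted_law_def by (subst integral_distr) (auto simp: integral_density V0)
  also have "\<dots> = expectation (\<lambda>z. (U z *\<^sub>R f (X z) + (B + 1) *\<^sub>R f (X z)) /\<^sub>R weight B U)"
    by (simp add: scaleR_add_left[symmetric] divide_inverse mult.commute)
  finally show "(\<integral>x. f x \<partial>weighted_law B U X) =
      (expectation (\<lambda>z. U z *\<^sub>R f (X z)) + (B + 1) *\<^sub>R expectation (\<lambda>z. f (X z))) /\<^sub>R weight B U"
    using if1 if2 by simp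
qed

end

end

locale two_prob_spaces = M: prob_space M + N: prob_space N
  for M :: "'a measure" and N :: "'b measure"
begin

text \<open>The weights are shifted to be positive; the weighted laws of \<open>X n\<close> then converge by
  Levy's theorem.\<close>

lemma weighted_levy_real:
  fixes U X :: "nat \<Rightarrow> 'a \<Rightarrow> real" and U' X' :: "'b \<Rightarrow> real" and g :: "real \<Rightarrow> real"
  assumes X [measurable]: "\<And>n. X n \<in> borel_measurable M" and X' [measurable]: "X' \<in> borel_measurable N"
    and U: "\<And>n. U n \<in> borel_measurable M" and U': "U' \<in> borel_measurable N"
    and bound: "\<And>n z. \<bar>U n z\<bar> \<le> B" "\<And>z. \<bar>U' z\<bar> \<le> B"
    and conv: "\<And>s. (\<lambda>n. \<integral>z. of_real (U n z) * iexp (s * X n z) \<partial>M) \<longlonglongrightarrow> (\<integral>z. of_real (U' z) * iexp (s * X' z) \<partial>N)"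
    and conv1: "\<And>s. (\<lambda>n. \<integral>z. iexp (s * X n z) \<partial>M) \<longlonglongrightarrow> (\<integral>z. iexp (s * X' z) \<partial>N)"
    and g: "continuous_on UNIV g" "\<And>x. \<bar>g x\<bar> \<le> C"
  shows "(\<lambda>n. \<integral>z. U n z * g (X n z) \<partial>M) \<longlonglongrightarrow> (\<integral>z. U' z * g (X' z) \<partial>N)"
proof -
  let ?v = "\<lambda>n. M.weight B (U n)" and ?v' = "N.weight B U'"
  have gm [measurable]: "g \<in> borel_measurable borel" using g(1) by (rule borel_measurable_continuous_onI)
  \<comment> \<open>At frequency \<open>0\<close> the weighted transforms are the expectations of
    the weights, so the normalisers converge.\<close>
  have "(\<lambda>n. Re (\<integral>z. of_real (U n z) \<partial>M)) \<longlonglongrightarrow> Re (\<integral>z. of_real (U' z) \<partial>N)"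
    using conv[of 0] by (intro tendsto_Re) simp
  then have vlim: "?v \<longlonglongrightarrow> ?v'"
    unfolding M.weight_def N.weight_def by (intro tendsto_add) simp_all
  note v = M.weight_pos[OF X U bound(1)] and v' = N.weight_pos[OF X' U' bound(2)]
  let ?\<mu> = "\<lambda>n. M.weighted_law B (U n) (X n)" and ?\<mu>' = "N.weighted_law B U' X'"
  note rd = M.real_distribution_weighted_law[OF X U bound(1)]
  note rd' = N.real_distribution_weighted_law[OF X' U' bound(2)]
  note int = M.integral_weighted_law[OF X U bound(1)]
  note int' = N.integral_weighted_law[OF X' U' bound(2)]
  \<comment> \<open>The transform of a weighted law is a combination of the transforms in
    \<open>conv\<close> and \<open>conv1\<close>, divided by the normaliser.\<close>
  have "(\<lambda>n. char (?\<mu> n) s) \<longlonglongrightarrow> char ?\<mu>' s" for s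
  proof -
    have m: "(\<lambda>x. iexp (s * x)) \<in> borel_measurable borel" "norm (iexp (s * x)) \<le> 1" for x by simp_all
    show ?thesis
      unfolding char_def int[OF m] int'[OF m] scaleR_conv_of_real using v'
      by (intro tendsto_mult tendsto_add tendsto_const conv conv1 tendsto_of_real tendsto_inverse vlim) auto
  qed
  then have wc: "weak_conv_m ?\<mu> ?\<mu>'" by (intro levy_continuity rd rd')
  have gc: "isCont g x" "norm (g x) \<le> C" for x
    using g by (auto simp: continuous_on_eq_continuous_at)
  have lim: "(\<lambda>n. \<integral>x. g x \<partial>?\<mu> n) \<longlonglongrightarrow> (\<integral>x. g x \<partial>?\<mu>')"
    by (rule weak_conv_imp_integral_bdd_continuous_conv[OF rd rd' wc gc])
  have lim0: "(\<lambda>n. \<integral>z. g (X n z) \<partial>M) \<longlonglongrightarrow> (\<integral>z. g (X' z) \<partial>N)"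
  proof -
    have "weak_conv_m (\<lambda>n. distr M borel (X n)) (distr N borel X')"
      by (intro levy_continuity M.real_distribution_distr N.real_distribution_distr)
        (use conv1 in \<open>auto simp: char_def integral_distr\<close>)
    from weak_conv_imp_integral_bdd_continuous_conv[OF _ _ this gc]
    show ?thesis by (auto simp: integral_distr)
  qed
  \<comment> \<open>The formula for integrals against the weighted law is solved for the wanted
    term, which removes the effect of the shift.\<close>
  have "(\<integral>z. U n z * g (X n z) \<partial>M) = ?v n * (\<integral>x. g x \<partial>?\<mu> n) - (B + 1) * (\<integral>z. g (X n z) \<partial>M)" for n
    using int[OF gm gc(2), of n] v[of n] by (simp add: field_simps)
  moreover have "(\<integral>z. U' z * g (X' z) \<partial>N) = ?v' * (\<integral>x. g x \<partial>?\<mu>') - (B + 1) * (\<integral>z. g (X' z) \<partial>N)"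
    using int'[OF gm gc(2)] v' by (simp add: field_simps)
  ultimately show ?thesis
    by (simp only:) (intro tendsto_diff tendsto_mult tendsto_const vlim lim lim0)
qed

text \<open>The weights that occur are complex, being products with exponentials of other
  coordinates. Their real and imaginary parts are real weights to which
  \<open>weighted_levy_real\<close> applies.\<close>

lemma weighted_levy:
  fixes U :: "nat \<Rightarrow> 'a \<Rightarrow> complex" and X :: "nat \<Rightarrow> 'a \<Rightarrow> real"
    and U' :: "'b \<Rightarrow> complex" and X' :: "'b \<Rightarrow> real" and g :: "real \<Rightarrow> real"
  assumes X [measurable]: "\<And>n. X n \<in> borel_measurable M" and X' [measurable]: "X' \<in> borel_measurable N"
    and U [measurable]: "\<And>n. U n \<in> borel_measurable M" and U' [measurable]: "U' \<in> borel_measurable N"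
    and bound: "\<And>n z. norm (U n z) \<le> B" "\<And>z. norm (U' z) \<le> B"
    and conv: "\<And>s. (\<lambda>n. \<integral>z. U n z * iexp (s * X n z) \<partial>M) \<longlonglongrightarrow> (\<integral>z. U' z * iexp (s * X' z) \<partial>N)"
    and conv1: "\<And>s. (\<lambda>n. \<integral>z. iexp (s * X n z) \<partial>M) \<longlonglongrightarrow> (\<integral>z. iexp (s * X' z) \<partial>N)"
    and g: "continuous_on UNIV g" "\<And>x. \<bar>g x\<bar> \<le> C"
  shows "(\<lambda>n. \<integral>z. U n z * of_real (g (X n z)) \<partial>M) \<longlonglongrightarrow> (\<integral>z. U' z * of_real (g (X' z)) \<partial>N)"
proof -
  have [measurable]: "g \<in> borel_measurable borel" using g(1) by (rule borel_measurable_continuous_onI)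
  have B: "B \<ge> 0" using bound(2)[of undefined] norm_ge_zero order_trans by blast
  have iU: "integrable M (\<lambda>z. U n z * iexp (s * X n z))" for n s
    using bound by (intro M.integrable_const_bound[where B=B]) (auto simp: norm_mult)
  have iU': "integrable N (\<lambda>z. U' z * iexp (s * X' z))" for s
    using bound by (intro N.integrable_const_bound[where B=B]) (auto simp: norm_mult)
  have ig: "integrable M (\<lambda>z. U n z * of_real (g (X n z)))" for n
    using bound g(2) B by (intro M.integrable_const_bound[where B="B * C"]) (auto simp: norm_mult intro!: mult_mono)
  have ig': "integrable N (\<lambda>z. U' z * of_real (g (X' z)))"
    using bound g(2) B by (intro N.integrable_const_bound[where B="B * C"]) (auto simp: norm_mult intro!: mult_mono)
  \<comment> \<open>Taking the real part of the whole transform would mix the weight with the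
    exponential. Instead the parts of \<open>u\<close> are written with \<open>u\<close> and its
    conjugate, and conjugation moves the frequency from \<open>s\<close> to \<open>- s\<close>,
    where convergence is also assumed.\<close>
  have re: "of_real (Re u) * iexp (s * x) = (u * iexp (s * x) + cnj (u * iexp (- s * x))) / 2"
    and im: "of_real (Im u) * iexp (s * x) = (u * iexp (s * x) - cnj (u * iexp (- s * x))) / (2 * \<i>)"
    for u s x
  proof -
    have c: "cnj (u * iexp (- s * x)) = cnj u * iexp (s * x)" by (simp add: exp_cnj)
    have "of_real (Re u) = (u + cnj u) / 2" "of_real (Im u) = (u - cnj u) / (2 * \<i>)"
      by (simp_all add: complex_eq_iff)
    then show "of_real (Re u) * iexp (s * x) = (u * iexp (s * x) + cnj (u * iexp (- s * x))) / 2"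
      "of_real (Im u) * iexp (s * x) = (u * iexp (s * x) - cnj (u * iexp (- s * x))) / (2 * \<i>)"
      unfolding c by (simp_all only: times_divide_eq_left distrib_right left_diff_distrib)
  qed
  have conv_cnj: "(\<lambda>n. \<integral>z. cnj (U n z * iexp (- s * X n z)) \<partial>M) \<longlonglongrightarrow>
      (\<integral>z. cnj (U' z * iexp (- s * X' z)) \<partial>N)" for s
    using tendsto_cnj[OF conv[of "- s"]] by (simp only: Bochner_Integration.integral_cnj)
  have Re_le: "\<bar>Re (U n z)\<bar> \<le> B" "\<bar>Im (U n z)\<bar> \<le> B" for n z
    using bound(1) abs_Re_le_cmod abs_Im_le_cmod order_trans by blast+
  have Re_le': "\<bar>Re (U' z)\<bar> \<le> B" "\<bar>Im (U' z)\<bar> \<le> B" for z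
    using bound(2) abs_Re_le_cmod abs_Im_le_cmod order_trans by blast+
  have c1: "(\<lambda>n. \<integral>z. Re (U n z) * g (X n z) \<partial>M) \<longlonglongrightarrow> (\<integral>z. Re (U' z) * g (X' z) \<partial>N)"
  proof (rule weighted_levy_real[OF X X' _ _ Re_le(1) Re_le'(1) _ conv1 g])
    show "(\<lambda>n. \<integral>z. of_real (Re (U n z)) * iexp (s * X n z) \<partial>M) \<longlonglongrightarrow>
        (\<integral>z. of_real (Re (U' z)) * iexp (s * X' z) \<partial>N)" for s
      unfolding re integral_divide_zero
        Bochner_Integration.integral_add[OF iU integrable_cnj[OF iU]]
        Bochner_Integration.integral_add[OF iU' integrable_cnj[OF iU']]
      by (intro tendsto_divide tendsto_add conv conv_cnj tendsto_const) auto
  qed auto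
  have c2: "(\<lambda>n. \<integral>z. Im (U n z) * g (X n z) \<partial>M) \<longlonglongrightarrow> (\<integral>z. Im (U' z) * g (X' z) \<partial>N)"
  proof (rule weighted_levy_real[OF X X' _ _ Re_le(2) Re_le'(2) _ conv1 g])
    show "(\<lambda>n. \<integral>z. of_real (Im (U n z)) * iexp (s * X n z) \<partial>M) \<longlonglongrightarrow>
        (\<integral>z. of_real (Im (U' z)) * iexp (s * X' z) \<partial>N)" for s
      unfolding im integral_divide_zero
        Bochner_Integration.integral_diff[OF iU integrable_cnj[OF iU]]
        Bochner_Integration.integral_diff[OF iU' integrable_cnj[OF iU']]
      by (intro tendsto_divide tendsto_diff conv conv_cnj tendsto_const) auto
  qed auto
  show ?thesis
    unfolding tendsto_complex_iff using c1 c2 by (simp add: integral_Re[OF ig, symmetric]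
        integral_Im[OF ig, symmetric] integral_Re[OF ig', symmetric] integral_Im[OF ig', symmetric])
qed

end

text \<open>Convergence in law of a random vector, expressed by its joint characteristic functions;
  only finitely many coordinates are involved.\<close>

locale joint_char_conv = two_prob_spaces M N for M :: "'a measure" and N :: "'b measure" +
  fixes L :: "nat set" and X :: "nat \<Rightarrow> nat \<Rightarrow> 'a \<Rightarrow> real" and Z :: "nat \<Rightarrow> 'b \<Rightarrow> real"
  assumes finL: "finite L"
    and X_meas: "\<And>n l. l \<in> L \<Longrightarrow> X n l \<in> borel_measurable M"
    and Z_meas: "\<And>l. l \<in> L \<Longrightarrow> Z l \<in> borel_measurable N"
    and char_conv: "\<And>s. (\<lambda>n. \<integral>z. iexp (\<Sum>l\<in>L. s l * X n l z) \<partial>M) \<longlonglongrightarrow> (\<integral>z. iexp (\<Sum>l\<in>L. s l * Z l z) \<partial>N)"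
begin

lemma char_conv_1: "l \<in> L \<Longrightarrow> (\<lambda>n. \<integral>z. iexp (s * X n l z) \<partial>M) \<longlonglongrightarrow> (\<integral>z. iexp (s * Z l z) \<partial>N)"
  using char_conv[of "\<lambda>l'. if l' = l then s else 0"] finL
  by (simp add: if_distrib[where f="\<lambda>c. c * _"] cong: if_cong)

text \<open>Exponentials are exchanged for the functions \<open>g l\<close> one coordinate at a
  time. For the coordinate \<open>a\<close> all other factors form a bounded complex weight, and the
  induction hypothesis at the frequencies \<open>s(a := t)\<close> provides the transforms that
  \<open>weighted_levy\<close> asks for.\<close>

lemma product_conv_aux:
  fixes g :: "nat \<Rightarrow> real \<Rightarrow> real"
  assumes "A \<subseteq> L" and g: "\<And>l. l \<in> L \<Longrightarrow> continuous_on UNIV (g l)" "\<And>l x. l \<in> L \<Longrightarrow> \<bar>g l x\<bar> \<le> C l"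
  shows "(\<lambda>n. \<integral>z. iexp (\<Sum>l\<in>L - A. s l * X n l z) * of_real (\<Prod>l\<in>A. g l (X n l z)) \<partial>M) \<longlonglongrightarrow>
     (\<integral>z. iexp (\<Sum>l\<in>L - A. s l * Z l z) * of_real (\<Prod>l\<in>A. g l (Z l z)) \<partial>N)"
  using finite_subset[OF \<open>A \<subseteq> L\<close> finL] \<open>A \<subseteq> L\<close>
proof (induction A arbitrary: s rule: finite_induct)
  case empty
  then show ?case using char_conv by simp
next
  case (insert a A)
  have gm: "g l \<in> borel_measurable borel" if "l \<in> L" for l
    using g(1)[OF that] by (rule borel_measurable_continuous_onI)
  have a: "a \<in> L" "A \<subseteq> L" using insert by auto
  define R where "R = L - insert a A"
  have R: "R \<subseteq> L" "a \<notin> R" "finite R" "L - A = insert a R" using insert a finL by (auto simp: R_def)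
  define B where "B = (\<Prod>l\<in>A. C l)"
  let ?u = "\<lambda>x. iexp (\<Sum>l\<in>R. s l * x l) * of_real (\<Prod>l\<in>A. g l (x l))"
  have u: "norm (?u x) \<le> B" for x
    unfolding B_def norm_mult norm_of_real abs_prod using a g(2) by (auto intro!: prod_mono)
  have u_conv: "(\<lambda>n. \<integral>z. ?u (\<lambda>l. X n l z) * iexp (t * X n a z) \<partial>M) \<longlonglongrightarrow>
      (\<integral>z. ?u (\<lambda>l. Z l z) * iexp (t * Z a z) \<partial>N)" for t
  proof -
    have "iexp (\<Sum>l\<in>L - A. (s(a := t)) l * x l) = iexp (\<Sum>l\<in>R. s l * x l) * iexp (t * x a)" for x
    proof -
      have "(\<Sum>l\<in>R. (s(a := t)) l * x l) = (\<Sum>l\<in>R. s l * x l)" using R by (intro sum.cong) auto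
      then show ?thesis using R by (simp add: exp_add distrib_left)
    qed
    then show ?thesis using insert.IH[OF a(2), of "s(a := t)"] by (simp only: mult_ac)
  qed
  have pm: "(\<lambda>z. \<Prod>l\<in>A. g l (X n l z)) \<in> borel_measurable M"
      "(\<lambda>z. \<Prod>l\<in>A. g l (Z l z)) \<in> borel_measurable N" for n
    using a by (auto intro!: borel_measurable_prod measurable_compose[OF X_meas gm] measurable_compose[OF Z_meas gm])
  have sm: "(\<lambda>z. \<Sum>l\<in>R. s l * X n l z) \<in> borel_measurable M"
      "(\<lambda>z. \<Sum>l\<in>R. s l * Z l z) \<in> borel_measurable N" for n
    using R by (auto intro!: borel_measurable_sum borel_measurable_times X_meas Z_meas)
  note [measurable] = pm sm
  have um: "(\<lambda>z. ?u (\<lambda>l. X n l z)) \<in> borel_measurable M" "(\<lambda>z. ?u (\<lambda>l. Z l z)) \<in> borel_measurable N" for n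
    by measurable
  have "(\<lambda>n. \<integral>z. ?u (\<lambda>l. X n l z) * of_real (g a (X n a z)) \<partial>M) \<longlonglongrightarrow>
      (\<integral>z. ?u (\<lambda>l. Z l z) * of_real (g a (Z a z)) \<partial>N)"
    by (rule weighted_levy[OF X_meas[OF a(1)] Z_meas[OF a(1)] um u u u_conv char_conv_1[OF a(1)]
          g(1)[OF a(1)] g(2)[OF a(1)]])
  then show ?case
    unfolding prod.insert[OF insert.hyps] R_def[symmetric] of_real_mult by (simp only: mult_ac)
qed

lemma product_conv:
  fixes g :: "nat \<Rightarrow> real \<Rightarrow> real"
  assumes "\<And>l. l \<in> L \<Longrightarrow> continuous_on UNIV (g l)" "\<And>l x. l \<in> L \<Longrightarrow> \<bar>g l x\<bar> \<le> C l"
  shows "(\<lambda>n. \<integral>z. (\<Prod>l\<in>L. g l (X n l z)) \<partial>M) \<longlonglongrightarrow> (\<integral>z. (\<Prod>l\<in>L. g l (Z l z)) \<partial>N)"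
proof -
  have "(\<lambda>n. \<integral>z. complex_of_real (\<Prod>l\<in>L. g l (X n l z)) \<partial>M) \<longlonglongrightarrow>
      (\<integral>z. complex_of_real (\<Prod>l\<in>L. g l (Z l z)) \<partial>N)"
    using product_conv_aux[where A=L and g=g and C=C and s="\<lambda>_. 0", OF subset_refl assms(1)] assms(2)
    by (simp del: of_real_prod)
  from tendsto_Re[OF this] show ?thesis by (simp del: of_real_prod)
qed

end

subsection \<open>Polynomials of jointly convergent variables\<close>

text \<open>Polynomials are generated as functions, without coefficients or degrees: the Hermite
  forms only have to be closed under the rules, and convergence can be proved by rule
  induction.\<close>

inductive poly_fun :: "nat set \<Rightarrow> ((nat \<Rightarrow> real) \<Rightarrow> real) \<Rightarrow> bool" for L where
  const: "poly_fun L (\<lambda>_. c)"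
| coord: "l \<in> L \<Longrightarrow> poly_fun L (\<lambda>w. w l)"
| add: "poly_fun L p \<Longrightarrow> poly_fun L q \<Longrightarrow> poly_fun L (\<lambda>w. p w + q w)"
| mult: "poly_fun L p \<Longrightarrow> poly_fun L q \<Longrightarrow> poly_fun L (\<lambda>w. p w * q w)"

lemma poly_fun_power: "poly_fun L p \<Longrightarrow> poly_fun L (\<lambda>w. p w ^ k)"
  by (induction k) (auto intro: poly_fun.intros)

lemma poly_fun_cmult: "poly_fun L p \<Longrightarrow> poly_fun L (\<lambda>w. c * p w)"
  by (intro poly_fun.intros)

lemma poly_fun_diff: "poly_fun L p \<Longrightarrow> poly_fun L q \<Longrightarrow> poly_fun L (\<lambda>w. p w - q w)"
  using poly_fun.add[OF _ poly_fun_cmult[of L q "-1"]] by fastforce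

lemma poly_fun_prod: "(\<And>i. i \<in> I \<Longrightarrow> poly_fun L (p i)) \<Longrightarrow> poly_fun L (\<lambda>w. \<Prod>i\<in>I. p i w)"
  by (induction I rule: infinite_finite_induct) (auto intro: poly_fun.intros)

lemma poly_fun_sum: "(\<And>i. i \<in> I \<Longrightarrow> poly_fun L (p i)) \<Longrightarrow> poly_fun L (\<lambda>w. \<Sum>i\<in>I. p i w)"
  by (induction I rule: infinite_finite_induct) (auto intro: poly_fun.intros)

lemma poly_fun_hermite: "l \<in> L \<Longrightarrow> poly_fun L (\<lambda>w. hermite r (w l))"
proof (induction r rule: less_induct)
  case (less r)
  show ?case
  proof (cases r)
    case (Suc q)
    have "(\<lambda>w. hermite r (w l)) = (\<lambda>w. w l * hermite q (w l) - real q * hermite (q - 1) (w l))"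
      by (simp add: Suc hermite_Suc fun_eq_iff del: hermite.simps(3))
    then show ?thesis using less Suc
      by (auto intro!: poly_fun_diff poly_fun_cmult poly_fun.mult poly_fun.coord)
  qed (simp add: poly_fun.const)
qed

lemma poly_fun_hermite_form: "m ` J \<subseteq> L \<Longrightarrow> poly_fun L (hermite_form J m)"
  unfolding hermite_form_def[abs_def] by (intro poly_fun_prod poly_fun_hermite) auto

lemma poly_fun_measurable:
  "poly_fun L p \<Longrightarrow> (\<And>l. l \<in> L \<Longrightarrow> (\<lambda>z. w z l) \<in> borel_measurable M) \<Longrightarrow>
    (\<lambda>z. p (w z)) \<in> borel_measurable M"
  by (induction rule: poly_fun.induct) auto

lemma poly_fun_bounded:
  assumes "poly_fun L p"
  shows "\<exists>C. \<forall>w. (\<forall>l\<in>L. \<bar>w l\<bar> \<le> R) \<longrightarrow> \<bar>p w\<bar> \<le> C"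
  using assms
proof (induction rule: poly_fun.induct)
  case (add p q)
  then obtain C D where "\<forall>w. (\<forall>l\<in>L. \<bar>w l\<bar> \<le> R) \<longrightarrow> \<bar>p w\<bar> \<le> C" "\<forall>w. (\<forall>l\<in>L. \<bar>w l\<bar> \<le> R) \<longrightarrow> \<bar>q w\<bar> \<le> D"
    by blast
  then show ?case by (intro exI[of _ "C + D"]) (meson abs_triangle_ineq add_mono order_trans)
next
  case (mult p q)
  then obtain C D where CD: "\<forall>w. (\<forall>l\<in>L. \<bar>w l\<bar> \<le> R) \<longrightarrow> \<bar>p w\<bar> \<le> C" "\<forall>w. (\<forall>l\<in>L. \<bar>w l\<bar> \<le> R) \<longrightarrow> \<bar>q w\<bar> \<le> D"
    by blast
  show ?case
  proof (intro exI[of _ "C * D"] allI impI)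
    fix w assume w: "\<forall>l\<in>L. \<bar>w l\<bar> \<le> R"
    have p: "\<bar>p w\<bar> \<le> C" and q: "\<bar>q w\<bar> \<le> D" using CD w by blast+
    have "0 \<le> C" using p by linarith
    then show "\<bar>p w * q w\<bar> \<le> C * D" unfolding abs_mult using p q by (intro mult_mono) auto
  qed
qed blast+

definition cutoff :: "nat set \<Rightarrow> (nat \<Rightarrow> real \<Rightarrow> real) \<Rightarrow> bool" where
  "cutoff L g \<longleftrightarrow> (\<forall>l\<in>L. continuous_on UNIV (g l)) \<and> (\<exists>R. \<forall>l\<in>L. \<forall>x. \<bar>x\<bar> > R \<longrightarrow> g l x = 0)"

lemma cutoff_bounded:
  assumes "cutoff L g"
  shows "\<exists>C. \<forall>l\<in>L. \<forall>x. \<bar>g l x\<bar> \<le> C l"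
proof -
  obtain R where R: "\<And>l x. l \<in> L \<Longrightarrow> \<bar>x\<bar> > R \<Longrightarrow> g l x = 0"
    using assms unfolding cutoff_def by blast
  have "\<exists>c. \<forall>x. \<bar>g l x\<bar> \<le> c" if l: "l \<in> L" for l
  proof -
    have "continuous_on UNIV (g l)" using assms l unfolding cutoff_def by blast
    then have "compact (g l ` {-R..R})"
      by (intro compact_continuous_image) (auto intro: continuous_on_subset)
    then obtain c where c: "\<And>x. x \<in> {-R..R} \<Longrightarrow> \<bar>g l x\<bar> \<le> c"
      using compact_imp_bounded by (fastforce simp: bounded_iff)
    have "\<bar>g l x\<bar> \<le> max c 0" for x
    proof (cases "\<bar>x\<bar> > R")
      case True
      then show ?thesis using R[OF l] by simp
    next
      case False
      then have "x \<in> {-R..R}" by auto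
      then show ?thesis using c[of x] by simp
    qed
    then show ?thesis by blast
  qed
  then show ?thesis by metis
qed

lemma cutoff_coord:
  assumes "cutoff L g"
  shows "cutoff L (g(l := \<lambda>x. x * g l x))"
  using assms unfolding cutoff_def by (auto intro!: continuous_intros)

lemma cutoff_poly_bounded:
  assumes L: "finite L" and g: "cutoff L g" and p: "poly_fun L p"
  shows "\<exists>C. \<forall>w. \<bar>p w * (\<Prod>l\<in>L. g l (w l))\<bar> \<le> C"
proof -
  obtain R where R: "\<And>l x. l \<in> L \<Longrightarrow> \<bar>x\<bar> > R \<Longrightarrow> g l x = 0"
    using g unfolding cutoff_def by blast
  obtain C where C: "\<And>w. (\<forall>l\<in>L. \<bar>w l\<bar> \<le> R) \<Longrightarrow> \<bar>p w\<bar> \<le> C"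
    using poly_fun_bounded[OF p] by blast
  obtain D where D: "\<And>l x. l \<in> L \<Longrightarrow> \<bar>g l x\<bar> \<le> D l"
    using cutoff_bounded[OF g] by blast
  have "\<bar>p w * (\<Prod>l\<in>L. g l (w l))\<bar> \<le> \<bar>C\<bar> * \<bar>\<Prod>l\<in>L. D l\<bar>" for w
  proof (cases "\<forall>l\<in>L. \<bar>w l\<bar> \<le> R")
    case True
    have "\<bar>\<Prod>l\<in>L. g l (w l)\<bar> \<le> (\<Prod>l\<in>L. D l)" unfolding abs_prod using D by (intro prod_mono) auto
    moreover have "\<bar>p w\<bar> \<le> \<bar>C\<bar>" using C[OF True] by linarith
    ultimately show ?thesis unfolding abs_mult by (intro mult_mono) auto
  next
    case False
    then have "(\<Prod>l\<in>L. g l (w l)) = 0" using R L by (auto simp: prod_zero_iff not_le)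
    then show ?thesis by simp
  qed
  then show ?thesis by blast
qed

text \<open>A trapezoid, equal to \<open>1\<close> on \<open>[-R, R]\<close> and to \<open>0\<close>
  outside \<open>[-R-1, R+1]\<close>.\<close>

definition hat :: "real \<Rightarrow> real \<Rightarrow> real" where
  "hat R x = max 0 (min 1 (R + 1 - \<bar>x\<bar>))"

lemma hat_bounds: "0 \<le> hat R x" "hat R x \<le> 1" "\<bar>x\<bar> \<le> R \<Longrightarrow> hat R x = 1" "\<bar>x\<bar> > R + 1 \<Longrightarrow> hat R x = 0"
  by (auto simp: hat_def)

lemma continuous_hat: "continuous_on UNIV (hat R)"
  unfolding hat_def[abs_def] by (intro continuous_intros)

lemma cutoff_hat: "cutoff L (\<lambda>_. hat R)"
  unfolding cutoff_def using continuous_hat hat_bounds(4) by blast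

lemma (in prob_space) norm_expectation_diff_le:
  fixes F G :: "'a \<Rightarrow> 'b :: {banach, second_countable_topology}"
  assumes FG: "integrable M F" "integrable M G" and e: "\<And>z. norm (F z - G z) \<le> e"
  shows "norm (expectation F - expectation G) \<le> e"
proof -
  have "expectation (\<lambda>z. norm (F z - G z)) \<le> expectation (\<lambda>_. e)"
    using e FG by (intro integral_mono) auto
  then show ?thesis using norm_expectation_diff[OF FG] by (simp add: prob_space)
qed

context joint_char_conv
begin

lemma cutoff_integrable:
  assumes g: "cutoff L g" and p: "poly_fun L p"
  shows "integrable M (\<lambda>z. p (\<lambda>l. X n l z) * (\<Prod>l\<in>L. g l (X n l z)))"
    and "integrable N (\<lambda>z. p (\<lambda>l. Z l z) * (\<Prod>l\<in>L. g l (Z l z)))"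
proof -
  obtain C where C: "\<And>w. \<bar>p w * (\<Prod>l\<in>L. g l (w l))\<bar> \<le> C"
    using cutoff_poly_bounded[OF finL g p] by blast
  have gm: "g l \<in> borel_measurable borel" if "l \<in> L" for l
    using g that by (auto simp: cutoff_def intro: borel_measurable_continuous_onI)
  have "(\<lambda>z. p (\<lambda>l. X n l z) * (\<Prod>l\<in>L. g l (X n l z))) \<in> borel_measurable M"
    by (intro borel_measurable_times borel_measurable_prod poly_fun_measurable[OF p]
        measurable_compose[OF X_meas gm] X_meas)
  then show "integrable M (\<lambda>z. p (\<lambda>l. X n l z) * (\<Prod>l\<in>L. g l (X n l z)))"
    using C[of "\<lambda>l. X n l _"] by (intro M.integrable_const_bound[where B=C]) auto
  have "(\<lambda>z. p (\<lambda>l. Z l z) * (\<Prod>l\<in>L. g l (Z l z))) \<in> borel_measurable N"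
    by (intro borel_measurable_times borel_measurable_prod poly_fun_measurable[OF p]
        measurable_compose[OF Z_meas gm] Z_meas)
  then show "integrable N (\<lambda>z. p (\<lambda>l. Z l z) * (\<Prod>l\<in>L. g l (Z l z)))"
    using C[of "\<lambda>l. Z l _"] by (intro N.integrable_const_bound[where B=C]) auto
qed

definition conv_cutoff :: "((nat \<Rightarrow> real) \<Rightarrow> real) \<Rightarrow> bool" where
  "conv_cutoff p \<longleftrightarrow> (\<forall>g. cutoff L g \<longrightarrow>
     (\<lambda>n. \<integral>z. p (\<lambda>l. X n l z) * (\<Prod>l\<in>L. g l (X n l z)) \<partial>M) \<longlonglongrightarrow>
     (\<integral>z. p (\<lambda>l. Z l z) * (\<Prod>l\<in>L. g l (Z l z)) \<partial>N))"

lemma conv_cutoff_1: "conv_cutoff (\<lambda>_. 1)"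
  unfolding conv_cutoff_def
proof (intro allI impI)
  fix g assume g: "cutoff L g"
  then obtain C where "\<And>l x. l \<in> L \<Longrightarrow> \<bar>g l x\<bar> \<le> C l" using cutoff_bounded by blast
  then show "(\<lambda>n. \<integral>z. 1 * (\<Prod>l\<in>L. g l (X n l z)) \<partial>M) \<longlonglongrightarrow> (\<integral>z. 1 * (\<Prod>l\<in>L. g l (Z l z)) \<partial>N)"
    using product_conv[of g C] g by (simp add: cutoff_def)
qed

text \<open>\<open>conv_cutoff\<close> for two polynomials does not directly give it for their
  product, so a second polynomial \<open>q\<close> is carried along as an accumulator. A coordinate
  is absorbed into the cutoff factor of the same coordinate; this is why \<open>conv_cutoff\<close>
  quantifies over all cutoffs.\<close>

lemma conv_cutoff_mult:
  assumes "poly_fun L p" "poly_fun L q" "conv_cutoff q"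
  shows "conv_cutoff (\<lambda>w. p w * q w)"
  using assms
proof (induction arbitrary: q rule: poly_fun.induct)
  case (const c)
  then show ?case unfolding conv_cutoff_def by (auto simp: mult.assoc intro!: tendsto_mult_left)
next
  case (coord l)
  show ?case
    unfolding conv_cutoff_def
  proof (intro allI impI)
    fix g assume g: "cutoff L g"
    have eq: "w l * q w * (\<Prod>i\<in>L. g i (w i)) = q w * (\<Prod>i\<in>L. (g(l := \<lambda>x. x * g l x)) i (w i))" for w
    proof -
      have "(\<Prod>i\<in>L - {l}. (g(l := \<lambda>x. x * g l x)) i (w i)) = (\<Prod>i\<in>L - {l}. g i (w i))"
        by (intro prod.cong) auto
      then show ?thesis using coord.hyps finL by (simp add: prod.remove[where x=l])
    qed
    show "(\<lambda>n. \<integral>z. X n l z * q (\<lambda>l. X n l z) * (\<Prod>l\<in>L. g l (X n l z)) \<partial>M) \<longlonglongrightarrow>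
       (\<integral>z. Z l z * q (\<lambda>l. Z l z) * (\<Prod>l\<in>L. g l (Z l z)) \<partial>N)"
      using coord.prems(2) cutoff_coord[OF g, of l] unfolding conv_cutoff_def
      unfolding eq[of "\<lambda>l. X _ l _"] eq[of "\<lambda>l. Z l _"] by blast
  qed
next
  case (add p1 p2)
  have pq: "poly_fun L (\<lambda>w. p1 w * q w)" "poly_fun L (\<lambda>w. p2 w * q w)"
    using add by (auto intro: poly_fun.mult)
  have c: "conv_cutoff (\<lambda>w. p1 w * q w)" "conv_cutoff (\<lambda>w. p2 w * q w)"
    using add by auto
  show ?case
    unfolding conv_cutoff_def
  proof (intro allI impI)
    fix g assume g: "cutoff L g"
    show "(\<lambda>n. \<integral>z. (p1 (\<lambda>l. X n l z) + p2 (\<lambda>l. X n l z)) * q (\<lambda>l. X n l z) * (\<Prod>l\<in>L. g l (X n l z)) \<partial>M) \<longlonglongrightarrow>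
       (\<integral>z. (p1 (\<lambda>l. Z l z) + p2 (\<lambda>l. Z l z)) * q (\<lambda>l. Z l z) * (\<Prod>l\<in>L. g l (Z l z)) \<partial>N)"
      unfolding distrib_right
      unfolding Bochner_Integration.integral_add[OF cutoff_integrable(1)[OF g pq(1)] cutoff_integrable(1)[OF g pq(2)]]
        Bochner_Integration.integral_add[OF cutoff_integrable(2)[OF g pq(1)] cutoff_integrable(2)[OF g pq(2)]]
      using c g unfolding conv_cutoff_def by (intro tendsto_add) blast+
  qed
next
  case (mult p1 p2)
  then have "conv_cutoff (\<lambda>w. p1 w * (p2 w * q w))"
    by (intro mult.IH poly_fun.mult) auto
  then show ?case by (simp add: mult.assoc)
qed

lemma poly_fun_conv_cutoff: "poly_fun L p \<Longrightarrow> conv_cutoff p"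
  using conv_cutoff_mult[OF _ poly_fun.const conv_cutoff_1, of p] by simp

text \<open>On the support of the hats the polynomial is bounded, so the Taylor series of its
  exponential converges uniformly there. Each Taylor term is again a polynomial times a
  cutoff.\<close>

lemma iexp_conv_cutoff:
  assumes p: "poly_fun L p"
  shows "(\<lambda>n. \<integral>z. iexp (p (\<lambda>l. X n l z)) * of_real (\<Prod>l\<in>L. hat R (X n l z)) \<partial>M) \<longlonglongrightarrow>
    (\<integral>z. iexp (p (\<lambda>l. Z l z)) * of_real (\<Prod>l\<in>L. hat R (Z l z)) \<partial>N)"
proof (rule tendsto_uniform_approx)
  fix e :: real assume e: "e > 0"
  \<comment> \<open>The box has radius \<open>R + 1\<close>, beyond which the hats are known to
    vanish.\<close>
  obtain C where C: "\<And>w. (\<forall>l\<in>L. \<bar>w l\<bar> \<le> R + 1) \<Longrightarrow> \<bar>p w\<bar> \<le> C"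
    using poly_fun_bounded[OF p] by blast
  have "(\<lambda>K. \<bar>C\<bar> ^ K / fact K) \<longlonglongrightarrow> 0"
    using summable_LIMSEQ_zero[OF summable_exp[of "\<bar>C\<bar>"]] by (simp add: field_simps)
  then have "(\<lambda>K. \<bar>C\<bar> ^ Suc K / fact (Suc K)) \<longlonglongrightarrow> 0" by (rule LIMSEQ_Suc)
  from order_tendstoD(2)[OF this e] obtain K where K: "\<bar>C\<bar> ^ Suc K / fact (Suc K) < e"
    by (auto simp: eventually_sequentially)
  define T where "T w = (\<Sum>k\<le>K. (\<i> ^ k / fact k) * of_real (p w ^ k * (\<Prod>l\<in>L. hat R (w l))))" for w
  define G where "G w = iexp (p w) * of_real (\<Prod>l\<in>L. hat R (w l))" for w
  have hat: "0 \<le> (\<Prod>l\<in>L. hat R (w l))" "(\<Prod>l\<in>L. hat R (w l)) \<le> 1" for w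
    by (auto intro!: prod_nonneg prod_le_1 hat_bounds)
  have diff: "norm (G w - T w) \<le> e" for w
  proof (cases "\<forall>l\<in>L. \<bar>w l\<bar> \<le> R + 1")
    case True
    have T: "T w = (\<Sum>k\<le>K. (\<i> * of_real (p w)) ^ k / fact k) * of_real (\<Prod>l\<in>L. hat R (w l))"
      unfolding T_def sum_distrib_right by (intro sum.cong refl) (simp add: power_mult_distrib)
    have "norm (G w - T w) = norm (iexp (p w) - (\<Sum>k\<le>K. (\<i> * of_real (p w)) ^ k / fact k)) * \<bar>\<Prod>l\<in>L. hat R (w l)\<bar>"
      unfolding G_def T left_diff_distrib[symmetric] norm_mult norm_of_real ..
    also have "\<dots> \<le> \<bar>p w\<bar> ^ Suc K / fact (Suc K) * 1"
      using hat[of w] by (intro mult_mono iexp_approx1) auto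
    also have "\<dots> \<le> \<bar>C\<bar> ^ Suc K / fact (Suc K)"
    proof -
      have "\<bar>p w\<bar> ^ Suc K \<le> \<bar>C\<bar> ^ Suc K" using C[OF True] by (intro power_mono) auto
      then show ?thesis by (simp add: divide_right_mono del: power_Suc fact_Suc)
    qed
    finally show ?thesis using K by simp
  next
    case False
    then obtain l where "l \<in> L" "\<bar>w l\<bar> > R + 1" by (auto simp: not_le)
    then have "(\<Prod>l\<in>L. hat R (w l)) = 0" using finL hat_bounds(4) by (auto simp: prod_zero_iff)
    then show ?thesis using e by (simp add: G_def T_def)
  qed
  have Ti: "integrable M (\<lambda>z. p (\<lambda>l. X n l z) ^ k * (\<Prod>l\<in>L. hat R (X n l z)))"
    "integrable N (\<lambda>z. p (\<lambda>l. Z l z) ^ k * (\<Prod>l\<in>L. hat R (Z l z)))" for k n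
    using cutoff_integrable[OF cutoff_hat poly_fun_power[OF p]] by auto
  have TX: "integrable M (\<lambda>z. T (\<lambda>l. X n l z))" for n
    unfolding T_def by (intro Bochner_Integration.integrable_sum integrable_mult_right integrable_of_real Ti)
  have TZ: "integrable N (\<lambda>z. T (\<lambda>l. Z l z))"
    unfolding T_def by (intro Bochner_Integration.integrable_sum integrable_mult_right integrable_of_real Ti)
  have hm: "hat R \<in> borel_measurable borel" using continuous_hat by (rule borel_measurable_continuous_onI)
  have G1: "norm (G w) \<le> 1" for w using hat[of w] by (simp add: G_def norm_mult del: of_real_prod)
  have [measurable]: "(\<lambda>z. \<Prod>l\<in>L. hat R (X n l z)) \<in> borel_measurable M"
      "(\<lambda>z. p (\<lambda>l. X n l z)) \<in> borel_measurable M" for n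
    by (intro borel_measurable_prod measurable_compose[OF X_meas hm] poly_fun_measurable[OF p X_meas]; assumption)+
  have "(\<lambda>z. G (\<lambda>l. X n l z)) \<in> borel_measurable M" for n
    unfolding G_def by measurable
  then have GX: "integrable M (\<lambda>z. G (\<lambda>l. X n l z))" for n
    using G1 by (intro M.integrable_const_bound[where B=1]) auto
  have [measurable]: "(\<lambda>z. \<Prod>l\<in>L. hat R (Z l z)) \<in> borel_measurable N"
      "(\<lambda>z. p (\<lambda>l. Z l z)) \<in> borel_measurable N"
    by (intro borel_measurable_prod measurable_compose[OF Z_meas hm] poly_fun_measurable[OF p Z_meas]; assumption)+
  have "(\<lambda>z. G (\<lambda>l. Z l z)) \<in> borel_measurable N"
    unfolding G_def by measurable
  then have GZ: "integrable N (\<lambda>z. G (\<lambda>l. Z l z))"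
    using G1 by (intro N.integrable_const_bound[where B=1]) auto
  have TX_eq: "(\<integral>z. T (\<lambda>l. X n l z) \<partial>M) =
      (\<Sum>k\<le>K. (\<i> ^ k / fact k) * of_real (\<integral>z. p (\<lambda>l. X n l z) ^ k * (\<Prod>l\<in>L. hat R (X n l z)) \<partial>M))" for n
    unfolding T_def using Ti(1)
    by (subst Bochner_Integration.integral_sum)
      (auto simp del: of_real_mult of_real_prod of_real_power intro!: integrable_mult_right integrable_of_real)
  have TZ_eq: "(\<integral>z. T (\<lambda>l. Z l z) \<partial>N) =
      (\<Sum>k\<le>K. (\<i> ^ k / fact k) * of_real (\<integral>z. p (\<lambda>l. Z l z) ^ k * (\<Prod>l\<in>L. hat R (Z l z)) \<partial>N))"
    unfolding T_def using Ti(2)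
    by (subst Bochner_Integration.integral_sum)
      (auto simp del: of_real_mult of_real_prod of_real_power intro!: integrable_mult_right integrable_of_real)
  have "(\<lambda>n. \<integral>z. T (\<lambda>l. X n l z) \<partial>M) \<longlonglongrightarrow> (\<integral>z. T (\<lambda>l. Z l z) \<partial>N)"
    unfolding TX_eq TZ_eq using poly_fun_conv_cutoff[OF poly_fun_power[OF p]] cutoff_hat
    unfolding conv_cutoff_def
    by (intro tendsto_sum tendsto_mult tendsto_const tendsto_of_real) blast
  moreover have "norm ((\<integral>z. G (\<lambda>l. X n l z) \<partial>M) - (\<integral>z. T (\<lambda>l. X n l z) \<partial>M)) \<le> e" for n
    using GX TX diff by (rule M.norm_expectation_diff_le)
  moreover have "norm ((\<integral>z. G (\<lambda>l. Z l z) \<partial>N) - (\<integral>z. T (\<lambda>l. Z l z) \<partial>N)) \<le> e"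
    using GZ TZ diff by (rule N.norm_expectation_diff_le)
  ultimately show "\<exists>y y'. y \<longlonglongrightarrow> y' \<and>
      (\<forall>\<^sub>F n in sequentially. norm ((\<integral>z. iexp (p (\<lambda>l. X n l z)) * of_real (\<Prod>l\<in>L. hat R (X n l z)) \<partial>M) - y n) \<le> e) \<and>
      norm ((\<integral>z. iexp (p (\<lambda>l. Z l z)) * of_real (\<Prod>l\<in>L. hat R (Z l z)) \<partial>N) - y') \<le> e"
    unfolding G_def by (intro exI conjI always_eventually allI)
qed

end

text \<open>The product of the hats differs from \<open>1\<close> only where some coordinate reaches
  \<open>R\<close> in modulus; a union bound estimates this event.\<close>

lemma (in prob_space) hat_error:
  assumes L: "finite L" and Y: "\<And>l. l \<in> L \<Longrightarrow> Y l \<in> borel_measurable M"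
    and F: "F \<in> borel_measurable M" "\<And>z. norm (F z :: complex) \<le> 1"
    and R: "\<And>l. l \<in> L \<Longrightarrow> prob {z \<in> space M. \<bar>Y l z\<bar> \<ge> R} \<le> d"
  shows "norm (expectation F - expectation (\<lambda>z. F z * of_real (\<Prod>l\<in>L. hat R (Y l z)))) \<le> real (card L) * d"
proof -
  have hm: "hat R \<in> borel_measurable borel" using continuous_hat by (rule borel_measurable_continuous_onI)
  define h where "h z = (\<Prod>l\<in>L. hat R (Y l z))" for z
  have h01: "0 \<le> h z" "h z \<le> 1" for z unfolding h_def by (auto intro!: prod_nonneg prod_le_1 hat_bounds)
  have [measurable]: "h \<in> borel_measurable M"
    unfolding h_def[abs_def] by (intro borel_measurable_prod measurable_compose[OF Y hm])
  note [measurable] = F(1)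
  have iF: "integrable M F" using F by (intro integrable_const_bound[where B=1]) auto
  have iFh: "integrable M (\<lambda>z. F z * of_real (h z))"
    using F h01 by (intro integrable_const_bound[where B=1]) (auto simp: norm_mult intro!: mult_le_one)
  let ?A = "\<lambda>l. {z \<in> space M. \<bar>Y l z\<bar> \<ge> R}"
  have A: "?A l \<in> sets M" if "l \<in> L" for l using Y[OF that] by measurable
  have iA: "integrable M (\<lambda>z. \<Sum>l\<in>L. indicat_real (?A l) z)"
    using A by (intro Bochner_Integration.integrable_sum integrable_real_indicator) (auto simp: less_top[symmetric])
  have "norm (expectation F - expectation (\<lambda>z. F z * of_real (h z))) \<le> expectation (\<lambda>z. norm (F z - F z * of_real (h z)))"
    by (rule norm_expectation_diff[OF iF iFh])
  also have "\<dots> \<le> expectation (\<lambda>z. \<Sum>l\<in>L. indicat_real (?A l) z)"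
  proof (rule integral_mono)
    fix z assume z: "z \<in> space M"
    have "norm (F z - F z * of_real (h z)) = norm (F z) * norm (complex_of_real (1 - h z))"
      by (simp add: norm_mult[symmetric] algebra_simps)
    also have "\<dots> \<le> 1 * (1 - h z)" using F(2) h01[of z] by (intro mult_mono) (auto simp del: of_real_diff)
    also have "\<dots> \<le> (\<Sum>l\<in>L. indicat_real (?A l) z)"
    proof (cases "\<exists>l\<in>L. z \<in> ?A l")
      case True
      then obtain l where l: "l \<in> L" "z \<in> ?A l" by blast
      have "indicat_real (?A l) z \<le> (\<Sum>l\<in>L. indicat_real (?A l) z)"
        using l L by (intro member_le_sum) auto
      then show ?thesis using l h01(1)[of z] by simp
    next
      case False
      then have "h z = 1" unfolding h_def using z by (intro prod.neutral ballI hat_bounds(3)) force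
      then show ?thesis by (simp add: sum_nonneg)
    qed
    finally show "norm (F z - F z * of_real (h z)) \<le> (\<Sum>l\<in>L. indicat_real (?A l) z)" .
  qed (use iF iFh iA in auto)
  also have "\<dots> = (\<Sum>l\<in>L. prob (?A l))"
    using A by (subst Bochner_Integration.integral_sum)
      (auto intro!: integrable_real_indicator sum.cong arg_cong[where f=prob] simp: less_top[symmetric])
  also have "\<dots> \<le> real (card L) * d" using R by (intro sum_bounded_above)
  finally show ?thesis unfolding h_def .
qed

text \<open>One radius serves all coordinates, and every larger radius serves as well, so that the
  radii for two families can be combined by a maximum.\<close>

lemma (in prob_space) tight_seq_finite:
  assumes L: "finite L" and t: "\<And>l. l \<in> L \<Longrightarrow> tight_seq (\<lambda>n. Y n l)" and d: "d > 0"
  shows "\<exists>R. \<forall>R'\<ge>R. \<forall>\<^sub>F n in sequentially. \<forall>l\<in>L. prob {z \<in> space M. \<bar>Y n l z\<bar> \<ge> R'} \<le> d"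
  using L t
proof (induction L rule: finite_induct)
  case (insert a L)
  then obtain R where R: "\<And>R'. R' \<ge> R \<Longrightarrow> \<forall>\<^sub>F n in sequentially. \<forall>l\<in>L. prob {z \<in> space M. \<bar>Y n l z\<bar> \<ge> R'} \<le> d"
    by auto
  obtain K where K: "\<forall>\<^sub>F n in sequentially. prob {z \<in> space M. \<bar>Y n a z\<bar> \<ge> K} \<le> d"
    using insert.prems[of a] d unfolding tight_seq_def by blast
  have [measurable]: "Y n a \<in> borel_measurable M" for n
    using insert.prems[of a] unfolding tight_seq_def by blast
  show ?case
  proof (intro exI[of _ "max R K"] allI impI)
    fix R' assume R': "R' \<ge> max R K"
    have "\<forall>\<^sub>F n in sequentially. \<forall>l\<in>L. prob {z \<in> space M. \<bar>Y n l z\<bar> \<ge> R'} \<le> d" using R R' by auto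
    with K show "\<forall>\<^sub>F n in sequentially. \<forall>l\<in>insert a L. prob {z \<in> space M. \<bar>Y n l z\<bar> \<ge> R'} \<le> d"
    proof eventually_elim
      case (elim n)
      have "prob {z \<in> space M. \<bar>Y n a z\<bar> \<ge> R'} \<le> prob {z \<in> space M. \<bar>Y n a z\<bar> \<ge> K}"
        using R' by (intro finite_measure_mono) auto
      then show ?case using elim by auto
    qed
  qed
qed simp

context joint_char_conv
begin

text \<open>Cutting off at a common radius changes both sides by at most \<open>e\<close>, and
  between the cut off expressions \<open>iexp_conv_cutoff\<close> gives convergence.\<close>

theorem iexp_poly_conv:
  assumes p: "poly_fun L p"
    and tX: "\<And>l. l \<in> L \<Longrightarrow> M.tight_seq (\<lambda>n. X n l)"
    and tZ: "\<And>l. l \<in> L \<Longrightarrow> N.tight_seq (\<lambda>_. Z l)"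
  shows "(\<lambda>n. \<integral>z. iexp (p (\<lambda>l. X n l z)) \<partial>M) \<longlonglongrightarrow> (\<integral>z. iexp (p (\<lambda>l. Z l z)) \<partial>N)"
proof (rule tendsto_uniform_approx)
  fix e :: real assume e: "e > 0"
  \<comment> \<open>\<open>hat_error\<close> loses \<open>d\<close> once for each coordinate; the
    \<open>+ 1\<close> covers empty \<open>L\<close>.\<close>
  define d where "d = e / (real (card L) + 1)"
  have d: "d > 0" "real (card L) * d \<le> e" using e by (auto simp: d_def field_simps)
  obtain R1 where R1: "\<And>R'. R' \<ge> R1 \<Longrightarrow> \<forall>\<^sub>F n in sequentially. \<forall>l\<in>L. M.prob {z \<in> space M. \<bar>X n l z\<bar> \<ge> R'} \<le> d"
    using M.tight_seq_finite[where Y=X and L=L, OF finL tX d(1)] by blast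
  obtain R2 where R2: "\<And>R'. R' \<ge> R2 \<Longrightarrow> \<forall>\<^sub>F n in sequentially. \<forall>l\<in>L. N.prob {z \<in> space N. \<bar>Z l z\<bar> \<ge> R'} \<le> d"
    using N.tight_seq_finite[where Y="\<lambda>_. Z" and L=L, OF finL tZ d(1)] by blast
  define R where "R = max R1 R2"
  have XR: "\<forall>\<^sub>F n in sequentially. \<forall>l\<in>L. M.prob {z \<in> space M. \<bar>X n l z\<bar> \<ge> R} \<le> d"
    using R1[of R] by (simp add: R_def)
  have ZR: "\<forall>l\<in>L. N.prob {z \<in> space N. \<bar>Z l z\<bar> \<ge> R} \<le> d"
    using R2[of R] by (simp add: R_def)
  have mX: "(\<lambda>z. iexp (p (\<lambda>l. X n l z))) \<in> borel_measurable M" for n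
    by (intro measurable_compose[OF poly_fun_measurable[OF p X_meas]]) auto
  have mZ: "(\<lambda>z. iexp (p (\<lambda>l. Z l z))) \<in> borel_measurable N"
    by (intro measurable_compose[OF poly_fun_measurable[OF p Z_meas]]) auto
  show "\<exists>y y'. y \<longlonglongrightarrow> y' \<and>
      (\<forall>\<^sub>F n in sequentially. norm ((\<integral>z. iexp (p (\<lambda>l. X n l z)) \<partial>M) - y n) \<le> e) \<and>
      norm ((\<integral>z. iexp (p (\<lambda>l. Z l z)) \<partial>N) - y') \<le> e"
  proof (intro exI conjI)
    show "\<forall>\<^sub>F n in sequentially. norm ((\<integral>z. iexp (p (\<lambda>l. X n l z)) \<partial>M) -
        (\<integral>z. iexp (p (\<lambda>l. X n l z)) * of_real (\<Prod>l\<in>L. hat R (X n l z)) \<partial>M)) \<le> e"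
      using XR
    proof eventually_elim
      case (elim n)
      show ?case
        by (rule order_trans[OF M.hat_error[where d=d, OF finL X_meas mX] d(2)]) (use elim in auto)
    qed
    show "norm ((\<integral>z. iexp (p (\<lambda>l. Z l z)) \<partial>N) -
        (\<integral>z. iexp (p (\<lambda>l. Z l z)) * of_real (\<Prod>l\<in>L. hat R (Z l z)) \<partial>N)) \<le> e"
      by (rule order_trans[OF N.hat_error[where d=d, OF finL Z_meas mZ] d(2)]) (use ZR in auto)
  qed (rule iexp_conv_cutoff[OF p])
qed

end

subsection \<open>Characteristic functions\<close>

text \<open>Needed on both sides of the comparison: for the basis on the interval and for the noise
  variables, which are orthonormal as well.\<close>

lemma integral_orthonormal_square:
  assumes L: "finite L" and sq: "\<And>l. l \<in> L \<Longrightarrow> square_integrable M (F l)"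
    and orth: "\<And>l m. l \<in> L \<Longrightarrow> m \<in> L \<Longrightarrow> (\<integral>x. F l x * F m x \<partial>M) = (if l = m then 1 else 0)"
  shows "(\<integral>x. (\<Sum>l\<in>L. s l * F l x)\<^sup>2 \<partial>M) = (\<Sum>l\<in>L. (s l)\<^sup>2)"
proof -
  have int: "integrable M (\<lambda>x. s l * s m * (F l x * F m x))" if "l \<in> L" "m \<in> L" for l m
    using that by (intro integrable_mult_right square_integrable_mult sq)
  have "(\<integral>x. (\<Sum>l\<in>L. s l * F l x)\<^sup>2 \<partial>M) = (\<integral>x. (\<Sum>l\<in>L. \<Sum>m\<in>L. s l * s m * (F l x * F m x)) \<partial>M)"
    unfolding power2_eq_square sum_product by (simp add: mult_ac)
  also have "\<dots> = (\<Sum>l\<in>L. \<integral>x. (\<Sum>m\<in>L. s l * s m * (F l x * F m x)) \<partial>M)"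
    by (intro Bochner_Integration.integral_sum Bochner_Integration.integrable_sum int)
  also have "\<dots> = (\<Sum>l\<in>L. \<Sum>m\<in>L. \<integral>x. s l * s m * (F l x * F m x) \<partial>M)"
    by (intro sum.cong refl Bochner_Integration.integral_sum int)
  also have "\<dots> = (\<Sum>l\<in>L. \<Sum>m\<in>L. if l = m then (s l)\<^sup>2 else 0)"
    by (intro sum.cong refl) (simp add: orth power2_eq_square)
  also have "\<dots> = (\<Sum>l\<in>L. (s l)\<^sup>2)" using L by simp
  finally show ?thesis .
qed

lemma integrable_distributed_normal:
  assumes "prob_space N" and \<sigma>: "\<sigma> > 0" and D: "distributed N lborel X (normal_density 0 \<sigma>)"
  shows "integrable N (\<lambda>z. (X z)\<^sup>2)" "(\<integral>z. (X z)\<^sup>2 \<partial>N) = \<sigma>\<^sup>2"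
    "(\<integral>z. iexp (t * X z) \<partial>N) = of_real (exp (- t\<^sup>2 * \<sigma>\<^sup>2 / 2))"
proof -
  interpret prob_space N by fact
  show "integrable N (\<lambda>z. (X z)\<^sup>2)"
    using distributed_integrable[OF D, of "\<lambda>x. x\<^sup>2"] integrable_normal_moment[OF \<sigma>, of 0 2] by simp
  show "(\<integral>z. (X z)\<^sup>2 \<partial>N) = \<sigma>\<^sup>2"
    using distributed_integral[OF D, of "\<lambda>x. x\<^sup>2"] integral_normal_moment_even[OF \<sigma>, of 0 1]
    by (simp add: fact_numeral)
  have D1: "distributed N lborel (\<lambda>z. (X z - 0) / \<sigma>) std_normal_density"
    using normal_standard_normal_convert[OF \<sigma>, of X 0] D by simp
  then have "distr N borel (\<lambda>z. X z / \<sigma>) = std_normal_distribution"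
    using distributed_distr_eq_density[OF D1] by (simp cong: distr_cong)
  then have "char (distr N borel (\<lambda>z. X z / \<sigma>)) (t * \<sigma>) = of_real (exp (- (t * \<sigma>)\<^sup>2 / 2))"
    by (simp add: char_std_normal_distribution)
  moreover have [measurable]: "X \<in> borel_measurable N" using distributed_measurable[OF D] by simp
  have "char (distr N borel (\<lambda>z. X z / \<sigma>)) (t * \<sigma>) = (\<integral>z. iexp (t * X z) \<partial>N)"
    unfolding char_def using \<sigma> by (subst integral_distr) auto
  ultimately show "(\<integral>z. iexp (t * X z) \<partial>N) = of_real (exp (- t\<^sup>2 * \<sigma>\<^sup>2 / 2))"
    by (simp add: power_mult_distrib)
qed

text \<open>In the nondegenerate and in the degenerate case alike the transform depends on
  \<open>X\<close> only through its second moment.\<close>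

lemma
  assumes N: "prob_space N" and X: "centered_gaussian N X"
  shows square_integrable_gaussian: "square_integrable N X"
    and iexp_gaussian: "(\<integral>z. iexp (X z) \<partial>N) = of_real (exp (- (\<integral>z. (X z)\<^sup>2 \<partial>N) / 2))"
proof -
  interpret prob_space N by fact
  consider (normal) \<sigma> where "\<sigma> > 0" "distributed N lborel X (normal_density 0 \<sigma>)"
    | (zero) "X \<in> borel_measurable N" "AE z in N. X z = 0"
    using X unfolding centered_gaussian_def by blast
  then have "square_integrable N X \<and> (\<integral>z. iexp (X z) \<partial>N) = of_real (exp (- (\<integral>z. (X z)\<^sup>2 \<partial>N) / 2))"
  proof cases
    case normal
    have "X \<in> borel_measurable N" using distributed_measurable[OF normal(2)] by simp
    with integrable_distributed_normal[OF N normal] integrable_distributed_normal(3)[OF N normal, of 1]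
    show ?thesis by (simp add: square_integrable_def)
  next
    case zero
    note [measurable] = zero(1)
    have sq: "AE z in N. (X z)\<^sup>2 = 0" and ie: "AE z in N. iexp (X z) = 1" using zero(2) by auto
    have "integrable N (\<lambda>z. (X z)\<^sup>2)" "(\<integral>z. (X z)\<^sup>2 \<partial>N) = 0"
      using integrable_cong_AE[OF _ _ sq] integral_cong_AE[OF _ _ sq] by auto
    moreover have "(\<integral>z. iexp (X z) \<partial>N) = 1"
      using integral_cong_AE[OF _ _ ie] by (simp add: prob_space)
    ultimately show ?thesis using zero(1) by (simp add: square_integrable_def)
  qed
  then show "square_integrable N X" "(\<integral>z. iexp (X z) \<partial>N) = of_real (exp (- (\<integral>z. (X z)\<^sup>2 \<partial>N) / 2))"
    by auto
qed

section \<open>The noise along the basis\<close>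

locale noise_onb = onb \<psi> for \<psi> +
  fixes N :: "'b measure" and \<xi> :: "(real \<Rightarrow> real) \<Rightarrow> 'b \<Rightarrow> real"
  assumes white_noise: "white_noise N \<xi>"

sublocale noise_onb \<subseteq> N: prob_space N
  using white_noise by (simp add: white_noise_def)

context noise_onb
begin

lemma orthonormal:
  "l \<ge> 1 \<Longrightarrow> m \<ge> 1 \<Longrightarrow> (\<integral>s. \<psi> l s * \<psi> m s \<partial>unit_interval) = (if l = m then 1 else 0)"
  using onb unfolding orthonormal_basis_def by blast

text \<open>Joint Gaussianity of the noise is stated for finite sets of functions, so sums over
  indices must be reindexed along \<open>\<psi>\<close>. A repeated function would have inner
  product both \<open>0\<close> and \<open>1\<close> with itself.\<close>

lemma inj_basis: "inj_on \<psi> {1..}"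
proof (rule inj_onI, rule ccontr)
  fix l m assume lm: "l \<in> {1..}" "m \<in> {1..}" "\<psi> l = \<psi> m" "l \<noteq> m"
  have "(\<integral>s. \<psi> l s * \<psi> m s \<partial>unit_interval) = 0"
    using orthonormal[of l m] lm(1,2,4) by auto
  moreover have "(\<integral>s. \<psi> l s * \<psi> l s \<partial>unit_interval) = 1"
    using orthonormal[of l l] lm(1) by auto
  ultimately show False unfolding lm(3) by simp
qed

lemma gaussian_combination:
  assumes "finite L" "L \<subseteq> {1..}"
  shows "centered_gaussian N (\<lambda>z. \<Sum>l\<in>L. s l * \<xi> (\<psi> l) z)"
proof -
  have inj: "inj_on \<psi> L" using inj_basis assms(2) by (rule inj_on_subset)
  have gaussian: "centered_gaussian N (\<lambda>z. \<Sum>g\<in>G. a g * \<xi> g z)"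
    if "finite G \<and> (\<forall>g\<in>G. square_integrable unit_interval g)" for G a
    using white_noise[unfolded white_noise_def, THEN conjunct2, THEN conjunct1, THEN spec, THEN spec] that
    by (rule mp)
  have "finite (\<psi> ` L) \<and> (\<forall>g\<in>\<psi> ` L. square_integrable unit_interval g)"
    using assms square_integrable_basis by auto
  then have "centered_gaussian N (\<lambda>z. \<Sum>g\<in>\<psi> ` L. s (inv_into L \<psi> g) * \<xi> g z)"
    by (rule gaussian)
  also have "(\<lambda>z. \<Sum>g\<in>\<psi> ` L. s (inv_into L \<psi> g) * \<xi> g z) = (\<lambda>z. \<Sum>l\<in>L. s l * \<xi> (\<psi> l) z)"
    by (simp add: sum.reindex[OF inj] inj)
  finally show ?thesis .
qed

lemma square_integrable_noise: "l \<ge> 1 \<Longrightarrow> square_integrable N (\<xi> (\<psi> l))"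
  using square_integrable_gaussian[OF N.prob_space_axioms gaussian_combination[of "{l}" "\<lambda>_. 1"]] by simp

lemma measurable_noise: "l \<ge> 1 \<Longrightarrow> \<xi> (\<psi> l) \<in> borel_measurable N"
  using square_integrable_noise by (simp add: square_integrable_def)

text \<open>The combination is centered Gaussian, and its variance is the sum of the squared
  coefficients because the covariance of the noise copies the orthonormality of the basis.\<close>

lemma iexp_noise:
  assumes L: "finite L" "L \<subseteq> {1..}"
  shows "(\<integral>z. iexp (\<Sum>l\<in>L. s l * \<xi> (\<psi> l) z) \<partial>N) = of_real (exp (- (\<Sum>l\<in>L. (s l)\<^sup>2) / 2))"
proof -
  have "(\<integral>z. (\<Sum>l\<in>L. s l * \<xi> (\<psi> l) z)\<^sup>2 \<partial>N) = (\<Sum>l\<in>L. (s l)\<^sup>2)"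
  proof (rule integral_orthonormal_square[OF L(1)])
    fix l m assume "l \<in> L" "m \<in> L"
    then have ge: "l \<ge> 1" "m \<ge> 1" using L(2) by auto
    show "square_integrable N (\<xi> (\<psi> l))" by (rule square_integrable_noise[OF ge(1)])
    have "(\<integral>z. \<xi> (\<psi> l) z * \<xi> (\<psi> m) z \<partial>N) = (\<integral>s. \<psi> l s * \<psi> m s \<partial>unit_interval)"
      using white_noise square_integrable_basis[OF ge(1)] square_integrable_basis[OF ge(2)]
      unfolding white_noise_def by blast
    with orthonormal[OF ge]
    show "(\<integral>z. \<xi> (\<psi> l) z * \<xi> (\<psi> m) z \<partial>N) = (if l = m then 1 else 0)" by simp
  qed
  then show ?thesis
    using iexp_gaussian[OF N.prob_space_axioms gaussian_combination[OF L, of s]] by simp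
qed

lemma tight_noise: "l \<ge> 1 \<Longrightarrow> N.tight_seq (\<lambda>_. \<xi> (\<psi> l))"
  by (rule N.tight_seq_second_moment[OF square_integrable_noise order_refl tendsto_const])

end

text \<open>Both functions agree with \<open>1 - x^2 / 2\<close> up to fourth order; the remainders
  are at most \<open>x^4 / 24\<close> and \<open>x^4 / 8\<close>, for every real
  \<open>x\<close>.\<close>

lemma cos_minus_gaussian_le: "\<bar>cos x - exp (- x\<^sup>2 / 2)\<bar> \<le> x ^ 4" for x :: real
proof -
  have "\<bar>cos x - (1 - x\<^sup>2 / 2)\<bar> \<le> \<bar>x\<bar> ^ 4 / 24"
  proof -
    \<comment> \<open>The cubic term is imaginary, so the third Taylor polynomial still has real
      part \<open>1 - x^2 / 2\<close> while its remainder is of order four.\<close>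
    have "(\<Sum>k\<le>3. (\<i> * complex_of_real x) ^ k / fact k) = of_real (1 - x\<^sup>2 / 2) + \<i> * of_real (x - x ^ 3 / 6)"
      by (simp add: eval_nat_numeral power2_eq_square power3_eq_cube field_simps)
    then have "Re (iexp x - (\<Sum>k\<le>3. (\<i> * complex_of_real x) ^ k / fact k)) = cos x - (1 - x\<^sup>2 / 2)"
      by (simp add: Re_exp)
    moreover have "cmod (iexp x - (\<Sum>k\<le>3. (\<i> * complex_of_real x) ^ k / fact k)) \<le> \<bar>x\<bar> ^ 4 / 24"
      using iexp_approx1[of x 3] by (simp add: fact_numeral)
    ultimately show ?thesis
      using abs_Re_le_cmod[of "iexp x - (\<Sum>k\<le>3. (\<i> * complex_of_real x) ^ k / fact k)"] by linarith
  qed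
  moreover have "\<bar>exp (- y) - (1 - y)\<bar> \<le> y\<^sup>2 / 2" if y: "y \<ge> 0" for y :: real
  proof -
    have "exp (- y) \<ge> 1 - y" using exp_ge_add_one_self[of "- y"] by simp
    \<comment> \<open>From \<open>exp y \<ge> 1 + y + y^2 / 2\<close> and
      \<open>(1 - y + y^2 / 2) (1 + y + y^2 / 2) = 1 + y^4 / 4\<close>.\<close>
    moreover have "exp (- y) \<le> 1 - y + y\<^sup>2 / 2"
    proof -
      have q: "1 + y + y\<^sup>2 / 2 > 0" using y by (simp add: add_pos_nonneg)
      have "exp (- y) = 1 / exp y" by (simp add: exp_minus inverse_eq_divide)
      also have "\<dots> \<le> 1 / (1 + y + y\<^sup>2 / 2)"
        using exp_lower_Taylor_quadratic[OF y] q by (intro divide_left_mono) auto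
      also have "\<dots> \<le> 1 - y + y\<^sup>2 / 2"
      proof -
        have "(1 - y + y\<^sup>2 / 2) * (1 + y + y\<^sup>2 / 2) = 1 + (y\<^sup>2 / 2)\<^sup>2"
          by (simp add: power2_eq_square field_simps)
        then have "1 \<le> (1 - y + y\<^sup>2 / 2) * (1 + y + y\<^sup>2 / 2)" by simp
        then show ?thesis using q by (simp only: divide_le_eq if_True)
      qed
      finally show ?thesis .
    qed
    ultimately show ?thesis by (simp add: abs_if)
  qed
  from this[of "x\<^sup>2 / 2"] have "\<bar>exp (- x\<^sup>2 / 2) - (1 - x\<^sup>2 / 2)\<bar> \<le> x ^ 4 / 8"
    by (simp add: power_divide power_mult[symmetric])
  ultimately show ?thesis by (simp add: abs_if split: if_splits)
qed

section \<open>Central limit theorem for Rademacher linear forms\<close>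

context rademacher
begin

text \<open>Independence factorises the expectation, and averaging an exponential over a sign gives
  a cosine.\<close>

lemma iexp_linear_form:
  "expectation (\<lambda>z. iexp (linear_form n h z)) = of_real (\<Prod>v\<in>{1..n}. cos (h (real v / real n) / sqrt (real n)))"
proof -
  let ?x = "\<lambda>v. h (real v / real n) / sqrt (real n)"
  have iexp_avg: "(1 / 2) *\<^sub>R (iexp (y * 1) + iexp (y * (-1))) = complex_of_real (cos y)" for y
    by (simp add: cos_of_real[symmetric] cos_exp_eq scaleR_conv_of_real)
  have "iexp (linear_form n h z) = (\<Prod>v\<in>{1..n}. iexp (?x v * \<epsilon> v z))" for z
    by (simp add: linear_form_def exp_sum sum_distrib_left)
  then have "expectation (\<lambda>z. iexp (linear_form n h z)) = expectation (\<lambda>z. \<Prod>v\<in>{1..n}. iexp (?x v * \<epsilon> v z))"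
    by simp
  also have "\<dots> = (\<Prod>v\<in>{1..n}. expectation (\<lambda>z. iexp (?x v * \<epsilon> v z)))"
  proof (rule indep_vars_lebesgue_integral)
    show "indep_vars (\<lambda>_. borel) (\<lambda>v z. iexp (?x v * \<epsilon> v z)) {1..n}"
      by (intro indep_vars_compose2[OF indep_vars_subset[OF indep_signs]]) auto
    show "integrable M (\<lambda>z. iexp (?x v * \<epsilon> v z))" if "v \<in> {1..n}" for v
      using that measurable_sign[of v] by (intro integrable_iexp) auto
  qed auto
  also have "\<dots> = (\<Prod>v\<in>{1..n}. of_real (cos (?x v)))"
  proof (rule prod.cong[OF refl])
    fix v assume "v \<in> {1..n}"
    then have "expectation (\<lambda>z. iexp (?x v * \<epsilon> v z)) = (1 / 2) *\<^sub>R (iexp (?x v * 1) + iexp (?x v * (-1)))"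
      by (intro expectation_sign[of v "\<lambda>u. iexp (?x v * u)"]) auto
    also have "\<dots> = of_real (cos (?x v))" by (rule iexp_avg)
    finally show "expectation (\<lambda>z. iexp (?x v * \<epsilon> v z)) = of_real (cos (?x v))" .
  qed
  finally show ?thesis by (simp only: of_real_prod)
qed

text \<open>Cosines are compared with Gaussian factors one by one. The total error is at most the
  sum of fourth powers, of order \<open>1/n\<close>, while the sum of squares in the Gaussian
  exponent is a Riemann sum.\<close>

theorem iexp_linear_form_tendsto:
  assumes h: "continuous_on {0..1} h"
  shows "(\<lambda>n. expectation (\<lambda>z. iexp (linear_form n h z))) \<longlonglongrightarrow>
    of_real (exp (- (\<integral>s. (h s)\<^sup>2 \<partial>unit_interval) / 2))"
proof -
  let ?x = "\<lambda>n v. h (real v / real n) / sqrt (real n)"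
  obtain B where B: "\<And>s. s \<in> {0..1} \<Longrightarrow> \<bar>h s\<bar> \<le> B"
    using compact_continuous_image[OF h compact_Icc] compact_imp_bounded
    by (fastforce simp: bounded_iff)
  have sumsq: "(\<lambda>n. \<Sum>v\<in>{1..n}. (?x n v)\<^sup>2) \<longlonglongrightarrow> (\<integral>s. (h s)\<^sup>2 \<partial>unit_interval)"
  proof -
    have "(\<Sum>v\<in>{1..n}. (?x n v)\<^sup>2) = (\<Sum>v\<in>{1..n}. (h (real v / real n))\<^sup>2) / real n" for n
      by (simp add: power_divide sum_divide_distrib)
    then show ?thesis using riemann_unit_interval[of "\<lambda>s. (h s)\<^sup>2"] h by (simp add: continuous_on_power)
  qed
  have sum4: "(\<Sum>v\<in>{1..n}. (?x n v) ^ 4) \<le> B ^ 4 / real n" for n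
  proof (cases "n = 0")
    case False
    have "(?x n v) ^ 4 \<le> B ^ 4 / (real n)\<^sup>2" if "v \<in> {1..n}" for v
    proof -
      have "sqrt (real n) ^ 4 = (sqrt (real n) ^ 2) ^ 2"
        using power_mult[of "sqrt (real n)" 2 2] by simp
      then have "sqrt (real n) ^ 4 = (real n)\<^sup>2" by simp
      then have "(?x n v) ^ 4 = h (real v / real n) ^ 4 / (real n)\<^sup>2" by (simp add: power_divide)
      moreover have "h (real v / real n) ^ 4 \<le> B ^ 4"
      proof -
        have "\<bar>h (real v / real n)\<bar> ^ 4 \<le> B ^ 4"
          using B[OF cell_grid_mem[OF _ that]] that by (intro power_mono) auto
        then show ?thesis by simp
      qed
      ultimately show ?thesis by (simp add: divide_right_mono)
    qed
    then have "(\<Sum>v\<in>{1..n}. (?x n v) ^ 4) \<le> real (card {1..n}) * (B ^ 4 / (real n)\<^sup>2)"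
      by (intro sum_bounded_above)
    then show ?thesis using False by (simp add: power2_eq_square)
  qed simp
  have "(\<lambda>n. (\<Prod>v\<in>{1..n}. cos (?x n v)) - exp (- (\<Sum>v\<in>{1..n}. (?x n v)\<^sup>2) / 2)) \<longlonglongrightarrow> 0"
  proof (rule Lim_null_comparison[OF always_eventually], rule allI)
    fix n
    have "exp (- (\<Sum>v\<in>{1..n}. (?x n v)\<^sup>2) / 2) = (\<Prod>v\<in>{1..n}. exp (- (?x n v)\<^sup>2 / 2))"
      by (simp add: exp_sum[symmetric] sum_negf sum_divide_distrib[symmetric])
    \<comment> \<open>For factors of modulus at most \<open>1\<close>, a difference of products is
      bounded by the sum of the differences of the factors.\<close>
    then have "norm ((\<Prod>v\<in>{1..n}. cos (?x n v)) - exp (- (\<Sum>v\<in>{1..n}. (?x n v)\<^sup>2) / 2)) \<le>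
       (\<Sum>v\<in>{1..n}. norm (cos (?x n v) - exp (- (?x n v)\<^sup>2 / 2)))"
      by (simp only:) (intro norm_prod_diff, auto)
    also have "\<dots> \<le> (\<Sum>v\<in>{1..n}. (?x n v) ^ 4)"
      unfolding real_norm_def by (intro sum_mono cos_minus_gaussian_le)
    also have "\<dots> \<le> B ^ 4 * (1 / real n)" using sum4 by simp
    finally show "norm ((\<Prod>v\<in>{1..n}. cos (?x n v)) - exp (- (\<Sum>v\<in>{1..n}. (?x n v)\<^sup>2) / 2)) \<le> B ^ 4 * (1 / real n)" .
  next
    show "(\<lambda>n. B ^ 4 * (1 / real n)) \<longlonglongrightarrow> 0"
      using tendsto_mult_left[OF lim_1_over_n, of "B ^ 4"] by simp
  qed
  moreover have "(\<lambda>n. exp (- (\<Sum>v\<in>{1..n}. (?x n v)\<^sup>2) / 2)) \<longlonglongrightarrow> exp (- (\<integral>s. (h s)\<^sup>2 \<partial>unit_interval) / 2)"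
    by (intro tendsto_intros sumsq) auto
  ultimately have "(\<lambda>n. \<Prod>v\<in>{1..n}. cos (?x n v)) \<longlonglongrightarrow> exp (- (\<integral>s. (h s)\<^sup>2 \<partial>unit_interval) / 2)"
    using tendsto_add by fastforce
  then show ?thesis unfolding iexp_linear_form by (rule tendsto_of_real)
qed

text \<open>The Cramer-Wold reduction: joint characteristic functions of linear forms are those of a
  single one, with a combined function.\<close>

lemma linear_form_sum: "linear_form n (\<lambda>x. \<Sum>l\<in>L. s l * h l x) z = (\<Sum>l\<in>L. s l * linear_form n (h l) z)"
  unfolding linear_form_def sum_distrib_left sum_distrib_right mult.assoc by (rule sum.swap)

end

subsection \<open>The invariance principle\<close>

lemma mult_divide_add_one_less:
  fixes c e :: real
  assumes "c \<ge> 0" "e > 0"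
  shows "e / (c + 1) > 0" "c * (e / (c + 1)) < e"
proof -
  have "c + 1 > 0" using assms(1) by simp
  then show "e / (c + 1) > 0" "c * (e / (c + 1)) < e"
    using assms by (simp_all add: pos_divide_less_eq algebra_simps)
qed

section \<open>Mean square estimates and completeness\<close>

context prob_space
begin

text \<open>From \<open>2 e |X| \<le> e^2 + X^2\<close>, so the first moment is bounded without the
  Cauchy-Schwarz inequality or square roots.\<close>

lemma expectation_abs_le:
  assumes X: "square_integrable M X" and e: "e > 0" "expectation (\<lambda>z. (X z)\<^sup>2) \<le> e\<^sup>2"
  shows "integrable M X" "expectation (\<lambda>z. \<bar>X z\<bar>) \<le> e"
proof -
  have "square_integrable M (\<lambda>_. 1)" by (simp add: square_integrable_def)
  from square_integrable_mult[OF X this] show iX: "integrable M X" by simp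
  have sq: "integrable M (\<lambda>z. (X z)\<^sup>2)" using X by (simp add: square_integrable_def)
  have "expectation (\<lambda>z. \<bar>X z\<bar>) \<le> expectation (\<lambda>z. (e + (X z)\<^sup>2 / e) / 2)"
  proof (rule integral_mono)
    show "\<bar>X z\<bar> \<le> (e + (X z)\<^sup>2 / e) / 2" for z
    proof -
      have "0 \<le> (\<bar>X z\<bar> - e)\<^sup>2" by simp
      then have "2 * e * \<bar>X z\<bar> \<le> e\<^sup>2 + (X z)\<^sup>2" by (simp add: power2_diff mult_ac)
      then show ?thesis using e(1) by (simp add: field_simps power2_eq_square)
    qed
  qed (use iX sq in auto)
  also have "\<dots> = (e + expectation (\<lambda>z. (X z)\<^sup>2) / e) / 2"
    using sq by (simp add: prob_space)
  also have "\<dots> \<le> (e + e\<^sup>2 / e) / 2"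
    using e by (intro divide_right_mono add_left_mono) auto
  also have "\<dots> = e" using e(1) by (simp add: power2_eq_square)
  finally show "expectation (\<lambda>z. \<bar>X z\<bar>) \<le> e" .
qed

lemma iexp_expectation_diff:
  assumes X: "X \<in> borel_measurable M" and Y: "Y \<in> borel_measurable M"
    and XY: "square_integrable M (\<lambda>z. X z - Y z)"
    and e: "e > 0" "expectation (\<lambda>z. (X z - Y z)\<^sup>2) \<le> e\<^sup>2"
  shows "norm (expectation (\<lambda>z. iexp (t * X z)) - expectation (\<lambda>z. iexp (t * Y z))) \<le> \<bar>t\<bar> * e"
proof -
  note [measurable] = X Y
  note ab = expectation_abs_le[OF XY e]
  have int: "integrable M (\<lambda>z. iexp (t * X z))" "integrable M (\<lambda>z. iexp (t * Y z))"
    by (intro integrable_iexp; simp)+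
  have "norm (expectation (\<lambda>z. iexp (t * X z)) - expectation (\<lambda>z. iexp (t * Y z))) \<le>
      expectation (\<lambda>z. norm (iexp (t * X z) - iexp (t * Y z)))"
    by (rule norm_expectation_diff[OF int])
  also have "\<dots> \<le> expectation (\<lambda>z. \<bar>t\<bar> * \<bar>X z - Y z\<bar>)"
  proof (rule integral_mono)
    show "integrable M (\<lambda>z. norm (iexp (t * X z) - iexp (t * Y z)))" using int by auto
    show "integrable M (\<lambda>z. \<bar>t\<bar> * \<bar>X z - Y z\<bar>)" using ab(1) by auto
    show "norm (iexp (t * X z) - iexp (t * Y z)) \<le> \<bar>t\<bar> * \<bar>X z - Y z\<bar>" for z
      using norm_iexp_diff[of "t * X z" "t * Y z"]
      by (simp add: abs_mult[symmetric] right_diff_distrib)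
  qed
  also have "\<dots> \<le> \<bar>t\<bar> * e" using ab(2) by (simp add: mult_left_mono)
  finally show ?thesis .
qed

text \<open>Truncated squares are bounded and continuous in \<open>X\<close>, hence accessible to
  weak limits; monotone convergence in \<open>K\<close> recovers the second moment together with its
  finiteness.\<close>

lemma square_integrable_truncation:
  assumes X [measurable]: "X \<in> borel_measurable M"
    and b: "\<And>K :: nat. expectation (\<lambda>z. min ((X z)\<^sup>2) (real K)) \<le> B"
  shows "square_integrable M X" "expectation (\<lambda>z. (X z)\<^sup>2) \<le> B"
proof -
  let ?f = "\<lambda>K z. min ((X z)\<^sup>2) (real K)"
  have int: "integrable M (?f K)" for K :: nat
    by (rule integrable_const_bound[where B="real K"]) auto
  have inc: "incseq (\<lambda>K. expectation (?f K))"
    by (intro incseq_SucI integral_mono int) auto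
  obtain x where x: "(\<lambda>K. expectation (?f K)) \<longlonglongrightarrow> x" "\<And>K. expectation (?f K) \<le> x"
    using incseq_convergent[OF inc, of B] b by blast
  have "x \<le> B" using b by (intro LIMSEQ_le_const2[OF x(1)]) auto
  have mono: "AE z in M. mono (\<lambda>K. ?f K z)"
    by (intro AE_I2 monoI) (auto simp: min_def)
  have lim: "AE z in M. (\<lambda>K. ?f K z) \<longlonglongrightarrow> (X z)\<^sup>2"
  proof (rule AE_I2)
    fix z
    obtain n :: nat where "(X z)\<^sup>2 \<le> real n" using real_arch_simple by blast
    then have "\<forall>\<^sub>F K in sequentially. ?f K z = (X z)\<^sup>2"
      by (intro eventually_sequentiallyI[of n]) auto
    then show "(\<lambda>K. ?f K z) \<longlonglongrightarrow> (X z)\<^sup>2" by (rule tendsto_eventually)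
  qed
  have "integrable M (\<lambda>z. (X z)\<^sup>2)" "expectation (\<lambda>z. (X z)\<^sup>2) = x"
    using integrable_monotone_convergence[OF int mono lim x(1)]
      integral_monotone_convergence[OF int mono lim x(1)] by auto
  then show "square_integrable M X" "expectation (\<lambda>z. (X z)\<^sup>2) \<le> B"
    using \<open>x \<le> B\<close> by (auto simp: square_integrable_def)
qed

text \<open>Completeness along finite subsets. The limit is found on an increasing sequence of index
  sets, from a subsequence converging almost surely; Fatou's lemma then transfers the Cauchy
  estimate to the distance between the limit and every sufficiently large partial sum.\<close>

lemma L2_complete_net:
  fixes F :: "'i \<Rightarrow> 'a \<Rightarrow> real"
  assumes F: "\<And>m. m \<in> I \<Longrightarrow> square_integrable M (F m)"
    and cauchy: "\<And>e. e > 0 \<Longrightarrow> \<exists>T. finite T \<and> T \<subseteq> I \<and>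
      (\<forall>S S'. finite S \<and> T \<subseteq> S \<and> S \<subseteq> I \<and> finite S' \<and> T \<subseteq> S' \<and> S' \<subseteq> I \<longrightarrow>
        expectation (\<lambda>z. ((\<Sum>m\<in>S. F m z) - (\<Sum>m\<in>S'. F m z))\<^sup>2) \<le> e)"
  shows "\<exists>Y. L2_has_sum M F Y I"
proof -
  define good where "good e T \<longleftrightarrow> finite T \<and> T \<subseteq> I \<and>
      (\<forall>S S'. finite S \<and> T \<subseteq> S \<and> S \<subseteq> I \<and> finite S' \<and> T \<subseteq> S' \<and> S' \<subseteq> I \<longrightarrow>
        expectation (\<lambda>z. ((\<Sum>m\<in>S. F m z) - (\<Sum>m\<in>S'. F m z))\<^sup>2) \<le> e)" for e T
  have "\<exists>T. good (inverse (real (Suc r))) T" for r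
    using cauchy[of "inverse (real (Suc r))"] unfolding good_def by simp
  then obtain T where T: "\<And>r. good (inverse (real (Suc r))) (T r)" by metis
  \<comment> \<open>Unions make the sets increase, so \<open>V r\<close> contains \<open>T q\<close>
    for all \<open>q \<le> r\<close> and the Cauchy bound of \<open>T q\<close> holds for all later
    partial sums.\<close>
  define V where "V r = (\<Union>q\<le>r. T q)" for r
  define Yr where "Yr r z = (\<Sum>m\<in>V r. F m z)" for r z
  have V: "finite (V r)" "V r \<subseteq> I" for r using T by (auto simp: V_def good_def)
  have TV: "T q \<subseteq> V r" if "q \<le> r" for q r using that by (auto simp: V_def)
  have sqS: "square_integrable M (\<lambda>z. \<Sum>m\<in>S. F m z)" if "S \<subseteq> I" for S
    using that F by (intro square_integrable_sum) auto
  have sqY: "square_integrable M (Yr r)" for r unfolding Yr_def[abs_def] by (intro sqS V)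
  have [measurable]: "Yr r \<in> borel_measurable M" for r using sqY by (auto simp: square_integrable_def)
  have close: "expectation (\<lambda>z. ((\<Sum>m\<in>S. F m z) - Yr r z)\<^sup>2) \<le> inverse (real (Suc q))"
    if "finite S" "T q \<subseteq> S" "S \<subseteq> I" "q \<le> r" for S q r
    using T[of q] that V[of r] TV[OF that(4)] unfolding good_def Yr_def by blast
  have Yint: "integrable M (Yr r)" for r
  proof -
    have "square_integrable M (\<lambda>_. 1)" by (simp add: square_integrable_def)
    from square_integrable_mult[OF sqY this] show ?thesis by simp
  qed
  have "\<exists>R. \<forall>i\<ge>R. \<forall>j\<ge>R. expectation (\<lambda>z. norm (Yr i z - Yr j z)) < e" if e: "e > 0" for e
  proof -
    obtain q where q: "inverse (real (Suc q)) < (e / 2)\<^sup>2"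
      using reals_Archimedean[of "(e / 2)\<^sup>2"] e by auto
    have "expectation (\<lambda>z. norm (Yr i z - Yr j z)) < e" if "i \<ge> q" "j \<ge> q" for i j
    proof -
      have "expectation (\<lambda>z. (Yr i z - Yr j z)\<^sup>2) \<le> (e / 2)\<^sup>2"
        using close[OF V(1) TV[OF that(1)] V(2) that(2)] q by (simp add: Yr_def)
      from expectation_abs_le(2)[OF square_integrable_diff[OF sqY sqY] _ this] e
      show ?thesis by simp
    qed
    then show ?thesis by blast
  qed
  then obtain r where r: "strict_mono r" "AE z in M. Cauchy (\<lambda>i. Yr (r i) z)"
    using cauchy_L1_AE_cauchy_subseq[of M Yr, OF Yint] by blast
  define Y where "Y z = lim (\<lambda>i. Yr (r i) z)" for z
  have [measurable]: "Y \<in> borel_measurable M" unfolding Y_def[abs_def] by measurable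
  have lim: "AE z in M. (\<lambda>i. Yr (r i) z) \<longlonglongrightarrow> Y z"
    using r(2) unfolding Y_def by eventually_elim (simp add: Cauchy_convergent_iff convergent_LIMSEQ_iff)
  \<comment> \<open>Nonnegative integrals are used because square integrability of the difference is
    only a consequence of this bound.\<close>
  have bound: "(\<integral>\<^sup>+z. ennreal (((\<Sum>m\<in>S. F m z) - Y z)\<^sup>2) \<partial>M) \<le> ennreal (inverse (real (Suc q)))"
    if S: "finite S" "T q \<subseteq> S" "S \<subseteq> I" for S q
  proof -
    let ?u = "\<lambda>i z. ((\<Sum>m\<in>S. F m z) - Yr (r i) z)\<^sup>2"
    have [measurable]: "(\<lambda>z. \<Sum>m\<in>S. F m z) \<in> borel_measurable M"
      using sqS[OF S(3)] by (simp add: square_integrable_def)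
    have "(\<integral>\<^sup>+z. ennreal (((\<Sum>m\<in>S. F m z) - Y z)\<^sup>2) \<partial>M) = (\<integral>\<^sup>+z. liminf (\<lambda>i. ennreal (?u i z)) \<partial>M)"
    proof (rule nn_integral_cong_AE)
      show "AE z in M. ennreal (((\<Sum>m\<in>S. F m z) - Y z)\<^sup>2) = liminf (\<lambda>i. ennreal (?u i z))"
        using lim
      proof eventually_elim
        case (elim z)
        then have "(\<lambda>i. ennreal (?u i z)) \<longlonglongrightarrow> ennreal (((\<Sum>m\<in>S. F m z) - Y z)\<^sup>2)"
          by (intro tendsto_ennrealI tendsto_intros)
        then show ?case by (intro lim_imp_Liminf[symmetric]) auto
      qed
    qed
    also have "\<dots> \<le> liminf (\<lambda>i. \<integral>\<^sup>+z. ennreal (?u i z) \<partial>M)"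
      by (rule nn_integral_liminf) measurable
    also have "\<dots> \<le> limsup (\<lambda>i. \<integral>\<^sup>+z. ennreal (?u i z) \<partial>M)"
      by (rule Liminf_le_Limsup) auto
    also have "\<dots> \<le> ennreal (inverse (real (Suc q)))"
    proof (rule Limsup_bounded, rule eventually_sequentiallyI[of q])
      fix i assume "q \<le> i"
      then have "q \<le> r i" using seq_suble[OF r(1), of i] by linarith
      have "(\<integral>\<^sup>+z. ennreal (?u i z) \<partial>M) = ennreal (expectation (?u i))"
        using square_integrable_diff[OF sqS[OF S(3)] sqY, of "r i"]
        by (intro nn_integral_eq_integral) (auto simp: square_integrable_def)
      also have "\<dots> \<le> ennreal (inverse (real (Suc q)))"
        using close[OF S \<open>q \<le> r i\<close>] by (rule ennreal_leI)
      finally show "(\<integral>\<^sup>+z. ennreal (?u i z) \<partial>M) \<le> ennreal (inverse (real (Suc q)))" .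
    qed
    finally show ?thesis .
  qed
  have sq: "square_integrable M (\<lambda>z. (\<Sum>m\<in>S. F m z) - Y z)"
      and le: "expectation (\<lambda>z. ((\<Sum>m\<in>S. F m z) - Y z)\<^sup>2) \<le> inverse (real (Suc q))"
    if S: "finite S" "T q \<subseteq> S" "S \<subseteq> I" for S q
  proof -
    have [measurable]: "(\<lambda>z. \<Sum>m\<in>S. F m z) \<in> borel_measurable M"
      using sqS[OF S(3)] by (simp add: square_integrable_def)
    show "square_integrable M (\<lambda>z. (\<Sum>m\<in>S. F m z) - Y z)"
      unfolding square_integrable_def
      using le_less_trans[OF bound[OF S]] by (auto intro!: integrableI_bounded)
    show "expectation (\<lambda>z. ((\<Sum>m\<in>S. F m z) - Y z)\<^sup>2) \<le> inverse (real (Suc q))"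
      using bound[OF S] by (intro integral_real_bounded) auto
  qed
  have "square_integrable M Y"
    using square_integrable_diff[OF sqS[OF V(2)[of 0]] sq[OF V(1) TV[OF order_refl] V(2), of 0]] by simp
  moreover have "((\<lambda>S. expectation (\<lambda>z. ((\<Sum>m\<in>S. F m z) - Y z)\<^sup>2)) \<longlongrightarrow> 0) (finite_subsets_at_top I)"
  proof (rule tendstoI)
    fix e :: real assume "e > 0"
    then obtain q where q: "inverse (real (Suc q)) < e" using reals_Archimedean by blast
    show "\<forall>\<^sub>F S in finite_subsets_at_top I. dist (expectation (\<lambda>z. ((\<Sum>m\<in>S. F m z) - Y z)\<^sup>2)) 0 < e"
      unfolding eventually_finite_subsets_at_top
    proof (intro exI[of _ "T q"] conjI allI impI)
      fix S assume S: "finite S \<and> T q \<subseteq> S \<and> S \<subseteq> I"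
      then have "expectation (\<lambda>z. ((\<Sum>m\<in>S. F m z) - Y z)\<^sup>2) \<le> inverse (real (Suc q))" using le by blast
      then show "dist (expectation (\<lambda>z. ((\<Sum>m\<in>S. F m z) - Y z)\<^sup>2)) 0 < e" using q by simp
    qed (use T[of q] in \<open>auto simp: good_def\<close>)
  qed
  ultimately show ?thesis unfolding L2_has_sum_def using F by blast
qed

end

locale invariance = rademacher_onb M \<epsilon> \<psi> + noise_onb \<psi> N \<xi>
  for M :: "'a measure" and \<epsilon> and \<psi> and N :: "'b measure" and \<xi> +
  fixes J :: "nat set"
  assumes finJ: "finite J"
begin

abbreviation P :: "(nat \<Rightarrow> real) measure" where "P \<equiv> cubeM J"

abbreviation indices :: "(nat \<Rightarrow> nat) set" where "indices \<equiv> J \<rightarrow>\<^sub>E {1..}"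

abbreviation C :: real where "C \<equiv> real (card J ^ card J)"

definition herm :: "(nat \<Rightarrow> nat) \<Rightarrow> 'b \<Rightarrow> real" where
  "herm m z = hermite_form J m (\<lambda>l. \<xi> (\<psi> l) z)"

lemma index_ge: "m \<in> indices \<Longrightarrow> j \<in> J \<Longrightarrow> m j \<ge> 1"
  by (auto simp: PiE_iff)

lemma measurable_herm: "m \<in> indices \<Longrightarrow> herm m \<in> borel_measurable N"
  unfolding herm_def[abs_def] using index_ge
  by (intro measurable_hermite_form measurable_noise) auto

lemma continuous_Psi: "m \<in> indices \<Longrightarrow> continuous_on (cube_on J) (\<Psi> J m)"
  using index_ge by (intro continuous_on_tensor continuous_basis) auto

text \<open>The chaos may be replaced by the polynomial of linear forms, the error being negligible.
  The polynomial then converges by \<open>iexp_poly_conv\<close>, whose hypothesis is the central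
  limit theorem matched with \<open>iexp_noise\<close>.\<close>

lemma iexp_chaos_conv:
  assumes S: "finite S" "S \<subseteq> indices"
  shows "(\<lambda>n. expectation (\<lambda>z. iexp (t * chaos n J (comb J S b) z))) \<longlonglongrightarrow>
    N.expectation (\<lambda>z. iexp (t * (\<Sum>m\<in>S. b m * herm m z)))"
proof -
  \<comment> \<open>The finitely many basis indices occurring in the combination; they are the
    coordinates of the random vector.\<close>
  define L where "L = (\<Union>m\<in>S. m ` J)"
  have L: "finite L" "L \<subseteq> {1..}" "\<And>m. m \<in> S \<Longrightarrow> m ` J \<subseteq> L"
    using S finJ index_ge by (auto simp: L_def)
  let ?X = "\<lambda>n l. linear_form n (\<psi> l)"
  interpret C: joint_char_conv M N L ?X "\<lambda>l. \<xi> (\<psi> l)"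
  proof unfold_locales
    fix s :: "nat \<Rightarrow> real"
    have c: "continuous_on {0..1} (\<lambda>x. \<Sum>l\<in>L. s l * \<psi> l x)"
      using L by (intro continuous_intros continuous_basis) auto
    have "(\<integral>x. (\<Sum>l\<in>L. s l * \<psi> l x)\<^sup>2 \<partial>unit_interval) = (\<Sum>l\<in>L. (s l)\<^sup>2)"
      using L(2) by (intro integral_orthonormal_square L(1) square_integrable_basis orthonormal) auto
    with iexp_linear_form_tendsto[OF c] iexp_noise[OF L(1,2), of s]
    show "(\<lambda>n. expectation (\<lambda>z. iexp (\<Sum>l\<in>L. s l * ?X n l z))) \<longlonglongrightarrow>
        N.expectation (\<lambda>z. iexp (\<Sum>l\<in>L. s l * \<xi> (\<psi> l) z))"
      by (simp only: linear_form_sum)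
  qed (use L measurable_linear_form measurable_noise in auto)
  let ?p = "\<lambda>w. \<Sum>m\<in>S. b m * hermite_form J m w"
  have p: "poly_fun L (\<lambda>w. t * ?p w)"
    using L(3) by (intro poly_fun_cmult poly_fun_sum poly_fun_hermite_form)
  have ge: "l \<ge> 1" if "l \<in> L" for l using L(2) that by auto
  have lim: "(\<lambda>n. expectation (\<lambda>z. iexp (t * ?p (\<lambda>l. ?X n l z)))) \<longlonglongrightarrow>
      N.expectation (\<lambda>z. iexp (t * (\<Sum>m\<in>S. b m * herm m z)))"
    using C.iexp_poly_conv[OF p tight_linear_form[OF continuous_basis[OF ge]] tight_noise[OF ge]]
    by (simp add: herm_def)
  have "negligible_seq (\<lambda>n z. \<Sum>m\<in>S. b m * (chaos n J (\<Psi> J m) z - hermite_form J m (\<lambda>l. ?X n l z)))"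
    using S index_ge finJ
    by (intro negligible_seq_sum negligible_seq_cmult chaos_minus_hermite) auto
  then have neg: "negligible_seq (\<lambda>n z. chaos n J (comb J S b) z - ?p (\<lambda>l. ?X n l z))"
    by (simp add: chaos_sum sum_subtractf right_diff_distrib)
  have m1: "chaos n J (comb J S b) \<in> borel_measurable M" for n
    by (rule measurable_chaos[OF finJ])
  have m2: "(\<lambda>z. ?p (\<lambda>l. ?X n l z)) \<in> borel_measurable M" for n
    by (intro borel_measurable_sum borel_measurable_times borel_measurable_const
        measurable_hermite_form measurable_linear_form)
  show ?thesis
    using tendsto_add[OF negligible_seq_iexp[OF neg m1 m2, of t] lim] by simp
qed

lemma chaos_weak_conv:
  assumes F: "\<And>t. (\<lambda>n. expectation (\<lambda>z. iexp (t * chaos n J F z))) \<longlonglongrightarrow> N.expectation (\<lambda>z. iexp (t * Y z))"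
    and Y [measurable]: "Y \<in> borel_measurable N"
  shows "weak_conv_m (\<lambda>n. distr M borel (chaos n J F)) (distr N borel Y)"
proof (rule levy_continuity)
  note [measurable] = measurable_chaos[OF finJ]
  show "real_distribution (distr M borel (chaos n J F))" for n
    by (rule real_distribution_distr) auto
  show "real_distribution (distr N borel Y)" by (rule N.real_distribution_distr) auto
  show "(\<lambda>n. char (distr M borel (chaos n J F)) t) \<longlonglongrightarrow> char (distr N borel Y) t" for t
    using F[of t] by (simp add: char_def integral_distr)
qed

text \<open>Fatou's lemma transfers the second moment bound for the Rademacher chaos to its weak limit,
  so no orthogonality relations between Hermite polynomials are needed.\<close>

lemma
  assumes S: "finite S" "S \<subseteq> indices"
  shows square_integrable_sum_herm: "square_integrable N (\<lambda>z. \<Sum>m\<in>S. b m * herm m z)"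
    and sum_herm_L2_bound: "N.expectation (\<lambda>z. (\<Sum>m\<in>S. b m * herm m z)\<^sup>2) \<le>
      C * (\<integral>x. (comb J S b x)\<^sup>2 \<partial>P)"
proof -
  let ?Y = "\<lambda>z. \<Sum>m\<in>S. b m * herm m z"
  let ?F = "comb J S b"
  have Y [measurable]: "?Y \<in> borel_measurable N"
    using S by (intro borel_measurable_sum borel_measurable_times borel_measurable_const measurable_herm) auto
  have F: "continuous_on (cube_on J) ?F"
    using S by (intro continuous_intros continuous_Psi) auto
  note [measurable] = measurable_chaos[OF finJ]
  have rd: "real_distribution (distr M borel (chaos n J ?F))" for n
    by (rule real_distribution_distr) auto
  have rd': "real_distribution (distr N borel ?Y)" by (rule N.real_distribution_distr) auto
  have wc: "weak_conv_m (\<lambda>n. distr M borel (chaos n J ?F)) (distr N borel ?Y)"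
    by (rule chaos_weak_conv[OF iexp_chaos_conv[OF S] Y])
  \<comment> \<open>Weak convergence controls only bounded continuous functions, so the square is
    truncated at \<open>K\<close>; the bound obtained does not depend on \<open>K\<close>.\<close>
  have "N.expectation (\<lambda>z. min ((?Y z)\<^sup>2) (real K)) \<le> C * (\<integral>x. (?F x)\<^sup>2 \<partial>P)" for K :: nat
  proof -
    have "(\<lambda>n. \<integral>y. min (y\<^sup>2) (real K) \<partial>distr M borel (chaos n J ?F)) \<longlonglongrightarrow>
        (\<integral>y. min (y\<^sup>2) (real K) \<partial>distr N borel ?Y)"
      by (rule weak_conv_imp_integral_bdd_continuous_conv[OF rd rd' wc, where B="real K"])
        (auto intro!: continuous_intros)
    then have lim: "(\<lambda>n. expectation (\<lambda>z. min ((chaos n J ?F z)\<^sup>2) (real K))) \<longlonglongrightarrow>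
        N.expectation (\<lambda>z. min ((?Y z)\<^sup>2) (real K))"
      by (simp add: integral_distr)
    have "expectation (\<lambda>z. min ((chaos n J ?F z)\<^sup>2) (real K)) \<le>
       C * ((\<Sum>i\<in>J \<rightarrow>\<^sub>E {1..n}. (?F (grid J n i))\<^sup>2) / real n ^ card J)" for n
    proof -
      have "expectation (\<lambda>z. min ((chaos n J ?F z)\<^sup>2) (real K)) \<le> expectation (\<lambda>z. (chaos n J ?F z)\<^sup>2)"
      proof (rule integral_mono)
        show "integrable M (\<lambda>z. min ((chaos n J ?F z)\<^sup>2) (real K))"
          by (rule integrable_const_bound[where B="real K"]) auto
        show "integrable M (\<lambda>z. (chaos n J ?F z)\<^sup>2)"
          using square_integrable_chaos[OF finJ] by (simp add: square_integrable_def)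
      qed simp
      also note chaos_L2_bound[OF finJ]
      finally show ?thesis .
    qed
    then show ?thesis
      by (intro LIMSEQ_le[OF lim chaos_L2_bound_tendsto[OF finJ F]]) auto
  qed
  then show "square_integrable N ?Y" "N.expectation (\<lambda>z. (?Y z)\<^sup>2) \<le> C * (\<integral>x. (?F x)\<^sup>2 \<partial>P)"
    by (rule N.square_integrable_truncation[OF Y])+
qed

lemma square_integrable_herm: "m \<in> indices \<Longrightarrow> square_integrable N (herm m)"
  using square_integrable_sum_herm[of "{m}" "\<lambda>_. 1"] by simp

text \<open>\<open>sum_herm_L2_bound\<close> makes the map from kernels to Hermite sums bounded in
  L2, so the Cauchy property of the kernel series passes to the Hermite series.\<close>

theorem hermite_series_converges:
  assumes f: "L2_has_sum P (\<lambda>m x. c m * \<Psi> J m x) f indices"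
  shows "\<exists>Y. L2_has_sum N (\<lambda>m z. c m * herm m z) Y indices"
proof (rule N.L2_complete_net)
  show "square_integrable N (\<lambda>z. c m * herm m z)" if "m \<in> indices" for m
    using that by (intro square_integrable_cmult square_integrable_herm)
  fix e :: real assume e: "e > 0"
  \<comment> \<open>Two partial sums are compared through \<open>f\<close>, each within
    \<open>d\<close> of it in squared distance; with the doubling this gives \<open>4 * d\<close>,
    and \<open>C * (4 * d) \<le> e\<close>.\<close>
  define d where "d = (e / 4) / (C + 1)"
  have d: "d > 0" and "C * d < e / 4"
    unfolding d_def using e by (intro mult_divide_add_one_less; simp)+
  then have d4: "C * (4 * d) \<le> e" using mult.left_commute[of C 4 d] by linarith
  have sf: "square_integrable P f" using f by (simp add: L2_has_sum_def)
  let ?f = "\<lambda>S x. \<Sum>m\<in>S. c m * \<Psi> J m x"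
  have "\<forall>\<^sub>F S in finite_subsets_at_top indices. (\<integral>x. (?f S x - f x)\<^sup>2 \<partial>P) < d"
    using f d unfolding L2_has_sum_def by (intro order_tendstoD(2)) auto
  then have "\<exists>T. finite T \<and> T \<subseteq> indices \<and>
      (\<forall>S. finite S \<and> T \<subseteq> S \<and> S \<subseteq> indices \<longrightarrow> (\<integral>x. (?f S x - f x)\<^sup>2 \<partial>P) < d)"
    by (simp only: eventually_finite_subsets_at_top)
  then obtain T where T: "finite T" "T \<subseteq> indices"
      and close: "\<forall>S. finite S \<and> T \<subseteq> S \<and> S \<subseteq> indices \<longrightarrow> (\<integral>x. (?f S x - f x)\<^sup>2 \<partial>P) < d"
    by (elim exE conjE)
  show "\<exists>T. finite T \<and> T \<subseteq> indices \<and>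
      (\<forall>S S'. finite S \<and> T \<subseteq> S \<and> S \<subseteq> indices \<and> finite S' \<and> T \<subseteq> S' \<and> S' \<subseteq> indices \<longrightarrow>
        N.expectation (\<lambda>z. ((\<Sum>m\<in>S. c m * herm m z) - (\<Sum>m\<in>S'. c m * herm m z))\<^sup>2) \<le> e)"
  proof (intro exI[of _ T] conjI allI impI T)
    fix S S' assume S: "finite S \<and> T \<subseteq> S \<and> S \<subseteq> indices \<and> finite S' \<and> T \<subseteq> S' \<and> S' \<subseteq> indices"
    \<comment> \<open>The difference of two partial sums as one combination over the union, to which
      the second moment bound applies.\<close>
    define b where "b m = (if m \<in> S then c m else 0) - (if m \<in> S' then c m else 0)" for m
    have eq: "(\<Sum>m\<in>S. c m * u m) - (\<Sum>m\<in>S'. c m * u m) = (\<Sum>m\<in>S \<union> S'. b m * u m)" for u :: "_ \<Rightarrow> real"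
    proof -
      have "(\<Sum>m\<in>S. c m * u m) = (\<Sum>m\<in>S \<union> S'. (if m \<in> S then c m else 0) * u m)"
        using S by (intro sum.mono_neutral_cong_left) auto
      moreover have "(\<Sum>m\<in>S'. c m * u m) = (\<Sum>m\<in>S \<union> S'. (if m \<in> S' then c m else 0) * u m)"
        using S by (intro sum.mono_neutral_cong_left) auto
      ultimately show ?thesis by (simp add: b_def left_diff_distrib sum_subtractf)
    qed
    have sS: "square_integrable P (?f S)" "square_integrable P (?f S')"
      using S square_integrable_sum_Psi[OF finJ, of S c] square_integrable_sum_Psi[OF finJ, of S' c] by blast+
    have "N.expectation (\<lambda>z. ((\<Sum>m\<in>S. c m * herm m z) - (\<Sum>m\<in>S'. c m * herm m z))\<^sup>2) \<le>
        C * (\<integral>x. (?f S x - ?f S' x)\<^sup>2 \<partial>P)"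
      unfolding eq using S by (intro sum_herm_L2_bound) auto
    also have "\<dots> \<le> C * (4 * d)"
    proof (intro mult_left_mono)
      have "(\<integral>x. (?f S x - ?f S' x)\<^sup>2 \<partial>P) \<le> 2 * (\<integral>x. (?f S x - f x)\<^sup>2 \<partial>P) + 2 * (\<integral>x. (f x - ?f S' x)\<^sup>2 \<partial>P)"
        by (rule integral_square_triangle[OF sS(1) sf sS(2)])
      also have "(\<integral>x. (f x - ?f S' x)\<^sup>2 \<partial>P) = (\<integral>x. (?f S' x - f x)\<^sup>2 \<partial>P)"
        by (simp add: power2_commute)
      also have "2 * (\<integral>x. (?f S x - f x)\<^sup>2 \<partial>P) + 2 * (\<integral>x. (?f S' x - f x)\<^sup>2 \<partial>P) \<le> 4 * d"
        using close[rule_format, of S] close[rule_format, of S'] S by simp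
      finally show "(\<integral>x. (?f S x - ?f S' x)\<^sup>2 \<partial>P) \<le> 4 * d" .
    qed simp
    also note d4
    finally show "N.expectation (\<lambda>z. ((\<Sum>m\<in>S. c m * herm m z) - (\<Sum>m\<in>S'. c m * herm m z))\<^sup>2) \<le> e" .
  qed
qed

text \<open>The same partial sum is taken of both series. Replacing \<open>f\<close> by it changes
  the chaos little in mean square for all large \<open>n\<close>, and replacing \<open>Y\<close>
  changes the limit little; in between, \<open>iexp_chaos_conv\<close> applies.\<close>

theorem chaos_converges:
  assumes cont: "continuous_on (cube_on J) f"
    and f: "L2_has_sum P (\<lambda>m x. c m * \<Psi> J m x) f indices"
    and Y: "L2_has_sum N (\<lambda>m z. c m * herm m z) Y indices"
  shows "weak_conv_m (\<lambda>n. distr M borel (chaos n J f)) (distr N borel Y)"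
proof (rule chaos_weak_conv)
  have sY: "square_integrable N Y" using Y by (simp add: L2_has_sum_def)
  then show mY: "Y \<in> borel_measurable N" by (simp add: square_integrable_def)
  fix t :: real
  show "(\<lambda>n. expectation (\<lambda>z. iexp (t * chaos n J f z))) \<longlonglongrightarrow> N.expectation (\<lambda>z. iexp (t * Y z))"
  proof (rule tendsto_uniform_approx)
    fix e :: real assume e: "e > 0"
    define a where "a = e / (\<bar>t\<bar> + 1)"
    have a: "a > 0" "\<bar>t\<bar> * a \<le> e"
      using mult_divide_add_one_less[of "\<bar>t\<bar>" e] e by (auto simp: a_def)
    \<comment> \<open>With \<open>C * d < a^2\<close> the mean square error of the chaos ends up
      below \<open>a^2\<close>, and \<open>a\<close> was chosen with
      \<open>|t| * a \<le> e\<close>.\<close>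
    define d where "d = a\<^sup>2 / (C + 1)"
    have d: "d > 0" "C * d < a\<^sup>2"
      unfolding d_def using a(1) by (intro mult_divide_add_one_less; simp)+
    let ?f = "\<lambda>S x. \<Sum>m\<in>S. c m * \<Psi> J m x"
    let ?Y = "\<lambda>S z. \<Sum>m\<in>S. c m * herm m z"
    have "\<forall>\<^sub>F S in finite_subsets_at_top indices. (\<integral>x. (?f S x - f x)\<^sup>2 \<partial>P) < d"
      using f d unfolding L2_has_sum_def by (intro order_tendstoD(2)) auto
    moreover have "\<forall>\<^sub>F S in finite_subsets_at_top indices. N.expectation (\<lambda>z. (?Y S z - Y z)\<^sup>2) < a\<^sup>2"
      using Y a(1) unfolding L2_has_sum_def by (intro order_tendstoD(2)) auto
    ultimately have "\<forall>\<^sub>F S in finite_subsets_at_top indices.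
        (\<integral>x. (?f S x - f x)\<^sup>2 \<partial>P) < d \<and> N.expectation (\<lambda>z. (?Y S z - Y z)\<^sup>2) < a\<^sup>2"
      by (rule eventually_conj)
    then obtain S where S: "finite S" "S \<subseteq> indices" "(\<integral>x. (?f S x - f x)\<^sup>2 \<partial>P) < d"
        "N.expectation (\<lambda>z. (?Y S z - Y z)\<^sup>2) < a\<^sup>2"
      unfolding eventually_finite_subsets_at_top by blast
    have sYS: "square_integrable N (?Y S)" by (rule square_integrable_sum_herm[OF S(1,2)])
    let ?g = "\<lambda>x. f x - ?f S x"
    have g: "continuous_on (cube_on J) ?g"
      using S(2) by (intro continuous_intros cont continuous_Psi) auto
    have "(\<integral>x. (?g x)\<^sup>2 \<partial>P) < d" using S(3) by (simp add: power2_commute)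
    then have "C * (\<integral>x. (?g x)\<^sup>2 \<partial>P) \<le> C * d" by (intro mult_left_mono) auto
    also note d(2)
    \<comment> \<open>The limit of the Riemann sum bound lies strictly below \<open>a^2\<close>, so
      the bound itself does for large \<open>n\<close>; this uses that the remainder of
      \<open>f\<close> is continuous.\<close>
    finally have "\<forall>\<^sub>F n in sequentially. C * ((\<Sum>i\<in>J \<rightarrow>\<^sub>E {1..n}. (?g (grid J n i))\<^sup>2) / real n ^ card J) < a\<^sup>2"
      by (rule order_tendstoD(2)[OF chaos_L2_bound_tendsto[OF finJ g]])
    then have M_close: "\<forall>\<^sub>F n in sequentially. norm (expectation (\<lambda>z. iexp (t * chaos n J f z)) -
        expectation (\<lambda>z. iexp (t * chaos n J (?f S) z))) \<le> e"
    proof eventually_elim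
      case (elim n)
      have diff: "chaos n J f z - chaos n J (?f S) z = chaos n J ?g z" for z
        by (rule chaos_diff[symmetric])
      have "norm (expectation (\<lambda>z. iexp (t * chaos n J f z)) -
          expectation (\<lambda>z. iexp (t * chaos n J (?f S) z))) \<le> \<bar>t\<bar> * a"
      proof (rule iexp_expectation_diff[OF measurable_chaos[OF finJ] measurable_chaos[OF finJ] _ a(1)])
        show "square_integrable M (\<lambda>z. chaos n J f z - chaos n J (?f S) z)"
          unfolding diff by (rule square_integrable_chaos[OF finJ])
        show "expectation (\<lambda>z. (chaos n J f z - chaos n J (?f S) z)\<^sup>2) \<le> a\<^sup>2"
          unfolding diff using chaos_L2_bound[OF finJ, of n ?g] elim by linarith
      qed
      with a(2) show ?case by linarith
    qed
    have N_close: "norm (N.expectation (\<lambda>z. iexp (t * Y z)) - N.expectation (\<lambda>z. iexp (t * ?Y S z))) \<le> e"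
    proof -
      have "norm (N.expectation (\<lambda>z. iexp (t * Y z)) - N.expectation (\<lambda>z. iexp (t * ?Y S z))) \<le> \<bar>t\<bar> * a"
      proof (rule N.iexp_expectation_diff[OF mY _ square_integrable_diff[OF sY sYS] a(1)])
        show "?Y S \<in> borel_measurable N" using sYS by (simp add: square_integrable_def)
        show "N.expectation (\<lambda>z. (Y z - ?Y S z)\<^sup>2) \<le> a\<^sup>2" using S(4) by (simp add: power2_commute)
      qed
      with a(2) show ?thesis by linarith
    qed
    show "\<exists>y y'. y \<longlonglongrightarrow> y' \<and>
        (\<forall>\<^sub>F n in sequentially. norm (expectation (\<lambda>z. iexp (t * chaos n J f z)) - y n) \<le> e) \<and>
        norm (N.expectation (\<lambda>z. iexp (t * Y z)) - y') \<le> e"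
      using iexp_chaos_conv[OF S(1,2), of t c] M_close N_close by blast
  qed
qed

end

theorem theorem3:
  fixes M :: "'a measure" and \<epsilon> :: "nat \<Rightarrow> 'a \<Rightarrow> real"
    and N :: "'b measure" and \<xi> :: "(real \<Rightarrow> real) \<Rightarrow> 'b \<Rightarrow> real"
    and \<psi> :: "nat \<Rightarrow> real \<Rightarrow> real"
    and k :: nat and f :: "(nat \<Rightarrow> real) \<Rightarrow> real"
  assumes "rademacher_sequence M \<epsilon>"
    and "white_noise N \<xi>"
    and "orthonormal_basis \<psi>"
    and "\<And>m. m \<ge> 1 \<Longrightarrow> continuous_on {0..1} (\<psi> m)"
    and "k \<ge> 1"
    and "continuous_on (cube k) f"
  shows "(\<exists>Y. is_hermite_polynomial N \<xi> \<psi> k f Y) \<and>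
         (\<forall>Y. is_hermite_polynomial N \<xi> \<psi> k f Y \<longrightarrow>
            weak_conv_m (\<lambda>n. distr M borel (rademacher_chaos \<epsilon> k f n)) (distr N borel Y))"
proof -
  interpret invariance M \<epsilon> \<psi> N \<xi> "{1..k}"
    by unfold_locales (use assms in auto)
  have poly: "is_hermite_polynomial N \<xi> \<psi> k f Y \<longleftrightarrow>
     (\<exists>c. L2_has_sum P (\<lambda>m x. c m * \<Psi> {1..k} m x) f indices \<and>
          L2_has_sum N (\<lambda>m z. c m * herm m z) Y indices)" for Y
    unfolding is_hermite_polynomial_def tensor_def herm_def hermite_product_eq ..
  show ?thesis
  proof (intro conjI allI impI)
    show "\<exists>Y. is_hermite_polynomial N \<xi> \<psi> k f Y"
      unfolding poly using tensor_basis[OF finJ assms(6)] hermite_series_converges by blast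
    show "weak_conv_m (\<lambda>n. distr M borel (rademacher_chaos \<epsilon> k f n)) (distr N borel Y)"
      if "is_hermite_polynomial N \<xi> \<psi> k f Y" for Y
      using that chaos_converges[OF assms(6)] unfolding poly rademacher_chaos_eq[OF assms(5)] by blast
  qed
qed

end
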